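(* Let $f_1(\mathbf{x})\in\mathbb{C}\{\mathbf{x}\}=\mathbb{C}\{x_0,\dots,x_n\}$ and $f_2(\mathbf{y})\in\mathbb{C}\{\mathbf{y}\}=\mathbb{C}\{y_0,\dots,y_m\}$ be germs of isolated hypersurface singularities in separated variables. Then: (1) $\tau_{f_1+f_2}=\mu_{f_1+f_2}-1$ if and only if either $\mu_{f_1}=\tau_{f_1}=1$ and $\mu_{f_2}-1=\tau_{f_2}$, or $\mu_{f_2}=\tau_{f_2}=1$ and $\mu_{f_1}-1=\tau_{f_1}$. (2) $\tau_{f_1+f_2}=\mu_{f_1+f_2}-2$ if and only if $f_1,f_2$ are in one of the following cases: (a) $\mu_{f_1}=\tau_{f_1}=1$ and $\mu_{f_2}-2=\tau_{f_2}$; (b) $\mu_{f_2}=\tau_{f_2}=1$ and $\mu_{f_1}-2=\tau_{f_1}$; (c) $\mu_{f_1}=\mu_{f_2}=2$ and $\tau_{f_1}=\tau_{f_2}=1$; (d) $\mu_{f_1}=\tau_{f_1}=2$ and $\mu_{f_2}-1=\tau_{f_2}$; (e) $\mu_{f_2}=\tau_{f_2}=2$ and $\mu_{f_1}-1=\tau_{f_1}$.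
   Context: A germ of isolated hypersurface singularity is a germ $f$ of holomorphic function at the origin with $f(0)=0$ that has an isolated critical point at the origin. For a germ $f$ in variables $z_0,\dots,z_k$, let $J_f=(\partial f/\partial z_0,\dots,\partial f/\partial z_k)$; the Milnor number is $\mu_f=\dim_{\mathbb{C}}\mathbb{C}\{z_0,\dots,z_k\}/J_f$ and the Tjurina number is $\tau_f=\dim_{\mathbb{C}}\mathbb{C}\{z_0,\dots,z_k\}/((f)+J_f)$. The join $f_1+f_2$ is regarded as a germ in $\mathbb{C}\{\mathbf{x};\mathbf{y}\}=\mathbb{C}\{x_0,\dots,x_n;y_0,\dots,y_m\}$. *)

theory Defs
  imports
    "HOL-Analysis.Analysis"
    "HOL-Algebra.QuotRing"
    "HOL-Algebra.Embedded_Algebras"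
begin

text \<open>
  A germ at the origin of a holomorphic function of the variables indexed by a finite type 'k is
  represented by its Taylor coefficients, a function on multi-indices 'k => nat; the holomorphic germs
  are exactly the convergent series, and partial derivatives are taken termwise.
\<close>

type_synonym 'k pseries = "('k \<Rightarrow> nat) \<Rightarrow> complex"

definition mpower :: "complex ^ 'k::finite \<Rightarrow> ('k \<Rightarrow> nat) \<Rightarrow> complex" where
  "mpower z \<alpha> = (\<Prod>i\<in>UNIV. (z $ i) ^ \<alpha> i)"

definition convergent_pseries :: "'k::finite pseries \<Rightarrow> bool" where
  "convergent_pseries f \<longleftrightarrow> (\<forall>\<^sub>F z in nhds 0. (\<lambda>\<alpha>. f \<alpha> * mpower z \<alpha>) summable_on UNIV)"

definition pseries_eval :: "'k::finite pseries \<Rightarrow> complex ^ 'k \<Rightarrow> complex" where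
  "pseries_eval f z = (\<Sum>\<^sub>\<infinity>\<alpha>. f \<alpha> * mpower z \<alpha>)"

definition pseries_const :: "complex \<Rightarrow> 'k::finite pseries" where
  "pseries_const c = (\<lambda>\<alpha>. if \<alpha> = (\<lambda>_. 0) then c else 0)"

definition pseries_deriv :: "'k::finite \<Rightarrow> 'k pseries \<Rightarrow> 'k pseries" where
  "pseries_deriv i f = (\<lambda>\<alpha>. of_nat (Suc (\<alpha> i)) * f (\<alpha>(i := Suc (\<alpha> i))))"

text \<open>
  The ring of convergent power series in the variables indexed by 'k. The product is the Cauchy
  product; order and subtraction of multi-indices are pointwise, so the sum runs over all ways to
  write the multi-index as a sum of two multi-indices.
\<close>

definition pseries_ring :: "'k::finite pseries ring" where
  "pseries_ring = \<lparr>carrier = Collect convergent_pseries,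
     mult = (\<lambda>f g \<gamma>. \<Sum>\<alpha>\<in>{..\<gamma>}. f \<alpha> * g (\<gamma> - \<alpha>)),
     one = pseries_const 1,
     zero = pseries_const 0,
     add = (\<lambda>f g \<alpha>. f \<alpha> + g \<alpha>)\<rparr>"

definition isolated_hypersurface_singularity :: "'k::finite pseries \<Rightarrow> bool" where
  "isolated_hypersurface_singularity f \<longleftrightarrow>
     f \<in> carrier pseries_ring \<and>
     pseries_eval f 0 = 0 \<and>
     (\<forall>i. pseries_eval (pseries_deriv i f) 0 = 0) \<and>
     (\<forall>\<^sub>F z in at 0. \<not> (\<forall>i. pseries_eval (pseries_deriv i f) z = 0))"

text \<open>
  The complex dimension of the quotient by an ideal, the scalars being the classes of the constant
  series. As with \<^const>\<open>card\<close>, the value is 0 if the dimension is infinite.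
\<close>

definition quotient_dim :: "'k::finite pseries set \<Rightarrow> nat" where
  "quotient_dim I =
     (let Q = pseries_ring Quot I;
          K = range (\<lambda>c. I +>\<^bsub>pseries_ring\<^esub> pseries_const c)
      in if ring.finite_dimension Q K (carrier Q)
         then ring.dim Q K (carrier Q) else 0)"

definition jacobian_ideal :: "'k::finite pseries \<Rightarrow> 'k pseries set" where
  "jacobian_ideal f = Idl\<^bsub>pseries_ring\<^esub> (range (\<lambda>i. pseries_deriv i f))"

definition milnor_number :: "'k::finite pseries \<Rightarrow> nat" where
  "milnor_number f = quotient_dim (jacobian_ideal f)"

definition tjurina_number :: "'k::finite pseries \<Rightarrow> nat" where
  "tjurina_number f =
     quotient_dim (Idl\<^bsub>pseries_ring\<^esub> {f} <+>\<^bsub>pseries_ring\<^esub> jacobian_ideal f)"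

text \<open>
  The variables of the join are indexed by the sum type; the two summands are the images of the
  given series under the inclusions of the rings in separate variables.
\<close>

definition pseries_inl :: "'n::finite pseries \<Rightarrow> ('n + 'm::finite) pseries" where
  "pseries_inl f = (\<lambda>\<alpha>. if \<forall>j. \<alpha> (Inr j) = 0 then f (\<lambda>i. \<alpha> (Inl i)) else 0)"

definition pseries_inr :: "'m::finite pseries \<Rightarrow> ('n::finite + 'm) pseries" where
  "pseries_inr g = (\<lambda>\<alpha>. if \<forall>i. \<alpha> (Inl i) = 0 then g (\<lambda>j. \<alpha> (Inr j)) else 0)"

definition germ_join :: "'n::finite pseries \<Rightarrow> 'm::finite pseries \<Rightarrow> ('n + 'm) pseries" where
  "germ_join f g = pseries_inl f \<oplus>\<^bsub>pseries_ring\<^esub> pseries_inr g"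

end

theory Submission
  imports Defs "HOL-Library.Function_Algebras"
begin

text \<open>
  Let \<open>J\<^sub>i\<close> be the Jacobian ideals, \<open>\<mu>\<^sub>i\<close> and \<open>\<tau>\<^sub>i\<close> the Milnor and Tjurina numbers, and \<open>K\<close> the
  ideal generated by \<open>J\<^sub>1\<close> and \<open>J\<^sub>2\<close>, the Jacobian ideal of the join. Codimensions are
  multiplicative: an ideal of finite codimension contains a power of every variable, so modulo \<open>K\<close>
  only finitely many monomials matter, and functionals killing \<open>J\<^sub>2\<close> involve finitely many
  coefficients and can be applied to a series in all variables, with values modulo \<open>J\<^sub>1\<close>.
  If \<open>f\<^sub>1 \<in> J\<^sub>1\<close>, then \<open>K + (f\<^sub>1 + f\<^sub>2) = K + (f\<^sub>2)\<close> and \<open>\<mu> - \<tau> = \<mu>\<^sub>1 (\<mu>\<^sub>2 - \<tau>\<^sub>2)\<close>; symmetrically for \<open>f\<^sub>2\<close>.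
  Otherwise let \<open>f\<^sub>2\<^sup>k\<close>, \<open>k \<ge> 1\<close>, be the last power outside \<open>J\<^sub>2\<close>. The product \<open>f\<^sub>1 f\<^sub>2\<^sup>k\<close> lies in
  \<open>K + (f\<^sub>1 + f\<^sub>2)\<close> and in \<open>K + (f\<^sub>2)\<close> but not in \<open>K\<close>, so the modular law gives
  \<open>\<mu> - \<tau> \<ge> 1 + (\<mu>\<^sub>1 - \<tau>\<^sub>1) \<tau>\<^sub>2\<close>. With the symmetric bound, \<open>\<mu> - \<tau> = 1\<close> is impossible
  and \<open>\<mu> - \<tau> = 2\<close> forces \<open>\<mu>\<^sub>i = 2\<close>, \<open>\<tau>\<^sub>i = 1\<close>; conversely this case gives \<open>2\<close> because
  \<open>f\<^sub>2 \<in> K + (f\<^sub>1 + f\<^sub>2)\<close> would imply \<open>f\<^sub>1 f\<^sub>2 \<in> K\<close>. If some \<open>J\<^sub>i\<close> had infinite codimension, then so would \<open>K\<close>,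
  and under the convention that such a dimension is \<open>0\<close> both sides of each equivalence are false.
\<close>

subsection \<open>Flags of subspaces\<close>

text \<open>The sum of the two germs mixes the variables, so the Tjurina ideal of the join is in
  general not generated by series in separate variables and its codimension is not a product. Ideals
  obtained by adding the germs separately do have this form. The lower bound compares with them: for
  P = K + (f1 + f2) and Q = K + (f2), the sum P + Q contains both germs, so the codimensions mu1
  tau2 of Q and tau1 tau2 of P + Q are known, and an element of P \<inter> Q outside K saves one
  more dimension. Such an element comes from f1 f2^k = (f1 + f2) f2^k - f2^(k+1). As mu_i - tau_i
  and tau_i are positive in this situation, a drop of 2 makes all four of them 1. Convergence enters
  through coefficient bounds C R^|\<alpha>|. The one further convergence argument is the inversion
  of a one-variable unit, which turns a linear relation between powers of a variable into a power of
  that variable inside the ideal.\<close>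

locale flag_space = vector_space scale for scale :: "'a::field \<Rightarrow> 'b::ab_group_add \<Rightarrow> 'b"
begin

text \<open>The counterpart of \<open>line_extension\<close> in \<open>HOL-Algebra\<close>;
  \<open>line_extension_quot\<close> matches the two.\<close>

definition adjoin :: "'b \<Rightarrow> 'b set \<Rightarrow> 'b set" where
  "adjoin v E = {x. \<exists>c. x - scale c v \<in> E}"

text \<open>
  \<open>flag I n E\<close> is the notion \<open>dimension\<close> of \<open>HOL-Algebra\<close> relative to a base \<open>I\<close>: the subspace
  \<open>E\<close> is reached from \<open>I\<close> by adjoining \<open>n\<close> vectors, so \<open>flag I n V\<close> says that \<open>I\<close> has codimension
  \<open>n\<close> in \<open>V\<close>.
\<close>

inductive flag :: "'b set \<Rightarrow> nat \<Rightarrow> 'b set \<Rightarrow> bool" for I where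
  flag_0: "flag I 0 I"
| flag_Suc: "flag I n E \<Longrightarrow> v \<notin> E \<Longrightarrow> flag I (Suc n) (adjoin v E)"

lemma adjoin_incl: "E \<subseteq> adjoin v E"
proof
  fix x assume "x \<in> E"
  then have "x - scale 0 v \<in> E" by simp
  then show "x \<in> adjoin v E" unfolding adjoin_def by blast
qed

lemma mem_adjoin: "subspace E \<Longrightarrow> v \<in> adjoin v E"
  unfolding adjoin_def by (auto intro!: exI[of _ 1] simp: subspace_0)

lemma subspace_adjoin:
  assumes "subspace E" shows "subspace (adjoin v E)"
  unfolding subspace_def
proof (intro conjI ballI allI)
  show "0 \<in> adjoin v E" using adjoin_incl subspace_0[OF assms] by blast
next
  fix x y assume "x \<in> adjoin v E" "y \<in> adjoin v E"
  then obtain c d where "x - scale c v \<in> E" "y - scale d v \<in> E" unfolding adjoin_def by blast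
  then have "(x - scale c v) + (y - scale d v) \<in> E" using assms subspace_add by blast
  then have "x + y - scale (c + d) v \<in> E" by (simp add: algebra_simps)
  then show "x + y \<in> adjoin v E" unfolding adjoin_def by blast
next
  fix a x assume "x \<in> adjoin v E"
  then obtain c where "x - scale c v \<in> E" unfolding adjoin_def by blast
  then have "scale a (x - scale c v) \<in> E" using assms subspace_scale by blast
  then have "scale a x - scale (a * c) v \<in> E" by (simp add: scale_right_diff_distrib)
  then show "scale a x \<in> adjoin v E" unfolding adjoin_def by blast
qed

lemma adjoin_subset: "subspace F \<Longrightarrow> E \<subseteq> F \<Longrightarrow> v \<in> F \<Longrightarrow> adjoin v E \<subseteq> F"
proof
  fix x assume F: "subspace F" "E \<subseteq> F" "v \<in> F" and "x \<in> adjoin v E"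
  then obtain c where "x - scale c v \<in> F" unfolding adjoin_def by blast
  then have "(x - scale c v) + scale c v \<in> F" using F subspace_add subspace_scale by blast
  then show "x \<in> F" by simp
qed

lemma adjoin_commute: "adjoin u (adjoin v E) = adjoin v (adjoin u E)"
proof -
  have "x - scale c u - scale d v = x - scale d v - scale c u" for x c d
    by (simp add: diff_diff_eq add.commute)
  then have "(\<exists>c d. x - scale c u - scale d v \<in> E) \<longleftrightarrow> (\<exists>d c. x - scale d v - scale c u \<in> E)" for x
    by metis
  then show ?thesis unfolding adjoin_def mem_Collect_eq by blast
qed

text \<open>Steinitz exchange: the coefficient of \<open>v\<close> in \<open>u\<close> is nonzero
  because \<open>u\<close> lies outside \<open>E\<close>, so it can be divided out.\<close>

lemma adjoin_exchange:
  assumes "subspace E" "u \<in> adjoin v E" "u \<notin> E"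
  shows "adjoin u E = adjoin v E"
proof -
  obtain c where c: "u - scale c v \<in> E" using assms unfolding adjoin_def by blast
  have "c \<noteq> 0" using c assms(3) by auto
  have "scale (- inverse c) (u - scale c v) \<in> E" using c assms(1) subspace_scale by blast
  then have "v - scale (inverse c) u \<in> E"
    using \<open>c \<noteq> 0\<close> by (simp add: scale_right_diff_distrib)
  then have "v \<in> adjoin u E" unfolding adjoin_def by blast
  then show ?thesis
    using adjoin_subset[OF subspace_adjoin adjoin_incl] assms by (simp add: subset_antisym)
qed

lemma flag_zeroD: "flag I 0 E \<Longrightarrow> E = I"
  by (auto elim: flag.cases)

lemma flag_SucD: "flag I (Suc n) E \<Longrightarrow> \<exists>v F. v \<notin> F \<and> flag I n F \<and> E = adjoin v F"
  by (erule flag.cases) auto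

lemma flag_subspace: "flag I n E \<Longrightarrow> subspace I \<Longrightarrow> subspace E"
  by (induction rule: flag.induct) (auto simp: subspace_adjoin)

lemma flag_incl: "flag I n E \<Longrightarrow> I \<subseteq> E"
  by (induction rule: flag.induct) (use adjoin_incl in auto)

lemma flag_trans:
  assumes "flag I n E" "flag E m W" shows "flag I (n + m) W"
  using assms(2,1) by (induction rule: flag.induct) (auto intro: flag.intros)

text \<open>Moves a vector to the bottom of a flag, the device behind \<open>flag_split\<close> and
  \<open>flag_unique\<close>. A new vector commutes past every step; a vector already reached makes
  exactly one step redundant. The two claims share an induction because the second uses the
  first.\<close>

lemma flag_adjoin_bottom:
  assumes "flag I n E" "subspace I"
  shows "(v \<notin> E \<longrightarrow> flag (adjoin v I) n (adjoin v E)) \<and>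
         (v \<in> E \<longrightarrow> v \<notin> I \<longrightarrow> (\<exists>m. n = Suc m \<and> flag (adjoin v I) m E))"
  using assms
proof (induction rule: flag.induct)
  case flag_0
  then show ?case by (auto intro: flag.intros)
next
  case (flag_Suc n E u)
  have E: "subspace E" using flag_Suc flag_subspace by blast
  show ?case
  proof (intro conjI impI)
    assume v: "v \<notin> adjoin u E"
    \<comment> \<open>Otherwise the exchange property would put \<open>v\<close> into
      \<open>adjoin u E\<close>.\<close>
    have "u \<notin> adjoin v E"
      using adjoin_exchange[OF E _ flag_Suc(2), of v] v mem_adjoin[OF E] by blast
    moreover have "flag (adjoin v I) n (adjoin v E)" using v flag_Suc adjoin_incl by blast
    ultimately show "flag (adjoin v I) (Suc n) (adjoin v (adjoin u E))"
      by (subst adjoin_commute) (auto intro: flag.intros)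
  next
    assume v: "v \<in> adjoin u E" "v \<notin> I"
    show "\<exists>m. Suc n = Suc m \<and> flag (adjoin v I) m (adjoin u E)"
    proof (cases "v \<in> E")
      case True
      then obtain m where "n = Suc m" "flag (adjoin v I) m E" using flag_Suc v by blast
      then show ?thesis using flag_Suc by (auto intro: flag.intros)
    next
      \<comment> \<open>Here \<open>v\<close> is first reached by adjoining \<open>u\<close>, so it
        can replace \<open>u\<close> and this step is the one saved.\<close>
      case False
      then show ?thesis using adjoin_exchange[OF E v(1) False] flag_Suc by auto
    qed
  qed
qed

text \<open>Moving a vector of \<open>E\<close> outside \<open>I\<close> to the bottom shortens the
  flag to \<open>W\<close> by one; the recursion stops when the base has grown to
  \<open>E\<close>.\<close>

lemma flag_split:
  assumes "flag I n W" "subspace I" "subspace E" "I \<subseteq> E" "E \<subseteq> W"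
  shows "\<exists>m k. n = m + k \<and> flag I m E \<and> flag E k W"
  using assms
proof (induction n arbitrary: I)
  case 0
  then have "I = W" using flag_zeroD by blast
  then show ?case using 0 by (auto intro: flag.intros)
next
  case (Suc n)
  show ?case
  proof (cases "I = E")
    case True
    then show ?thesis using Suc.prems(1) flag_0[of E] by (intro exI[of _ 0] exI[of _ "Suc n"]) simp
  next
    case False
    then obtain v where v: "v \<in> E" "v \<notin> I" using Suc by blast
    then have "flag (adjoin v I) n W" using flag_adjoin_bottom[OF Suc.prems(1,2), of v] Suc by auto
    then obtain m k where mk: "n = m + k" "flag (adjoin v I) m E" "flag E k W"
      using Suc.IH[OF _ subspace_adjoin[OF Suc.prems(2)] Suc.prems(3)
          adjoin_subset[OF Suc.prems(3,4) v(1)] Suc.prems(5)] by blast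
    have "flag I (Suc 0 + m) E"
      using mk v by (intro flag_trans[of _ "Suc 0"]) (auto intro: flag.intros)
    then show ?thesis using mk by (intro exI[of _ "Suc 0 + m"] exI[of _ k]) auto
  qed
qed

lemma flag_unique:
  assumes "flag I n E" "flag I m E" "subspace I" shows "n = m"
  using assms
proof (induction n arbitrary: m I)
  case 0
  then have "I = E" using flag_zeroD by blast
  show ?case
  proof (cases m)
    case (Suc m')
    then obtain v F where "v \<notin> F" "flag I m' F" "E = adjoin v F" using 0(2) flag_SucD by blast
    then show ?thesis
      using \<open>I = E\<close> flag_incl[of I m' F] mem_adjoin[OF flag_subspace[OF _ 0(3)]] by blast
  qed simp
next
  case (Suc n)
  then obtain v F where vF: "v \<notin> F" "flag I n F" "E = adjoin v F" using flag_SucD by blast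
  then have "v \<notin> I" "v \<in> E"
    using flag_incl[OF vF(2)] mem_adjoin[OF flag_subspace[OF vF(2) Suc.prems(3)]] by blast+
  then obtain m' where "m = Suc m'" "flag (adjoin v I) m' E" "flag (adjoin v I) n E"
    using flag_adjoin_bottom[OF Suc.prems(1,3), of v] flag_adjoin_bottom[OF Suc.prems(2,3), of v] by auto
  then show ?case using Suc.IH[OF _ _ subspace_adjoin[OF Suc.prems(3)]] by blast
qed

lemma flag_le:
  assumes "flag I n W" "flag I m E" "E \<subseteq> W" "subspace I" shows "m \<le> n"
proof -
  obtain a b where "n = a + b" "flag I a E"
    using flag_split[OF assms(1,4) flag_subspace[OF assms(2,4)]] flag_incl[OF assms(2)] assms by blast
  then show ?thesis using flag_unique[OF _ assms(2,4)] by auto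
qed

text \<open>The source of finite codimension for all larger ideals; the clause on
  \<open>m = n\<close> turns a proper inclusion into a strict drop.\<close>

lemma flag_codim_mono:
  assumes "flag I n W" "subspace I" "subspace E" "I \<subseteq> E" "E \<subseteq> W"
  obtains m where "flag E m W" "m \<le> n" "m = n \<Longrightarrow> E = I"
proof -
  obtain a b where ab: "n = a + b" "flag I a E" "flag E b W" using flag_split[OF assms] by blast
  moreover have "E = I" if "b = n" using that ab flag_zeroD by auto
  ultimately show thesis using that by auto
qed

text \<open>Infinite codimension in a form that \<open>flag_image\<close> can transport: since no
  flag reaches \<open>W\<close>, it can always be prolonged inside \<open>W\<close>.\<close>

lemma long_flag_if_infinite:
  assumes "\<nexists>n. flag I n W" "subspace I" "I \<subseteq> W" "subspace W"
  shows "\<exists>E. flag I n E \<and> E \<subseteq> W"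
proof (induction n)
  case 0
  then show ?case using assms flag.intros by blast
next
  case (Suc n)
  then obtain E where E: "flag I n E" "E \<subseteq> W" by blast
  have "E \<noteq> W" using E(1) assms(1) by auto
  then obtain v where "v \<in> W" "v \<notin> E" using E(2) by blast
  then show ?case using E adjoin_subset[OF assms(4)] flag.intros by blast
qed

section \<open>Linear combinations and independence modulo a subspace\<close>

definition combs :: "'b set \<Rightarrow> ('i \<Rightarrow> 'b) \<Rightarrow> 'i set \<Rightarrow> 'b set" where
  "combs I w A = {x. \<exists>c. x - (\<Sum>a\<in>A. scale (c a) (w a)) \<in> I}"

text \<open>The index type is arbitrary because \<open>codim_join\<close> indexes a basis by
  pairs.\<close>

definition free_mod :: "'b set \<Rightarrow> ('i \<Rightarrow> 'b) \<Rightarrow> 'i set \<Rightarrow> bool" where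
  "free_mod I w A \<longleftrightarrow> (\<forall>c. (\<Sum>a\<in>A. scale (c a) (w a)) \<in> I \<longrightarrow> (\<forall>a\<in>A. c a = 0))"

lemma combs_empty [simp]: "combs I w {} = I"
  by (simp add: combs_def)

lemma combs_insert:
  assumes "finite A" "b \<notin> A"
  shows "combs I w (insert b A) = adjoin (w b) (combs I w A)"
proof -
  have "x \<in> combs I w (insert b A) \<longleftrightarrow> x \<in> adjoin (w b) (combs I w A)" for x
  proof
    assume "x \<in> combs I w (insert b A)"
    then obtain c where "x - (\<Sum>a\<in>insert b A. scale (c a) (w a)) \<in> I" unfolding combs_def by blast
    then have "(x - scale (c b) (w b)) - (\<Sum>a\<in>A. scale (c a) (w a)) \<in> I"
      using assms by (simp add: algebra_simps)
    then show "x \<in> adjoin (w b) (combs I w A)" unfolding adjoin_def combs_def by blast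
  next
    assume "x \<in> adjoin (w b) (combs I w A)"
    then obtain d c where dc: "(x - scale d (w b)) - (\<Sum>a\<in>A. scale (c a) (w a)) \<in> I"
      unfolding adjoin_def combs_def by blast
    have "(\<Sum>a\<in>A. scale ((c(b := d)) a) (w a)) = (\<Sum>a\<in>A. scale (c a) (w a))"
      using assms by (intro sum.cong) auto
    then have "x - (\<Sum>a\<in>insert b A. scale ((c(b := d)) a) (w a)) \<in> I"
      using dc assms by (simp add: algebra_simps)
    then show "x \<in> combs I w (insert b A)" unfolding combs_def by blast
  qed
  then show ?thesis by blast
qed

lemma free_mod_insert:
  assumes "finite A" "b \<notin> A" "subspace I"
  shows "free_mod I w (insert b A) \<longleftrightarrow> free_mod I w A \<and> w b \<notin> combs I w A"
proof (intro iffI conjI)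
  assume f: "free_mod I w (insert b A)"
  show "free_mod I w A" unfolding free_mod_def
  proof (intro allI impI ballI)
    fix c a assume c: "(\<Sum>a\<in>A. scale (c a) (w a)) \<in> I" "a \<in> A"
    have "(\<Sum>a\<in>A. scale ((c(b := 0)) a) (w a)) = (\<Sum>a\<in>A. scale (c a) (w a))"
      using assms by (intro sum.cong) auto
    then have "(\<Sum>a\<in>insert b A. scale ((c(b := 0)) a) (w a)) \<in> I" using c assms by simp
    then have "(c(b := 0)) a = 0" using f c(2) unfolding free_mod_def by blast
    then show "c a = 0" using c(2) assms(2) by (auto split: if_splits)
  qed
  show "w b \<notin> combs I w A"
  proof
    assume "w b \<in> combs I w A"
    then obtain c where c: "w b - (\<Sum>a\<in>A. scale (c a) (w a)) \<in> I" unfolding combs_def by blast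
    have "(\<Sum>a\<in>A. scale (((\<lambda>a. - c a)(b := 1)) a) (w a)) = - (\<Sum>a\<in>A. scale (c a) (w a))"
      unfolding sum_negf[symmetric] using assms by (intro sum.cong) auto
    then have "(\<Sum>a\<in>insert b A. scale (((\<lambda>a. - c a)(b := 1)) a) (w a)) \<in> I" using c assms by simp
    then have "((\<lambda>a. - c a)(b := 1)) b = 0" using f unfolding free_mod_def by blast
    then show False by simp
  qed
next
  assume f: "free_mod I w A \<and> w b \<notin> combs I w A"
  show "free_mod I w (insert b A)" unfolding free_mod_def
  proof (intro allI impI)
    fix c assume "(\<Sum>a\<in>insert b A. scale (c a) (w a)) \<in> I"
    then have c: "scale (c b) (w b) + (\<Sum>a\<in>A. scale (c a) (w a)) \<in> I" using assms by simp
    have "c b = 0"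
    proof (rule ccontr)
      assume n: "c b \<noteq> 0"
      have "scale (inverse (c b)) (scale (c b) (w b) + (\<Sum>a\<in>A. scale (c a) (w a))) \<in> I"
        using c assms subspace_scale by blast
      then have "w b - (\<Sum>a\<in>A. scale (- inverse (c b) * c a) (w a)) \<in> I"
        using n by (simp add: scale_right_distrib scale_sum_right sum_negf)
      then have "w b \<in> combs I w A" unfolding combs_def mem_Collect_eq
        by (rule exI[of _ "\<lambda>a. - inverse (c b) * c a"])
      then show False using f by blast
    qed
    then show "\<forall>a\<in>insert b A. c a = 0" using f c unfolding free_mod_def by auto
  qed
qed

lemma flag_combs:
  assumes "finite A" "free_mod I w A" "subspace I"
  shows "flag I (card A) (combs I w A)"
  using assms
proof (induction A rule: finite_induct)
  case empty
  then show ?case by (auto intro: flag.intros)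
next
  case (insert b A)
  then show ?case by (auto simp: combs_insert free_mod_insert intro: flag.intros)
qed

lemma combs_cong: "(\<And>a. a \<in> A \<Longrightarrow> w a = w' a) \<Longrightarrow> combs I w A = combs I w' A"
  unfolding combs_def by (auto cong: sum.cong)

lemma free_mod_cong: "(\<And>a. a \<in> A \<Longrightarrow> w a = w' a) \<Longrightarrow> free_mod I w A = free_mod I w' A"
  unfolding free_mod_def by (auto cong: sum.cong)

text \<open>Converse of \<open>flag_combs\<close>: the vectors adjoined along the flag, numbered in
  the order of adjunction, are the basis.\<close>

lemma flag_basis:
  assumes "flag I n E" "subspace I"
  shows "\<exists>w. (\<forall>i<n. w i \<in> E) \<and> free_mod I w {..<n} \<and> E = combs I w {..<n}"
  using assms
proof (induction rule: flag.induct)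
  case flag_0
  then show ?case by (auto simp: free_mod_def)
next
  case (flag_Suc n E v)
  then obtain w where w: "\<forall>i<n. w i \<in> E" "free_mod I w {..<n}" "E = combs I w {..<n}" by blast
  have c: "combs I (w(n := v)) {..<n} = E" using w combs_cong[of "{..<n}" "w(n := v)" w] by auto
  have f: "free_mod I (w(n := v)) {..<n}" using w free_mod_cong[of "{..<n}" "w(n := v)" w] by auto
  have E: "subspace E" using flag_Suc flag_subspace by blast
  show ?case
  proof (intro exI[of _ "w(n := v)"] conjI allI impI)
    fix i assume "i < Suc n"
    then show "(w(n := v)) i \<in> adjoin v E"
      using w mem_adjoin[OF E] adjoin_incl[of E v] by (cases "i = n") auto
  next
    show "free_mod I (w(n := v)) {..<Suc n}"
      using f c flag_Suc by (simp add: lessThan_Suc free_mod_insert)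
    show "adjoin v E = combs I (w(n := v)) {..<Suc n}"
      using c by (simp add: lessThan_Suc combs_insert)
  qed
qed

end

section \<open>Flags under linear maps\<close>

locale flag_space_pair = vs1: flag_space scale1 + vs2: flag_space scale2
  for scale1 :: "'a::field \<Rightarrow> 'b::ab_group_add \<Rightarrow> 'b" and scale2 :: "'a \<Rightarrow> 'c::ab_group_add \<Rightarrow> 'c"

text \<open>By the last assumption \<open>T\<close> is injective on \<open>B\<close> modulo
  \<open>A\<close> and \<open>A'\<close>, so it preserves independence. The space reached is the sum
  of \<open>A'\<close> and the image of \<open>B\<close>; for the identity map this is the second
  isomorphism theorem.\<close>

lemma (in flag_space_pair) flag_image:
  assumes "vs1.flag A n B" and T: "Vector_Spaces.linear scale1 scale2 T"
    and A: "vs1.subspace A" and A': "vs2.subspace A'"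
    and iff: "\<And>x. x \<in> B \<Longrightarrow> T x \<in> A' \<longleftrightarrow> x \<in> A"
  shows "vs2.flag A' n {y. \<exists>x\<in>B. y - T x \<in> A'}"
  using assms(1,5)
proof (induction rule: vs1.flag.induct)
  case flag_0
  interpret T: Vector_Spaces.linear scale1 scale2 T by fact
  have "{y. \<exists>x\<in>A. y - T x \<in> A'} = A'"
  proof safe
    fix y x assume "x \<in> A" "y - T x \<in> A'"
    then have "(y - T x) + T x \<in> A'" using flag_0 A' vs2.subspace_add by blast
    then show "y \<in> A'" by simp
  next
    fix y assume "y \<in> A'"
    then show "\<exists>x\<in>A. y - T x \<in> A'" using vs1.subspace_0[OF A] T.zero by (intro bexI[of _ 0]) auto
  qed
  then show ?case by (auto intro: vs2.flag.intros)
next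
  case (flag_Suc n B v)
  interpret T: Vector_Spaces.linear scale1 scale2 T by fact
  have B: "vs1.subspace B" using flag_Suc vs1.flag_subspace A by blast
  let ?B' = "{y. \<exists>x\<in>B. y - T x \<in> A'}"
  have IH: "vs2.flag A' n ?B'" using flag_Suc vs1.adjoin_incl by blast
  have "T v \<notin> ?B'"
  proof
    assume "T v \<in> ?B'"
    then obtain x where x: "x \<in> B" "T v - T x \<in> A'" by blast
    then have xv: "T (v - x) \<in> A'" by (simp add: T.diff)
    have "v - x \<in> vs1.adjoin v B"
      using x B vs1.adjoin_incl vs1.mem_adjoin vs1.subspace_adjoin vs1.subspace_diff by blast
    then have "v - x \<in> A" using flag_Suc.prems xv by blast
    then have "v - x \<in> B" using vs1.flag_incl[OF flag_Suc(1)] by blast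
    then have "(v - x) + x \<in> B" using x B vs1.subspace_add by blast
    then show False using flag_Suc by simp
  qed
  then have "vs2.flag A' (Suc n) (vs2.adjoin (T v) ?B')" using IH vs2.flag.intros by blast
  moreover have "vs2.adjoin (T v) ?B' = {y. \<exists>x\<in>vs1.adjoin v B. y - T x \<in> A'}"
  proof safe
    fix y assume "y \<in> vs2.adjoin (T v) ?B'"
    then obtain c x where cx: "x \<in> B" "y - scale2 c (T v) - T x \<in> A'" unfolding vs2.adjoin_def by blast
    then have "y - T (x + scale1 c v) \<in> A'" by (simp add: T.add T.scale algebra_simps)
    moreover have "x + scale1 c v \<in> vs1.adjoin v B"
      using cx unfolding vs1.adjoin_def by (auto intro!: exI[of _ c])
    ultimately show "\<exists>x\<in>vs1.adjoin v B. y - T x \<in> A'" by blast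
  next
    fix y x assume x: "x \<in> vs1.adjoin v B" "y - T x \<in> A'"
    then obtain c where c: "x - scale1 c v \<in> B" unfolding vs1.adjoin_def by blast
    have "(y - scale2 c (T v)) - T (x - scale1 c v) = y - T x" by (simp add: T.diff T.scale)
    then have "\<exists>x\<in>B. (y - scale2 c (T v)) - T x \<in> A'" using c x by metis
    then show "y \<in> vs2.adjoin (T v) ?B'" unfolding vs2.adjoin_def by blast
  qed
  ultimately show ?case by simp
qed

subsection \<open>The ring of convergent power series\<close>

text \<open>Linear algebra takes place in the space of all coefficient families, in which the
  convergent ones form a subspace.\<close>

definition smul :: "complex \<Rightarrow> 'k pseries \<Rightarrow> 'k pseries" where
  "smul c f = (\<lambda>\<alpha>. c * f \<alpha>)"

lemma smul_apply [simp]: "smul c f \<alpha> = c * f \<alpha>"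
  by (simp add: smul_def)

interpretation pv: flag_space smul
  by unfold_locales (auto simp: fun_eq_iff algebra_simps)

interpretation pvp: flag_space_pair smul smul ..

abbreviation pmult :: "'k::finite pseries \<Rightarrow> 'k pseries \<Rightarrow> 'k pseries" (infixl \<open>\<star>\<close> 70) where
  "f \<star> g \<equiv> f \<otimes>\<^bsub>pseries_ring\<^esub> g"

abbreviation conv_series :: "'k::finite pseries set" where
  "conv_series \<equiv> carrier pseries_ring"

lemma pmult_apply: "(f \<star> g) \<gamma> = (\<Sum>\<alpha>\<in>{..\<gamma>}. f \<alpha> * g (\<gamma> - \<alpha>))"
  by (simp add: pseries_ring_def)

lemma padd_eq [simp]: "f \<oplus>\<^bsub>pseries_ring\<^esub> g = f + g"
  by (simp add: pseries_ring_def plus_fun_def)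

lemma pzero_eq [simp]: "\<zero>\<^bsub>pseries_ring\<^esub> = 0"
  by (simp add: pseries_ring_def pseries_const_def fun_eq_iff)

lemma pone_eq [simp]: "\<one>\<^bsub>pseries_ring\<^esub> = pseries_const 1"
  by (simp add: pseries_ring_def)

lemma finite_atMost_fun [simp, intro]: "finite {..\<gamma> :: 'k::finite \<Rightarrow> nat}"
proof -
  have "{..\<gamma>} = (\<Pi>\<^sub>E i\<in>UNIV. {..\<gamma> i})" by (auto simp: le_fun_def PiE_def Pi_def)
  then show ?thesis by (simp add: finite_PiE)
qed

lemma mpower_const: "mpower (\<chi> i. t) \<alpha> = t ^ (\<Sum>i\<in>UNIV. \<alpha> i)"
  by (simp add: mpower_def power_sum)

text \<open>From n + 1 \<le> 2^n in each variable. This lets \<open>conv_mult\<close> absorb the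
  number of terms of a Cauchy product by doubling the base of the growth bound.\<close>

lemma card_atMost_fun_le: "card {..\<gamma> :: 'k::finite \<Rightarrow> nat} \<le> 2 ^ (\<Sum>i\<in>UNIV. \<gamma> i)"
proof -
  have "{..\<gamma>} = (\<Pi>\<^sub>E i\<in>UNIV. {..\<gamma> i})" by (auto simp: le_fun_def PiE_def Pi_def)
  then have "card {..\<gamma>} = (\<Prod>i\<in>UNIV. Suc (\<gamma> i))" by (simp add: card_PiE)
  also have "\<dots> \<le> (\<Prod>i\<in>UNIV. 2 ^ \<gamma> i)"
    by (intro prod_mono) (auto simp: Suc_le_eq)
  also have "\<dots> = 2 ^ (\<Sum>i\<in>UNIV. \<gamma> i)" by (simp add: power_sum)
  finally show ?thesis .
qed

text \<open>The sum factors into one-variable geometric sums, each at most 2. Uniformity in \<gamma>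
  is what yields summability over all multi-indices.\<close>

lemma sum_geometric_multi_le:
  "(\<Sum>\<alpha>\<in>{..\<gamma>}. (1/2::real) ^ (\<Sum>i\<in>UNIV. \<alpha> i)) \<le> 2 ^ CARD('k)" for \<gamma> :: "'k::finite \<Rightarrow> nat"
proof -
  have eq: "{..\<gamma>} = (\<Pi>\<^sub>E i\<in>UNIV. {..\<gamma> i})" by (auto simp: le_fun_def PiE_def Pi_def)
  have "(\<Sum>\<alpha>\<in>{..\<gamma>}. (1/2::real) ^ (\<Sum>i\<in>UNIV. \<alpha> i)) = (\<Sum>\<alpha>\<in>{..\<gamma>}. \<Prod>i\<in>UNIV. (1/2) ^ \<alpha> i)"
    by (simp add: power_sum)
  also have "\<dots> = (\<Prod>i\<in>UNIV. \<Sum>a\<in>{..\<gamma> i}. (1/2::real) ^ a)"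
    unfolding eq by (subst prod_sum_PiE) auto
  also have "\<dots> \<le> (\<Prod>i\<in>(UNIV::'k set). 2)"
  proof (intro prod_mono conjI)
    fix i
    show "(\<Sum>a\<in>{..\<gamma> i}. (1/2::real) ^ a) \<le> 2"
      using sum_gp0[of "1/2::real" "\<gamma> i"] by simp
  qed (auto intro: sum_nonneg)
  finally show ?thesis by simp
qed

text \<open>Together with \<open>conv_seriesE\<close> this replaces convergence by a Cauchy
  estimate, which is easily checked for sums, products, shifts, slices and derivatives. Where all
  coordinates are at most 1/(2R), the terms are dominated by C 2^(-|\<alpha>|).\<close>

lemma conv_seriesI:
  fixes f :: "'k::finite pseries"
  assumes "R \<ge> 1" "\<And>\<alpha>. norm (f \<alpha>) \<le> C * R ^ (\<Sum>i\<in>UNIV. \<alpha> i)"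
  shows "f \<in> conv_series"
proof -
  have "(\<lambda>\<alpha>. f \<alpha> * mpower z \<alpha>) summable_on UNIV" if z: "dist z 0 < 1 / (2 * R)" for z :: "complex ^ 'k"
  proof -
    have C: "C \<ge> 0" using order_trans[OF norm_ge_zero assms(2)[of "\<lambda>_. 0"]] by simp
    have t: "norm (f \<alpha> * mpower z \<alpha>) \<le> C * (1/2) ^ (\<Sum>i\<in>UNIV. \<alpha> i)" for \<alpha>
    proof -
      have zi: "norm (z $ i) \<le> 1 / (2 * R)" for i
        using Finite_Cartesian_Product.norm_nth_le[of z i] z by simp
      have "norm (mpower z \<alpha>) = (\<Prod>i\<in>UNIV. norm (z $ i) ^ \<alpha> i)"
        by (simp add: mpower_def prod_norm norm_power flip: prod_norm)
      also have "\<dots> \<le> (\<Prod>i\<in>UNIV. (1 / (2 * R)) ^ \<alpha> i)"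
        using zi by (intro prod_mono) (auto intro: power_mono)
      also have "\<dots> = (1 / (2 * R)) ^ (\<Sum>i\<in>UNIV. \<alpha> i)" by (simp add: power_sum)
      finally have "norm (f \<alpha> * mpower z \<alpha>) \<le> (C * R ^ (\<Sum>i\<in>UNIV. \<alpha> i)) * (1 / (2 * R)) ^ (\<Sum>i\<in>UNIV. \<alpha> i)"
        unfolding norm_mult using assms C by (intro mult_mono) auto
      also have "\<dots> = C * (1/2) ^ (\<Sum>i\<in>UNIV. \<alpha> i)"
        using assms(1) by (simp add: power_mult_distrib power_divide field_simps)
      finally show ?thesis .
    qed
    have "(\<lambda>\<alpha>. C * (1/2) ^ (\<Sum>i\<in>UNIV. \<alpha> i)) summable_on (UNIV :: ('k \<Rightarrow> nat) set)"
    proof (rule nonneg_bdd_above_summable_on)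
      show "bdd_above (sum (\<lambda>\<alpha>. C * (1/2) ^ (\<Sum>i\<in>UNIV. \<alpha> i)) ` {F. F \<subseteq> (UNIV :: ('k \<Rightarrow> nat) set) \<and> finite F})"
      proof (rule bdd_aboveI2)
        fix F :: "('k \<Rightarrow> nat) set" assume "F \<in> {F. F \<subseteq> UNIV \<and> finite F}"
        then have F: "finite F" by auto
        \<comment> \<open>The sum of all members of \<open>F\<close> dominates each of them, so
          \<open>F\<close> lies in a single box.\<close>
        define \<gamma> where "\<gamma> = (\<lambda>i. \<Sum>\<alpha>\<in>F. \<alpha> i)"
        have sub: "F \<subseteq> {..\<gamma>}" using F by (auto simp: \<gamma>_def le_fun_def intro: member_le_sum)
        have "(\<Sum>\<alpha>\<in>F. C * (1/2) ^ (\<Sum>i\<in>UNIV. \<alpha> i)) \<le> (\<Sum>\<alpha>\<in>{..\<gamma>}. C * (1/2) ^ (\<Sum>i\<in>UNIV. \<alpha> i))"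
          using C sub by (intro sum_mono2) auto
        also have "\<dots> \<le> C * 2 ^ CARD('k)"
          unfolding sum_distrib_left[symmetric] using C sum_geometric_multi_le by (intro mult_left_mono) auto
        finally show "(\<Sum>\<alpha>\<in>F. C * (1/2) ^ (\<Sum>i\<in>UNIV. \<alpha> i)) \<le> C * 2 ^ CARD('k)" .
      qed
    qed (use C in auto)
    then have "(\<lambda>\<alpha>. norm (f \<alpha> * mpower z \<alpha>)) summable_on UNIV"
      using t by (rule summable_on_comparison_test) auto
    then show ?thesis by (rule abs_summable_summable)
  qed
  then have "convergent_pseries f"
    unfolding convergent_pseries_def eventually_nhds_metric
    using assms(1) by (intro exI[of _ "1 / (2 * R)"]) auto
  then show ?thesis by (simp add: pseries_ring_def)
qed

lemma conv_seriesE: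
  fixes f :: "'k::finite pseries"
  assumes "f \<in> conv_series"
  obtains C R where "C \<ge> 0" "R \<ge> 1" "\<And>\<alpha>. norm (f \<alpha>) \<le> C * R ^ (\<Sum>i\<in>UNIV. \<alpha> i)"
proof -
  from assms obtain d where d: "d > 0"
    "\<And>z. dist z 0 < d \<Longrightarrow> (\<lambda>\<alpha>. f \<alpha> * mpower z \<alpha>) summable_on UNIV"
    by (auto simp: pseries_ring_def convergent_pseries_def eventually_nhds_metric)
  \<comment> \<open>The point with all coordinates \<open>t\<close> has norm at most CARD('k) t
    \<le> d/2, hence lies in the ball of convergence; the minimum with 1 makes R = 1/t at least
    1.\<close>
  define t where "t = min 1 (d / (2 * CARD('k)))"
  have t: "0 < t" "t \<le> 1" using d by (auto simp: t_def)
  have "norm (\<chi> i::'k. complex_of_real t) \<le> (\<Sum>i\<in>(UNIV::'k set). norm (complex_of_real t))"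
    unfolding norm_vec_def by (rule order_trans[OF L2_set_le_sum]) auto
  also have "\<dots> = CARD('k) * t" using t by simp
  also have "\<dots> \<le> CARD('k) * (d / (2 * CARD('k)))" by (intro mult_left_mono) (auto simp: t_def)
  also have "\<dots> < d" using d by simp
  finally have "(\<lambda>\<alpha>. f \<alpha> * mpower (\<chi> i. complex_of_real t) \<alpha>) summable_on UNIV"
    using d by simp
  \<comment> \<open>\<open>summable_on\<close> means unconditional summability, which for complex
    terms is absolute.\<close>
  then have "(\<lambda>\<alpha>. norm (f \<alpha> * mpower (\<chi> i. complex_of_real t) \<alpha>)) summable_on UNIV"
    by (rule summable_on_iff_abs_summable_on_complex[THEN iffD1])
  then have s: "(\<lambda>\<alpha>. norm (f \<alpha>) * t ^ (\<Sum>i\<in>UNIV. \<alpha> i)) summable_on UNIV"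
    using t by (simp add: mpower_const norm_mult norm_power)
  define C where "C = (\<Sum>\<^sub>\<infinity>\<alpha>. norm (f \<alpha>) * t ^ (\<Sum>i\<in>UNIV. \<alpha> i))"
  have "norm (f \<alpha>) * t ^ (\<Sum>i\<in>UNIV. \<alpha> i) \<le> C" for \<alpha>
    unfolding C_def using finite_sum_le_infsum[OF s, of "{\<alpha>}"] t by auto
  then have b: "norm (f \<alpha>) \<le> C * (1 / t) ^ (\<Sum>i\<in>UNIV. \<alpha> i)" for \<alpha>
    using t by (simp add: power_divide field_simps)
  have "C \<ge> 0" unfolding C_def using t by (intro infsum_nonneg) auto
  then show thesis using that[of C "1 / t"] b t by auto
qed

lemma conv_add: assumes "f \<in> conv_series" "g \<in> conv_series" shows "f + g \<in> conv_series"
proof -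
  obtain C R where f: "C \<ge> 0" "R \<ge> 1" "\<And>\<alpha>. norm (f \<alpha>) \<le> C * R ^ (\<Sum>i\<in>UNIV. \<alpha> i)"
    using conv_seriesE[OF assms(1)] by blast
  obtain D S where g: "D \<ge> 0" "S \<ge> 1" "\<And>\<alpha>. norm (g \<alpha>) \<le> D * S ^ (\<Sum>i\<in>UNIV. \<alpha> i)"
    using conv_seriesE[OF assms(2)] by blast
  have "norm ((f + g) \<alpha>) \<le> (C + D) * (max R S) ^ (\<Sum>i\<in>UNIV. \<alpha> i)" for \<alpha>
  proof -
    have "norm ((f + g) \<alpha>) \<le> norm (f \<alpha>) + norm (g \<alpha>)" by (simp add: norm_triangle_ineq)
    also have "\<dots> \<le> C * R ^ (\<Sum>i\<in>UNIV. \<alpha> i) + D * S ^ (\<Sum>i\<in>UNIV. \<alpha> i)" using f g by (intro add_mono) auto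
    also have "\<dots> \<le> C * (max R S) ^ (\<Sum>i\<in>UNIV. \<alpha> i) + D * (max R S) ^ (\<Sum>i\<in>UNIV. \<alpha> i)"
      using f g by (intro add_mono mult_left_mono power_mono) auto
    finally show ?thesis by (simp add: algebra_simps)
  qed
  then show ?thesis using f by (intro conv_seriesI[of "max R S"]) auto
qed

lemma conv_mult: assumes "f \<in> conv_series" "g \<in> conv_series" shows "f \<star> g \<in> conv_series"
proof -
  obtain C R where f: "C \<ge> 0" "R \<ge> 1" "\<And>\<alpha>. norm (f \<alpha>) \<le> C * R ^ (\<Sum>i\<in>UNIV. \<alpha> i)"
    using conv_seriesE[OF assms(1)] by blast
  obtain D S where g: "D \<ge> 0" "S \<ge> 1" "\<And>\<alpha>. norm (g \<alpha>) \<le> D * S ^ (\<Sum>i\<in>UNIV. \<alpha> i)"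
    using conv_seriesE[OF assms(2)] by blast
  define T where "T = max R S"
  have T: "T \<ge> 1" "R \<le> T" "S \<le> T" using f g by (auto simp: T_def)
  have "norm ((f \<star> g) \<gamma>) \<le> (C * D) * (2 * T) ^ (\<Sum>i\<in>UNIV. \<gamma> i)" for \<gamma>
  proof -
    have "norm ((f \<star> g) \<gamma>) \<le> (\<Sum>\<alpha>\<in>{..\<gamma>}. norm (f \<alpha> * g (\<gamma> - \<alpha>)))"
      unfolding pmult_apply by (rule norm_sum)
    also have "\<dots> \<le> (\<Sum>\<alpha>\<in>{..\<gamma>}. (C * D) * T ^ (\<Sum>i\<in>UNIV. \<gamma> i))"
    proof (intro sum_mono)
      fix \<alpha> assume "\<alpha> \<in> {..\<gamma>}"
      then have le: "\<And>i. \<alpha> i \<le> \<gamma> i" by (auto simp: le_fun_def)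
      have "norm (f \<alpha> * g (\<gamma> - \<alpha>)) \<le> (C * R ^ (\<Sum>i\<in>UNIV. \<alpha> i)) * (D * S ^ (\<Sum>i\<in>UNIV. (\<gamma> - \<alpha>) i))"
        unfolding norm_mult by (intro mult_mono f(3) g(3)) (use f(1,2) in auto)
      also have "\<dots> \<le> (C * T ^ (\<Sum>i\<in>UNIV. \<alpha> i)) * (D * T ^ (\<Sum>i\<in>UNIV. (\<gamma> - \<alpha>) i))"
        using f g T by (intro mult_mono mult_left_mono power_mono) auto
      also have "\<dots> = (C * D) * T ^ ((\<Sum>i\<in>UNIV. \<alpha> i) + (\<Sum>i\<in>UNIV. (\<gamma> - \<alpha>) i))"
        by (simp add: power_add)
      also have "(\<Sum>i\<in>UNIV. \<alpha> i) + (\<Sum>i\<in>UNIV. (\<gamma> - \<alpha>) i) = (\<Sum>i\<in>UNIV. \<gamma> i)"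
        unfolding sum.distrib[symmetric] using le by (intro sum.cong) auto
      finally show "norm (f \<alpha> * g (\<gamma> - \<alpha>)) \<le> (C * D) * T ^ (\<Sum>i\<in>UNIV. \<gamma> i)" .
    qed
    also have "\<dots> = real (card {..\<gamma>}) * ((C * D) * T ^ (\<Sum>i\<in>UNIV. \<gamma> i))" by simp
    also have "\<dots> \<le> 2 ^ (\<Sum>i\<in>UNIV. \<gamma> i) * ((C * D) * T ^ (\<Sum>i\<in>UNIV. \<gamma> i))"
    proof (intro mult_right_mono)
      show "real (card {..\<gamma>}) \<le> 2 ^ (\<Sum>i\<in>UNIV. \<gamma> i)"
        using card_atMost_fun_le[of \<gamma>] by (metis of_nat_le_iff of_nat_numeral of_nat_power)
    qed (use f g T in auto)
    finally show ?thesis by (simp add: power_mult_distrib algebra_simps)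
  qed
  then show ?thesis using T by (intro conv_seriesI[of "2 * T"]) auto
qed

lemma conv_smul: assumes "f \<in> conv_series" shows "smul c f \<in> conv_series"
proof -
  obtain C R where f: "C \<ge> 0" "R \<ge> 1" "\<And>\<alpha>. norm (f \<alpha>) \<le> C * R ^ (\<Sum>i\<in>UNIV. \<alpha> i)"
    using conv_seriesE[OF assms(1)] by blast
  have "norm (smul c f \<alpha>) \<le> (norm c * C) * R ^ (\<Sum>i\<in>UNIV. \<alpha> i)" for \<alpha>
    using f(3)[of \<alpha>] mult_left_mono[OF f(3)[of \<alpha>], of "norm c"] by (simp add: norm_mult algebra_simps)
  then show ?thesis using f by (intro conv_seriesI[of R]) auto
qed

lemma conv_restrict:
  assumes "f \<in> conv_series" "\<And>\<alpha>. g \<alpha> = 0 \<or> g \<alpha> = f \<alpha>" shows "g \<in> conv_series"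
proof -
  obtain C R where f: "C \<ge> 0" "R \<ge> 1" "\<And>\<alpha>. norm (f \<alpha>) \<le> C * R ^ (\<Sum>i\<in>UNIV. \<alpha> i)"
    using conv_seriesE[OF assms(1)] by blast
  have "norm (g \<alpha>) \<le> C * R ^ (\<Sum>i\<in>UNIV. \<alpha> i)" for \<alpha>
    using assms(2)[of \<alpha>] f by auto
  then show ?thesis using f by (intro conv_seriesI[of R]) auto
qed

lemma conv_zero: "0 \<in> conv_series"
  by (rule conv_seriesI[of 1 _ 0]) auto

lemma conv_const: "pseries_const c \<in> conv_series"
proof (rule conv_seriesI[of 1 _ "norm c"])
qed (auto simp: pseries_const_def)

lemma subspace_conv: "pv.subspace conv_series"
  by (auto simp: pv.subspace_def conv_zero conv_add conv_smul)

lemma const_mult [simp]: "pseries_const c \<star> f = smul c f"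
proof
  fix \<gamma>
  have "(pseries_const c \<star> f) \<gamma> = (\<Sum>\<alpha>\<in>{..\<gamma>}. if \<alpha> = (\<lambda>_. 0) then c * f (\<gamma> - \<alpha>) else 0)"
    unfolding pmult_apply pseries_const_def by (intro sum.cong) auto
  also have "\<dots> = c * f (\<gamma> - (\<lambda>_. 0))" by (subst sum.delta) (auto simp: le_fun_def)
  also have "\<gamma> - (\<lambda>_. 0) = \<gamma>" by (auto simp: fun_eq_iff)
  finally show "(pseries_const c \<star> f) \<gamma> = smul c f \<gamma>" by simp
qed

lemma pmult_comm: "f \<star> g = g \<star> f"
proof
  fix \<gamma>
  show "(f \<star> g) \<gamma> = (g \<star> f) \<gamma>" unfolding pmult_apply
    by (rule sum.reindex_bij_witness[of _ "\<lambda>\<alpha>. \<gamma> - \<alpha>" "\<lambda>\<alpha>. \<gamma> - \<alpha>"])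
       (auto simp: le_fun_def fun_eq_iff mult.commute intro!: arg_cong[of _ _ f] arg_cong[of _ _ g])
qed

text \<open>Both sides sum over the ways to write \<gamma> as a sum of three multi-indices; the
  reindexing sends (\<beta>, \<delta>) to (\<beta> + \<delta>, \<beta>).\<close>

lemma pmult_assoc: "(f \<star> g) \<star> h = f \<star> (g \<star> h)"
proof
  fix \<gamma>
  have "((f \<star> g) \<star> h) \<gamma> = (\<Sum>(\<alpha>,\<beta>)\<in>Sigma {..\<gamma>} (\<lambda>\<alpha>. {..\<alpha>}). f \<beta> * g (\<alpha> - \<beta>) * h (\<gamma> - \<alpha>))"
    unfolding pmult_apply by (subst sum.Sigma[symmetric]) (auto simp: sum_distrib_right)
  also have "\<dots> = (\<Sum>(\<beta>,\<delta>)\<in>Sigma {..\<gamma>} (\<lambda>\<beta>. {..\<gamma> - \<beta>}). f \<beta> * (g \<delta> * h (\<gamma> - \<beta> - \<delta>)))"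
  proof (rule sum.reindex_bij_witness[of _ "\<lambda>(\<beta>,\<delta>). (\<beta> + \<delta>, \<beta>)" "\<lambda>(\<alpha>,\<beta>). (\<beta>, \<alpha> - \<beta>)"])
    fix p assume "p \<in> Sigma {..\<gamma>} (\<lambda>\<alpha>. {..\<alpha>})"
    then obtain \<alpha> \<beta> where p: "p = (\<alpha>, \<beta>)" "\<And>i. \<alpha> i \<le> \<gamma> i" "\<And>i. \<beta> i \<le> \<alpha> i" by (auto simp: le_fun_def)
    show "(case (case p of (\<alpha>, \<beta>) \<Rightarrow> (\<beta>, \<alpha> - \<beta>)) of (\<beta>, \<delta>) \<Rightarrow> (\<beta> + \<delta>, \<beta>)) = p"
      using p by (auto simp: fun_eq_iff)
    show "(case p of (\<alpha>, \<beta>) \<Rightarrow> (\<beta>, \<alpha> - \<beta>)) \<in> Sigma {..\<gamma>} (\<lambda>\<beta>. {..\<gamma> - \<beta>})"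
      using p by (auto simp: le_fun_def intro: order_trans diff_le_mono)
    have "\<gamma> - \<beta> - (\<alpha> - \<beta>) = \<gamma> - \<alpha>" using p by (auto simp: fun_eq_iff)
    then show "(case (case p of (\<alpha>, \<beta>) \<Rightarrow> (\<beta>, \<alpha> - \<beta>)) of (\<beta>, \<delta>) \<Rightarrow> f \<beta> * (g \<delta> * h (\<gamma> - \<beta> - \<delta>)))
      = (case p of (\<alpha>, \<beta>) \<Rightarrow> f \<beta> * g (\<alpha> - \<beta>) * h (\<gamma> - \<alpha>))"
      using p by simp
  next
    fix p assume "p \<in> Sigma {..\<gamma>} (\<lambda>\<beta>. {..\<gamma> - \<beta>})"
    then obtain \<beta> \<delta> where p: "p = (\<beta>, \<delta>)" "\<And>i. \<beta> i \<le> \<gamma> i" "\<And>i. \<delta> i \<le> \<gamma> i - \<beta> i" by (auto simp: le_fun_def)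
    show "(case (case p of (\<beta>, \<delta>) \<Rightarrow> (\<beta> + \<delta>, \<beta>)) of (\<alpha>, \<beta>) \<Rightarrow> (\<beta>, \<alpha> - \<beta>)) = p"
      using p by (auto simp: fun_eq_iff)
    have "\<beta> i + \<delta> i \<le> \<gamma> i" for i using p(2,3)[of i] by linarith
    then show "(case p of (\<beta>, \<delta>) \<Rightarrow> (\<beta> + \<delta>, \<beta>)) \<in> Sigma {..\<gamma>} (\<lambda>\<alpha>. {..\<alpha>})"
      using p by (auto simp: le_fun_def)
  qed
  also have "\<dots> = (f \<star> (g \<star> h)) \<gamma>"
    unfolding pmult_apply by (subst sum.Sigma[symmetric]) (auto simp: sum_distrib_left)
  finally show "((f \<star> g) \<star> h) \<gamma> = (f \<star> (g \<star> h)) \<gamma>" .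
qed

lemma pmult_add_left: "(f + g) \<star> h = f \<star> h + g \<star> h"
  by (auto simp: fun_eq_iff pmult_apply algebra_simps sum.distrib)

lemma pmult_add_right: "h \<star> (f + g) = h \<star> f + h \<star> g"
  by (auto simp: fun_eq_iff pmult_apply algebra_simps sum.distrib)

lemma pmult_smul_left: "smul c f \<star> g = smul c (f \<star> g)"
  by (auto simp: fun_eq_iff pmult_apply algebra_simps sum_distrib_left)

lemma pmult_smul_right: "f \<star> smul c g = smul c (f \<star> g)"
  by (auto simp: fun_eq_iff pmult_apply algebra_simps sum_distrib_left)

lemma pmult_diff_left: "(f - g) \<star> h = f \<star> h - g \<star> h"
  by (auto simp: fun_eq_iff pmult_apply algebra_simps sum_subtractf)

lemma pmult_diff_right: "h \<star> (f - g) = h \<star> f - h \<star> g"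
  by (auto simp: fun_eq_iff pmult_apply algebra_simps sum_subtractf)

lemma smul_1 [simp]: "smul 1 f = f"
  by (simp add: fun_eq_iff)

interpretation pr: cring pseries_ring
proof (intro cringI abelian_groupI comm_monoidI)
  fix x :: "'k::finite pseries" assume "x \<in> conv_series"
  then show "\<exists>y\<in>conv_series. y \<oplus>\<^bsub>pseries_ring\<^esub> x = \<zero>\<^bsub>pseries_ring\<^esub>"
    using conv_smul[of x "-1"] by (intro bexI[of _ "smul (-1) x"]) (auto simp: fun_eq_iff)
qed (auto simp: conv_add conv_mult conv_zero conv_const pmult_assoc pmult_add_left add_ac intro: pmult_comm)

lemma conv_uminus: "f \<in> conv_series \<Longrightarrow> - f \<in> conv_series"
  by (rule pv.subspace_neg[OF subspace_conv])

lemma conv_diff: "f \<in> conv_series \<Longrightarrow> g \<in> conv_series \<Longrightarrow> f - g \<in> conv_series"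
  using pv.subspace_diff[OF subspace_conv] .

subsection \<open>Ideals and their codimension\<close>

abbreviation pideal :: "'k::finite pseries set \<Rightarrow> bool" where
  "pideal I \<equiv> ideal I pseries_ring"

lemma pidealI:
  fixes I :: "'k::finite pseries set"
  assumes "I \<subseteq> conv_series" "0 \<in> I" "\<And>f g. f \<in> I \<Longrightarrow> g \<in> I \<Longrightarrow> f + g \<in> I"
    "\<And>f h. f \<in> I \<Longrightarrow> h \<in> conv_series \<Longrightarrow> h \<star> f \<in> I"
  shows "pideal I"
proof (rule idealI[OF pr.ring_axioms])
  show "subgroup I (add_monoid pseries_ring)"
  proof
    fix x assume "x \<in> I"
    then have x: "x \<in> conv_series" "pseries_const (-1) \<star> x \<in> I" using assms conv_const by blast+
    have "\<ominus>\<^bsub>pseries_ring\<^esub> x = pseries_const (-1) \<star> x"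
      using x by (intro pr.minus_equality) (auto simp: fun_eq_iff intro!: conv_uminus conv_smul)
    then show "inv\<^bsub>add_monoid pseries_ring\<^esub> x \<in> I" using x by (simp add: a_inv_def)
  qed (use assms in auto)
  fix a x :: "'k pseries" assume a: "a \<in> I" "x \<in> conv_series"
  then show "x \<star> a \<in> I" "a \<star> x \<in> I" using assms(4) pmult_comm[of a x] by auto
qed

lemma pideal_mult: "pideal I \<Longrightarrow> f \<in> I \<Longrightarrow> h \<in> conv_series \<Longrightarrow> h \<star> f \<in> I"
  by (rule ideal.I_l_closed)

lemma pideal_conv: "pideal I \<Longrightarrow> I \<subseteq> conv_series"
  by (auto dest: ideal.Icarr)

lemma pideal_subspace: "pideal I \<Longrightarrow> pv.subspace I"
proof -
  assume I: "pideal I"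
  interpret ideal I pseries_ring by fact
  have "smul c x \<in> I" if "x \<in> I" for c x
    using pideal_mult[OF I that conv_const] by simp
  then show ?thesis using a_closed zero_closed by (auto simp: pv.subspace_def)
qed

lemma rcos_eq_iff:
  assumes "pideal I" "f \<in> conv_series" "g \<in> conv_series"
  shows "I +>\<^bsub>pseries_ring\<^esub> f = I +>\<^bsub>pseries_ring\<^esub> g \<longleftrightarrow> f - g \<in> I"
proof -
  have "\<ominus>\<^bsub>pseries_ring\<^esub> g = smul (-1) g"
    using assms by (intro pr.minus_equality) (auto simp: fun_eq_iff intro!: conv_uminus conv_smul)
  then have "f \<ominus>\<^bsub>pseries_ring\<^esub> g = f - g"
    using assms by (simp add: a_minus_def fun_eq_iff)
  then show ?thesis using pr.quotient_eq_iff_same_a_r_cos[OF assms] by simp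
qed

lemma rcos_zero_iff:
  assumes "pideal I" "f \<in> conv_series"
  shows "I +>\<^bsub>pseries_ring\<^esub> f = I \<longleftrightarrow> f \<in> I"
  using rcos_eq_iff[OF assms conv_zero] pr.a_rcos_zero[OF assms(1), of 0]
    additive_subgroup.zero_closed[OF ideal.axioms(1)[OF assms(1)]] by simp

section \<open>Dimension of the quotient ring as codimension of the ideal\<close>

context
  fixes I :: "'k::finite pseries set"
  assumes I: "pideal I"
begin

interpretation I: ideal I pseries_ring by (rule I)
interpretation Q: ring "pseries_ring Quot I" by (rule I.quotient_is_ring)

abbreviation (input) "quot_scalars \<equiv> range (\<lambda>c. I +>\<^bsub>pseries_ring\<^esub> pseries_const c)"

text \<open>The inductive step of the passage between \<open>dimension\<close> in the quotient and
  \<open>flag\<close> above \<open>I\<close>: adjoining a coset corresponds to adjoining a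
  representative.\<close>

lemma line_extension_quot:
  assumes "v \<in> conv_series" "E \<subseteq> conv_series" "I \<subseteq> E" "pv.subspace E"
  shows "Q.line_extension quot_scalars (I +>\<^bsub>pseries_ring\<^esub> v) ((+>\<^bsub>pseries_ring\<^esub>) I ` E)
    = (+>\<^bsub>pseries_ring\<^esub>) I ` pv.adjoin v E" (is "?L = ?r ` _")
proof -
  have comb: "(?r (pseries_const c) \<otimes>\<^bsub>pseries_ring Quot I\<^esub> ?r v) \<oplus>\<^bsub>pseries_ring Quot I\<^esub> ?r e
      = ?r (smul c v + e)" if "e \<in> E" for c e
  proof -
    have "?r (pseries_const c) \<otimes>\<^bsub>pseries_ring Quot I\<^esub> ?r v = ?r (smul c v)"
      using I.rcoset_mult_add[OF conv_const[of c] assms(1)] by (simp add: FactRing_def)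
    moreover have "?r (smul c v) \<oplus>\<^bsub>pseries_ring Quot I\<^esub> ?r e = ?r (smul c v + e)"
      using I.a_rcos_sum[OF conv_smul[OF assms(1)], of e] that assms(2) by (auto simp: FactRing_def)
    ultimately show ?thesis by simp
  qed
  have "?L = {?r (smul c v + e) |c e. e \<in> E}"
    unfolding Q.line_extension_def set_add_def' r_coset_def
    using comb by (auto simp: image_iff)
  moreover have "pv.adjoin v E = {smul c v + e |c e. e \<in> E}"
  proof (intro subset_antisym subsetI)
    fix x assume "x \<in> pv.adjoin v E"
    then obtain c where "x - smul c v \<in> E" unfolding pv.adjoin_def by blast
    moreover have "x = smul c v + (x - smul c v)" by simp
    ultimately show "x \<in> {smul c v + e |c e. e \<in> E}" by blast
  next
    fix x assume "x \<in> {smul c v + e |c e. e \<in> E}"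
    then obtain c e where "e \<in> E" "x = smul c v + e" by blast
    then have "x - smul c v \<in> E" by simp
    then show "x \<in> pv.adjoin v E" unfolding pv.adjoin_def by blast
  qed
  ultimately show ?thesis by auto
qed

lemma dimension_if_flag:
  "pv.flag I n E \<Longrightarrow> E \<subseteq> conv_series \<Longrightarrow>
    Q.dimension n quot_scalars ((+>\<^bsub>pseries_ring\<^esub>) I ` E)"
proof (induction rule: pv.flag.induct)
  case flag_0
  have "(+>\<^bsub>pseries_ring\<^esub>) I ` I = {\<zero>\<^bsub>pseries_ring Quot I\<^esub>}"
    using rcos_zero_iff[OF I] flag_0 I.zero_closed by (auto simp: FactRing_def image_iff)
  then show ?case by (metis Q.zero_dim)
next
  case (flag_Suc n E v)
  have E: "pv.subspace E" using pv.flag_subspace[OF flag_Suc(1) pideal_subspace[OF I]] .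
  have c: "E \<subseteq> conv_series" "v \<in> conv_series"
    using flag_Suc.prems pv.adjoin_incl pv.mem_adjoin[OF E] by blast+
  have "I +>\<^bsub>pseries_ring\<^esub> v \<notin> (+>\<^bsub>pseries_ring\<^esub>) I ` E"
  proof
    assume "I +>\<^bsub>pseries_ring\<^esub> v \<in> (+>\<^bsub>pseries_ring\<^esub>) I ` E"
    then obtain e where e: "e \<in> E" "v - e \<in> I" using rcos_eq_iff[OF I c(2)] c(1) by auto
    then have "(v - e) + e \<in> E" using E pv.subspace_add pv.flag_incl[OF flag_Suc(1)] by blast
    then show False using flag_Suc by simp
  qed
  moreover have "I +>\<^bsub>pseries_ring\<^esub> v \<in> carrier (pseries_ring Quot I)"
    using c by (auto simp: FactRing_def A_RCOSETS_def')
  ultimately show ?case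
    using line_extension_quot[OF c(2,1) pv.flag_incl[OF flag_Suc(1)] E] flag_Suc.IH[OF c(1)]
      Q.Suc_dim by metis
qed

text \<open>A subspace of the quotient is pulled back to its full preimage. The second conjunct is
  carried along because it recovers \<open>F\<close> from that preimage.\<close>

lemma flag_if_dimension:
  "Q.dimension n K F \<Longrightarrow> K = quot_scalars \<Longrightarrow>
    pv.flag I n {f \<in> conv_series. I +>\<^bsub>pseries_ring\<^esub> f \<in> F} \<and> F \<subseteq> (+>\<^bsub>pseries_ring\<^esub>) I ` conv_series"
proof (induction rule: Q.dimension.induct)
  case (zero_dim K)
  have "{f \<in> conv_series. I +>\<^bsub>pseries_ring\<^esub> f \<in> {\<zero>\<^bsub>pseries_ring Quot I\<^esub>}} = I"
    using rcos_zero_iff[OF I] pideal_conv[OF I] by (auto simp: FactRing_def)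
  moreover have "\<zero>\<^bsub>pseries_ring Quot I\<^esub> \<in> (+>\<^bsub>pseries_ring\<^esub>) I ` conv_series"
    using rcos_zero_iff[OF I] I.zero_closed conv_zero by (auto simp: FactRing_def image_iff intro!: bexI[of _ 0])
  ultimately show ?case using pv.flag_0[of I] by (metis empty_subsetI insert_subset)
next
  case (Suc_dim V F n K)
  let ?r = "(+>\<^bsub>pseries_ring\<^esub>) I"
  let ?E = "{f \<in> conv_series. ?r f \<in> F}"
  have IH: "pv.flag I n ?E" "F \<subseteq> ?r ` conv_series" using Suc_dim.IH[OF Suc_dim.prems] by blast+
  then have F: "F = ?r ` ?E" by auto
  obtain v where v: "v \<in> conv_series" "V = ?r v"
    using Suc_dim(1) by (auto simp: FactRing_def A_RCOSETS_def')
  have E: "pv.subspace ?E" using pv.flag_subspace[OF IH(1) pideal_subspace[OF I]] .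
  have le: "Q.line_extension K V F = ?r ` pv.adjoin v ?E"
    using line_extension_quot[OF v(1) _ pv.flag_incl[OF IH(1)] E] v F Suc_dim.prems by auto
  have aE: "pv.adjoin v ?E \<subseteq> conv_series"
    using v by (intro pv.adjoin_subset[OF subspace_conv]) auto
  have "{f \<in> conv_series. ?r f \<in> Q.line_extension K V F} = pv.adjoin v ?E"
  proof
    show "pv.adjoin v ?E \<subseteq> {f \<in> conv_series. ?r f \<in> Q.line_extension K V F}" using le aE by auto
    show "{f \<in> conv_series. ?r f \<in> Q.line_extension K V F} \<subseteq> pv.adjoin v ?E"
    proof
      fix f assume "f \<in> {f \<in> conv_series. ?r f \<in> Q.line_extension K V F}"
      then obtain g where g: "f \<in> conv_series" "g \<in> pv.adjoin v ?E" "?r f = ?r g" using le by auto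
      then have "f - g \<in> I" using rcos_eq_iff[OF I, of f g] aE by auto
      then have "f - g \<in> pv.adjoin v ?E" using pv.flag_incl[OF IH(1)] pv.adjoin_incl by blast
      then have "(f - g) + g \<in> pv.adjoin v ?E" using g pv.subspace_add[OF pv.subspace_adjoin[OF E]] by blast
      then show "f \<in> pv.adjoin v ?E" by simp
    qed
  qed
  moreover have "v \<notin> ?E" using v Suc_dim by auto
  ultimately have "pv.flag I (Suc n) {f \<in> conv_series. ?r f \<in> Q.line_extension K V F}"
    by (simp only: pv.flag_Suc[OF IH(1)] not_False_eq_True)
  then show ?case using le aE by blast
qed

lemma dimension_quot_iff:
  "Q.dimension n quot_scalars (carrier (pseries_ring Quot I)) \<longleftrightarrow> pv.flag I n conv_series"
proof -
  have c: "carrier (pseries_ring Quot I) = (+>\<^bsub>pseries_ring\<^esub>) I ` conv_series"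
    by (auto simp: FactRing_def A_RCOSETS_def')
  have "{f \<in> conv_series. I +>\<^bsub>pseries_ring\<^esub> f \<in> (+>\<^bsub>pseries_ring\<^esub>) I ` conv_series} = conv_series" by auto
  then show ?thesis unfolding c using dimension_if_flag[of n conv_series]
      flag_if_dimension[of n quot_scalars "(+>\<^bsub>pseries_ring\<^esub>) I ` conv_series"] by auto
qed

lemma quotient_dim_eq: "pv.flag I n conv_series \<Longrightarrow> quotient_dim I = n"
proof -
  assume f: "pv.flag I n conv_series"
  have "(THE n. pv.flag I n conv_series) = n"
    using f pv.flag_unique[OF _ _ pideal_subspace[OF I]] by blast
  then show ?thesis
    using f by (auto simp: quotient_dim_def Let_def Q.finite_dimension_def Q.dim_def over_def dimension_quot_iff)
qed

lemma quotient_dim_infinite: "\<nexists>n. pv.flag I n conv_series \<Longrightarrow> quotient_dim I = 0"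
  by (auto simp: quotient_dim_def Let_def Q.finite_dimension_def dimension_quot_iff)

end

lemma sum_fun_apply: "(\<Sum>a\<in>A. f a) x = (\<Sum>a\<in>A. f a x)"
  for f :: "'a \<Rightarrow> 'b \<Rightarrow> 'c::comm_monoid_add"
  by (induction A rule: infinite_finite_induct) auto

subsection \<open>Monomials\<close>

definition monom_series :: "('k \<Rightarrow> nat) \<Rightarrow> 'k::finite pseries" where
  "monom_series \<delta> = (\<lambda>\<alpha>. if \<alpha> = \<delta> then 1 else 0)"

lemma monom_mult_apply: "(monom_series \<delta> \<star> f) \<gamma> = (if \<delta> \<le> \<gamma> then f (\<gamma> - \<delta>) else 0)"
proof -
  have "(monom_series \<delta> \<star> f) \<gamma> = (\<Sum>\<alpha>\<in>{..\<gamma>}. if \<alpha> = \<delta> then f (\<gamma> - \<delta>) else 0)"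
    unfolding pmult_apply monom_series_def by (intro sum.cong) auto
  then show ?thesis by (auto simp: sum.delta)
qed

lemma monom_mult_monom: "monom_series \<alpha> \<star> monom_series \<beta> = monom_series (\<alpha> + \<beta>)"
proof
  fix \<gamma>
  have "\<alpha> \<le> \<gamma> \<and> \<gamma> - \<alpha> = \<beta> \<longleftrightarrow> \<gamma> = \<alpha> + \<beta>"
    by (fastforce simp: le_fun_def fun_eq_iff)
  then show "(monom_series \<alpha> \<star> monom_series \<beta>) \<gamma> = monom_series (\<alpha> + \<beta>) \<gamma>"
    unfolding monom_mult_apply by (auto simp: monom_series_def)
qed

lemma conv_monom: "monom_series \<delta> \<in> conv_series"
  by (rule conv_seriesI[of 1 _ 1]) (auto simp: monom_series_def)

lemma conv_shift:
  assumes "f \<in> conv_series" shows "(\<lambda>\<alpha>. f (\<alpha> + \<delta>)) \<in> conv_series"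
proof -
  obtain C R where f: "C \<ge> 0" "R \<ge> 1" "\<And>\<alpha>. norm (f \<alpha>) \<le> C * R ^ (\<Sum>i\<in>UNIV. \<alpha> i)"
    using conv_seriesE[OF assms] by blast
  have "norm (f (\<alpha> + \<delta>)) \<le> (C * R ^ (\<Sum>i\<in>UNIV. \<delta> i)) * R ^ (\<Sum>i\<in>UNIV. \<alpha> i)" for \<alpha>
    using f(3)[of "\<alpha> + \<delta>"] by (simp add: sum.distrib power_add mult_ac)
  then show ?thesis using f(2) by (rule conv_seriesI[rotated])
qed

text \<open>The part of a series divisible by a monomial is the monomial times a series, convergent
  by \<open>conv_shift\<close>; so it lies in every ideal containing the monomial.\<close>

lemma monom_mult_shift:
  "monom_series \<delta> \<star> (\<lambda>\<alpha>. f (\<alpha> + \<delta>)) = (\<lambda>\<gamma>. if \<delta> \<le> \<gamma> then f \<gamma> else 0)"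
proof
  fix \<gamma>
  have "\<gamma> - \<delta> + \<delta> = \<gamma>" if "\<delta> \<le> \<gamma>" using that by (auto simp: le_fun_def fun_eq_iff)
  then show "(monom_series \<delta> \<star> (\<lambda>\<alpha>. f (\<alpha> + \<delta>))) \<gamma> = (if \<delta> \<le> \<gamma> then f \<gamma> else 0)"
    unfolding monom_mult_apply by auto
qed

abbreviation axis_exp :: "'k \<Rightarrow> nat \<Rightarrow> 'k::finite \<Rightarrow> nat" where
  "axis_exp i n \<equiv> (\<lambda>_. 0)(i := n)"

lemma axis_exp_le_iff: "axis_exp i n \<le> \<gamma> \<longleftrightarrow> n \<le> \<gamma> i"
  by (auto simp: le_fun_def)

definition exp_box :: "nat \<Rightarrow> ('k::finite \<Rightarrow> nat) set" where
  "exp_box N = {\<alpha>. \<forall>i. \<alpha> i < N}"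

lemma finite_exp_box [simp]: "finite (exp_box N)"
  by (rule finite_subset[OF _ finite_atMost_fun[of "\<lambda>_. N"]]) (auto simp: exp_box_def le_fun_def less_imp_le)

definition on_axis :: "'k \<Rightarrow> ('k::finite \<Rightarrow> nat) \<Rightarrow> bool" where
  "on_axis i \<alpha> \<longleftrightarrow> (\<forall>j. j \<noteq> i \<longrightarrow> \<alpha> j = 0)"

lemma on_axisD: "on_axis i \<alpha> \<Longrightarrow> j \<noteq> i \<Longrightarrow> \<alpha> j = 0"
  by (simp add: on_axis_def)

text \<open>Embeds one-variable series along an axis, so that inverses and their radius of
  convergence can be taken from the theory of \<open>fps\<close>.\<close>

definition uni :: "'k \<Rightarrow> complex fps \<Rightarrow> 'k::finite pseries" where
  "uni i a = (\<lambda>\<alpha>. if on_axis i \<alpha> then fps_nth a (\<alpha> i) else 0)"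

lemma eq_axis_exp_iff: "\<alpha> = axis_exp i n \<longleftrightarrow> on_axis i \<alpha> \<and> \<alpha> i = n"
  by (auto simp: fun_eq_iff on_axis_def)

lemma uni_X_power: "uni i (fps_X ^ n) = monom_series (axis_exp i n)"
  by (rule ext) (simp add: uni_def monom_series_def eq_axis_exp_iff fps_X_power_iff)

lemma uni_mult: "uni i (a * b) = uni i a \<star> uni i b"
proof
  fix \<gamma>
  show "uni i (a * b) \<gamma> = (uni i a \<star> uni i b) \<gamma>"
  proof (cases "on_axis i \<gamma>")
    case True
    have sub: "axis_exp i ` {..\<gamma> i} \<subseteq> {..\<gamma>}" by (auto simp: axis_exp_le_iff)
    have inj: "inj_on (axis_exp i) {..\<gamma> i}"
      unfolding inj_on_def by (auto simp: fun_upd_eqD)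
    have z: "uni i a \<alpha> * uni i b (\<gamma> - \<alpha>) = 0" if "\<alpha> \<in> {..\<gamma>} - axis_exp i ` {..\<gamma> i}" for \<alpha>
    proof -
      have "\<alpha> i \<le> \<gamma> i" using that by (auto simp: le_fun_def)
      then have "\<alpha> \<noteq> axis_exp i (\<alpha> i)" using that by blast
      then show ?thesis by (simp add: uni_def eq_axis_exp_iff)
    qed
    have e: "uni i a (axis_exp i m) * uni i b (\<gamma> - axis_exp i m) = fps_nth a m * fps_nth b (\<gamma> i - m)"
      for m
      using True by (simp add: uni_def on_axis_def)
    have "(uni i a \<star> uni i b) \<gamma> = (\<Sum>\<alpha>\<in>axis_exp i ` {..\<gamma> i}. uni i a \<alpha> * uni i b (\<gamma> - \<alpha>))"
      unfolding pmult_apply using sub z by (intro sum.mono_neutral_right) auto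
    also have "\<dots> = (\<Sum>m\<in>{..\<gamma> i}. fps_nth a m * fps_nth b (\<gamma> i - m))"
      by (subst sum.reindex[OF inj]) (simp add: e)
    finally show ?thesis using True by (simp add: uni_def fps_mult_nth atLeast0AtMost)
  next
    case False
    then obtain j where j: "j \<noteq> i" "\<gamma> j \<noteq> 0" unfolding on_axis_def by blast
    have "uni i a \<alpha> * uni i b (\<gamma> - \<alpha>) = 0" for \<alpha>
    proof (cases "\<alpha> j = 0")
      case True
      then have "(\<gamma> - \<alpha>) j \<noteq> 0" using j by simp
      then have "\<not> on_axis i (\<gamma> - \<alpha>)" by (rule contrapos_nn) (rule on_axisD[OF _ j(1)])
      then show ?thesis by (simp add: uni_def)
    next
      case False
      then have "\<not> on_axis i \<alpha>" by (rule contrapos_nn) (rule on_axisD[OF _ j(1)])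
      then show ?thesis by (simp add: uni_def)
    qed
    then have "(uni i a \<star> uni i b) \<gamma> = 0" unfolding pmult_apply by (intro sum.neutral ballI)
    then show ?thesis using False by (simp add: uni_def)
  qed
qed

lemma conv_uni:
  assumes "fps_conv_radius a > 0" shows "uni i a \<in> conv_series"
proof -
  obtain r :: real where r: "0 < r" "ereal r < fps_conv_radius a"
    using ereal_dense2[OF assms] by (metis ereal_less(2))
  have "summable (\<lambda>n. norm (fps_nth a n * of_real r ^ n))"
    using abs_summable_in_conv_radius[of "complex_of_real r" "fps_nth a"] r by (simp add: fps_conv_radius_def)
  then have "Bseq (\<lambda>n. norm (fps_nth a n * of_real r ^ n))" by (rule summable_imp_Bseq)
  then obtain C where C: "C > 0" "\<And>n. norm (fps_nth a n * of_real r ^ n) \<le> C"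
    by (auto simp: Bseq_def)
  have b: "norm (fps_nth a n) \<le> C * (1 / r) ^ n" for n
    using C(2)[of n] r by (simp add: norm_mult norm_power field_simps)
  have "norm (uni i a \<alpha>) \<le> C * (max 1 (1 / r)) ^ (\<Sum>i\<in>UNIV. \<alpha> i)" for \<alpha>
  proof (cases "on_axis i \<alpha>")
    case True
    have "norm (uni i a \<alpha>) \<le> C * (1 / r) ^ (\<alpha> i)" using b True by (simp add: uni_def)
    also have "\<dots> \<le> C * (max 1 (1 / r)) ^ (\<alpha> i)" using C r by (intro mult_left_mono power_mono) auto
    also have "\<dots> \<le> C * (max 1 (1 / r)) ^ (\<Sum>i\<in>UNIV. \<alpha> i)"
      using C by (intro mult_left_mono power_increasing member_le_sum) auto
    finally show ?thesis .
  qed (use C in \<open>simp add: uni_def\<close>)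
  then show ?thesis by (intro conv_seriesI[of "max 1 (1 / r)"]) auto
qed

subsection \<open>Ideals of finite codimension contain powers of the variables\<close>

text \<open>The powers of one variable are dependent modulo \<open>I\<close>, so \<open>I\<close>
  contains a nonzero polynomial in that variable alone. It is a power of the variable times a unit,
  and multiplying by the convergent inverse of the unit leaves the power in
  \<open>I\<close>.\<close>

lemma monom_power_in_ideal:
  assumes I: "pideal I" and fin: "pv.flag I n conv_series"
  shows "\<exists>N. monom_series (axis_exp i N) \<in> I"
proof -
  define x where "x = (\<lambda>a. monom_series (axis_exp i a))"
  have "\<not> pv.free_mod I x {..<Suc n}"
  proof
    assume f: "pv.free_mod I x {..<Suc n}"
    have "pv.combs I x {..<Suc n} \<subseteq> conv_series"
    proof
      fix y assume "y \<in> pv.combs I x {..<Suc n}"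
      then obtain c where "y - (\<Sum>a\<in>{..<Suc n}. smul (c a) (x a)) \<in> conv_series"
        unfolding pv.combs_def using pideal_conv[OF I] by blast
      moreover have "(\<Sum>a\<in>{..<Suc n}. smul (c a) (x a)) \<in> conv_series"
        by (intro pv.subspace_sum[OF subspace_conv]) (auto simp: x_def intro!: conv_smul conv_monom)
      ultimately show "y \<in> conv_series" using conv_add by fastforce
    qed
    then have "Suc n \<le> n"
      using pv.flag_le[OF fin pv.flag_combs[OF _ f pideal_subspace[OF I]]] pideal_subspace[OF I] by simp
    then show False by simp
  qed
  then obtain c a where c: "(\<Sum>a\<in>{..<Suc n}. smul (c a) (x a)) \<in> I" "a < Suc n" "c a \<noteq> 0"
    unfolding pv.free_mod_def by auto
  define p where "p = Abs_fps (\<lambda>a. if a < Suc n then c a else 0)"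
  have "p \<noteq> 0" using c by (auto simp: p_def fps_eq_iff)
  define u where "u = unit_factor p"
  have pu: "p = u * fps_X ^ subdegree p" unfolding u_def using fps_unit_factor_decompose[of p] by simp
  have u0: "fps_nth u 0 \<noteq> 0" unfolding u_def using fps_unit_factor_nth_0[OF \<open>p \<noteq> 0\<close>] .
  have "summable (\<lambda>m. fps_nth p m * 1 ^ m)"
    by (rule summable_finite[of "{..<Suc n}"]) (auto simp: p_def)
  then have "fps_conv_radius p \<ge> 1" using conv_radius_geI[of "fps_nth p" 1] by (simp add: fps_conv_radius_def one_ereal_def)
  then have "fps_conv_radius p > 0" by (rule less_le_trans[rotated]) simp
  then have "fps_conv_radius u > 0" by (simp add: u_def)
  then have v: "uni i (inverse u) \<in> conv_series" using u0 fps_conv_radius_inverse_pos conv_uni by blast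
  have "uni i p = (\<Sum>a\<in>{..<Suc n}. smul (c a) (x a))"
  proof
    fix \<alpha>
    have "smul (c a) (x a) \<alpha> = (if a = \<alpha> i then (if on_axis i \<alpha> then c a else 0) else 0)" for a
      by (auto simp: x_def monom_series_def eq_axis_exp_iff)
    then show "uni i p \<alpha> = (\<Sum>a\<in>{..<Suc n}. smul (c a) (x a)) \<alpha>"
      unfolding sum_fun_apply by (simp add: sum.delta' uni_def p_def del: smul_apply)
  qed
  then have "uni i (inverse u) \<star> uni i p \<in> I" using pideal_mult[OF I _ v] c by simp
  moreover have "inverse u * p = fps_X ^ subdegree p"
    using inverse_mult_eq_1[OF u0] by (subst pu) (simp add: mult.assoc[symmetric])
  ultimately have "monom_series (axis_exp i (subdegree p)) \<in> I"
    using uni_mult[of i "inverse u" p] uni_X_power[of i "subdegree p"] by metis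
  then show ?thesis by blast
qed

text \<open>Removes one variable of \<open>A\<close> at a time: the part of \<open>F\<close> whose
  exponent at \<open>i\<close> is at least \<open>N\<close> is a multiple of a monomial of
  \<open>I\<close>, and the rest satisfies the hypothesis for the smaller set.\<close>

lemma ideal_contains_box_complement:
  assumes "finite A" "pideal I" "\<And>i. monom_series (axis_exp i N) \<in> I"
    "F \<in> conv_series" "\<And>\<alpha>. (\<forall>i\<in>A. \<alpha> i < N) \<Longrightarrow> F \<alpha> = 0"
  shows "F \<in> I"
  using assms(1,4,5)
proof (induction A arbitrary: F rule: finite_induct)
  case empty
  then have "F = 0" by (auto simp: fun_eq_iff)
  then show ?case using pv.subspace_0[OF pideal_subspace[OF assms(2)]] by (simp only:)
next
  case (insert i A)
  let ?G = "\<lambda>\<alpha>. if axis_exp i N \<le> \<alpha> then F \<alpha> else 0" and ?H = "\<lambda>\<alpha>. if \<alpha> i < N then F \<alpha> else 0"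
  have "(\<lambda>\<alpha>. F (\<alpha> + axis_exp i N)) \<star> monom_series (axis_exp i N) \<in> I"
    using pideal_mult[OF assms(2,3) conv_shift[OF insert.prems(1)]] .
  then have "?G \<in> I"
    by (subst (asm) pmult_comm) (simp only: monom_mult_shift)
  moreover have "?H \<in> I"
  proof (rule insert.IH)
    show "?H \<in> conv_series" by (rule conv_restrict[OF insert.prems(1)]) auto
  qed (use insert.prems in auto)
  ultimately have "?G + ?H \<in> I" using pv.subspace_add[OF pideal_subspace[OF assms(2)]] by blast
  moreover have "?G + ?H = F" by (auto simp: fun_eq_iff axis_exp_le_iff)
  ultimately show ?case by metis
qed

lemma ideal_contains_high_order:
  assumes I: "pideal I" and fin: "pv.flag I n conv_series"
  obtains N where "\<And>i. monom_series (axis_exp i N) \<in> I"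
proof -
  obtain M where M: "\<And>i. monom_series (axis_exp i (M i)) \<in> I"
    using monom_power_in_ideal[OF assms] by metis
  define N where "N = (\<Sum>i\<in>UNIV. M i)"
  have "monom_series (axis_exp i N) \<in> I" for i
  proof -
    have "M i \<le> N" unfolding N_def by (intro member_le_sum) auto
    then have "axis_exp i (N - M i) + axis_exp i (M i) = axis_exp i N" by (auto simp: fun_eq_iff)
    then show ?thesis
      using pideal_mult[OF I M[of i] conv_monom[of "axis_exp i (N - M i)"]] by (simp add: monom_mult_monom)
  qed
  then show thesis using that by blast
qed

lemma truncation_mod_ideal:
  assumes I: "pideal I" and N: "\<And>i. monom_series (axis_exp i N) \<in> I" and F: "F \<in> conv_series"
  shows "F - (\<Sum>\<alpha>\<in>exp_box N. smul (F \<alpha>) (monom_series \<alpha>)) \<in> I"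
proof (rule ideal_contains_box_complement[OF _ I N])
  show "F - (\<Sum>\<alpha>\<in>exp_box N. smul (F \<alpha>) (monom_series \<alpha>)) \<in> conv_series"
    by (intro conv_diff F pv.subspace_sum[OF subspace_conv] conv_smul conv_monom)
  fix \<alpha> :: "'a \<Rightarrow> nat" assume "\<forall>i\<in>UNIV. \<alpha> i < N"
  then have "\<alpha> \<in> exp_box N" by (simp add: exp_box_def)
  then show "(F - (\<Sum>\<alpha>\<in>exp_box N. smul (F \<alpha>) (monom_series \<alpha>))) \<alpha> = 0"
    by (simp add: sum_fun_apply monom_series_def sum.delta if_distrib[of "\<lambda>x. _ * x"] cong: if_cong)
qed simp

text \<open>Each factor has order at least 1. In a term of f^k times f with |\<beta>| \<ge> k, the
  bound |\<alpha>| < k + 1 forces \<beta> = \<alpha>, and the second factor is then the vanishing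
  constant term.\<close>

lemma power_coeff_zero:
  assumes "f (\<lambda>_. 0) = 0" "(\<Sum>i\<in>UNIV. \<alpha> i) < k"
  shows "(f [^]\<^bsub>pseries_ring\<^esub> k) \<alpha> = 0"
  using assms(2)
proof (induction k arbitrary: \<alpha>)
  case (Suc k)
  have "(f [^]\<^bsub>pseries_ring\<^esub> k) \<beta> * f (\<alpha> - \<beta>) = 0" if "\<beta> \<in> {..\<alpha>}" for \<beta>
  proof (cases "(\<Sum>i\<in>UNIV. \<beta> i) < k")
    case False
    have le: "\<beta> i \<le> \<alpha> i" for i using that by (auto simp: le_fun_def)
    have "(\<Sum>i\<in>UNIV. \<beta> i) + (\<Sum>i\<in>UNIV. \<alpha> i - \<beta> i) = (\<Sum>i\<in>UNIV. \<alpha> i)"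
      unfolding sum.distrib[symmetric] using le by (intro sum.cong) auto
    then have "(\<Sum>i\<in>UNIV. \<alpha> i - \<beta> i) = 0" using False Suc.prems by linarith
    then have "\<alpha> - \<beta> = (\<lambda>_. 0)" by (auto simp: fun_eq_iff)
    then show ?thesis using assms(1) by simp
  qed (use Suc.IH in simp)
  then show ?case unfolding pr.nat_pow_Suc pmult_apply by (intro sum.neutral ballI)
qed simp

lemma nilpotent_mod_ideal:
  assumes I: "pideal I" and fin: "pv.flag I n conv_series" and f: "f \<in> conv_series" "f (\<lambda>_. 0) = 0"
  shows "\<exists>k::nat. f [^]\<^bsub>pseries_ring\<^esub> k \<in> I"
proof -
  obtain N where N: "\<And>i. monom_series (axis_exp i N) \<in> I"
    using ideal_contains_high_order[OF I fin] by blast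
  \<comment> \<open>Multi-indices in the box have degree at most \<open>N\<close> times the number
    of variables, so a power of larger order has no coefficient there.\<close>
  define k where "k = Suc (\<Sum>i\<in>(UNIV::'a set). N)"
  have "f [^]\<^bsub>pseries_ring\<^esub> k \<in> I"
  proof (rule ideal_contains_box_complement[OF finite I N])
    show "f [^]\<^bsub>pseries_ring\<^esub> k \<in> conv_series" using f by (intro pr.nat_pow_closed)
    fix \<alpha> :: "'a \<Rightarrow> nat" assume "\<forall>i\<in>UNIV. \<alpha> i < N"
    then have "(\<Sum>i\<in>UNIV. \<alpha> i) \<le> (\<Sum>i\<in>(UNIV::'a set). N)" by (intro sum_mono) (auto simp: less_imp_le)
    then show "(f [^]\<^bsub>pseries_ring\<^esub> k) \<alpha> = 0" using f by (intro power_coeff_zero) (auto simp: k_def)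
  qed
  then show ?thesis by blast
qed

subsection \<open>Values at the origin and derivatives\<close>

lemma pmult_at_0: "(f \<star> g) (\<lambda>_. 0) = f (\<lambda>_. 0) * g (\<lambda>_. 0)"
proof -
  have "{..(\<lambda>_. 0) :: 'a \<Rightarrow> nat} = {\<lambda>_. 0}" by (auto simp: le_fun_def fun_eq_iff)
  then have "(f \<star> g) (\<lambda>_. 0) = f (\<lambda>_. 0) * g ((\<lambda>_. 0) - (\<lambda>_. 0))"
    unfolding pmult_apply by simp
  also have "(\<lambda>_. 0) - (\<lambda>_. 0) = (\<lambda>_. 0 :: nat)" by (rule ext) simp
  finally show ?thesis .
qed

text \<open>The maximal ideal of the local ring; lying in it expresses that an ideal is
  proper.\<close>

definition max_ideal :: "'k::finite pseries set" where
  "max_ideal = {f \<in> conv_series. f (\<lambda>_. 0) = 0}"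

lemma pideal_max: "pideal max_ideal"
  unfolding max_ideal_def by (rule pidealI) (auto simp: conv_zero conv_add conv_mult pmult_at_0)

lemma pseries_eval_0: "pseries_eval f 0 = f (\<lambda>_. 0)"
proof -
  have z: "mpower 0 \<alpha> = (if \<alpha> = (\<lambda>_. 0) then 1 else 0)" for \<alpha> :: "'a \<Rightarrow> nat"
    by (auto simp: mpower_def fun_eq_iff)
  have "pseries_eval f 0 = (\<Sum>\<^sub>\<infinity>\<alpha>\<in>{\<lambda>_. 0}. f \<alpha> * mpower 0 \<alpha>)"
    unfolding pseries_eval_def by (rule infsum_cong_neutral) (auto simp: z)
  then show ?thesis by (simp add: z)
qed

lemma conv_deriv:
  assumes "f \<in> conv_series" shows "pseries_deriv i f \<in> conv_series"
proof -
  obtain C R where f: "C \<ge> 0" "R \<ge> 1" "\<And>\<alpha>. norm (f \<alpha>) \<le> C * R ^ (\<Sum>i\<in>UNIV. \<alpha> i)"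
    using conv_seriesE[OF assms] by blast
  have "norm (pseries_deriv i f \<alpha>) \<le> (C * R) * (2 * R) ^ (\<Sum>i\<in>UNIV. \<alpha> i)" for \<alpha>
  proof -
    have "(\<Sum>j\<in>UNIV. (\<alpha>(i := Suc (\<alpha> i))) j) = (\<Sum>j\<in>UNIV. \<alpha> j + (if j = i then 1 else 0))"
      by (intro sum.cong) auto
    also have "\<dots> = Suc (\<Sum>j\<in>UNIV. \<alpha> j)" by (simp add: sum.distrib)
    finally have s: "(\<Sum>j\<in>UNIV. (\<alpha>(i := Suc (\<alpha> i))) j) = Suc (\<Sum>j\<in>UNIV. \<alpha> j)" .
    have "Suc (\<alpha> i) \<le> 2 ^ \<alpha> i" by (simp add: Suc_le_eq)
    also have "\<dots> \<le> 2 ^ (\<Sum>i\<in>UNIV. \<alpha> i)" by (intro power_increasing member_le_sum) auto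
    finally have n: "real (Suc (\<alpha> i)) \<le> 2 ^ (\<Sum>i\<in>UNIV. \<alpha> i)"
      by (metis of_nat_le_iff of_nat_numeral of_nat_power)
    have "norm (pseries_deriv i f \<alpha>) = real (Suc (\<alpha> i)) * norm (f (\<alpha>(i := Suc (\<alpha> i))))"
      unfolding pseries_deriv_def norm_mult norm_of_nat ..
    also have "\<dots> \<le> 2 ^ (\<Sum>i\<in>UNIV. \<alpha> i) * (C * R ^ Suc (\<Sum>i\<in>UNIV. \<alpha> i))"
      using n f(3)[of "\<alpha>(i := Suc (\<alpha> i))"] unfolding s by (intro mult_mono) auto
    finally show ?thesis by (simp add: power_mult_distrib mult_ac)
  qed
  then show ?thesis using f by (intro conv_seriesI[of "2 * R"]) auto
qed

subsection \<open>Joining two sets of variables\<close>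

lemma sum_type_fun_eq: "(\<gamma> :: 'n + 'm \<Rightarrow> 'c) = case_sum (\<gamma> \<circ> Inl) (\<gamma> \<circ> Inr)"
  by (rule ext) (simp split: sum.split)

lemma case_sum_diff: "case_sum \<alpha> \<beta> - case_sum \<alpha>' \<beta>' = case_sum (\<alpha> - \<alpha>') (\<beta> - \<beta>' :: _ \<Rightarrow> nat)"
  by (rule ext) (simp split: sum.split)

lemma case_sum_le_iff: "case_sum \<alpha> \<beta> \<le> case_sum \<alpha>' (\<beta>' :: _ \<Rightarrow> nat) \<longleftrightarrow> \<alpha> \<le> \<alpha>' \<and> \<beta> \<le> \<beta>'"
  by (auto simp: le_fun_def split: sum.split)

lemma le_case_sum_iff: "\<gamma> \<le> case_sum \<alpha> (\<beta> :: _ \<Rightarrow> nat) \<longleftrightarrow> \<gamma> \<circ> Inl \<le> \<alpha> \<and> \<gamma> \<circ> Inr \<le> \<beta>"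
  by (subst sum_type_fun_eq) (rule case_sum_le_iff)

lemma sum_UNIV_case_sum:
  "(\<Sum>i\<in>UNIV. case_sum \<alpha> \<beta> i) = (\<Sum>i\<in>UNIV. \<alpha> i) + (\<Sum>i\<in>UNIV. \<beta> i)"
  for \<alpha> :: "'n::finite \<Rightarrow> nat" and \<beta> :: "'m::finite \<Rightarrow> nat"
  unfolding UNIV_sum by (subst sum.union_disjoint) (auto simp: sum.reindex)

lemma sum_atMost_case_sum:
  fixes \<alpha> :: "'n::finite \<Rightarrow> nat" and \<beta> :: "'m::finite \<Rightarrow> nat"
  shows "(\<Sum>\<gamma>\<in>{..case_sum \<alpha> \<beta>}. G \<gamma>) = (\<Sum>\<beta>'\<in>{..\<beta>}. \<Sum>\<alpha>'\<in>{..\<alpha>}. G (case_sum \<alpha>' \<beta>'))"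
proof -
  have "(\<Sum>\<gamma>\<in>{..case_sum \<alpha> \<beta>}. G \<gamma>) = (\<Sum>(\<beta>', \<alpha>')\<in>{..\<beta>} \<times> {..\<alpha>}. G (case_sum \<alpha>' \<beta>'))"
  proof (rule sum.reindex_bij_witness[of _ "\<lambda>(\<beta>', \<alpha>'). case_sum \<alpha>' \<beta>'" "\<lambda>\<gamma>. (\<gamma> \<circ> Inr, \<gamma> \<circ> Inl)"])
  qed (auto simp: le_case_sum_iff sum_type_fun_eq[symmetric] case_sum_o_inj simp del: comp_apply)
  then show ?thesis by (simp add: sum.cartesian_product)
qed

lemma pseries_inl_case_sum: "pseries_inl f (case_sum \<alpha> \<beta>) = (if \<beta> = (\<lambda>_. 0) then f \<alpha> else 0)"
  by (auto simp: pseries_inl_def fun_eq_iff)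

lemma pseries_inr_case_sum: "pseries_inr g (case_sum \<alpha> \<beta>) = (if \<alpha> = (\<lambda>_. 0) then g \<beta> else 0)"
  by (auto simp: pseries_inr_def fun_eq_iff)

lemma join_series_eqI:
  assumes "\<And>\<alpha> \<beta>. F (case_sum \<alpha> \<beta>) = G (case_sum \<alpha> \<beta>)"
  shows "F = (G :: ('n::finite + 'm::finite) pseries)"
proof
  fix \<gamma> show "F \<gamma> = G \<gamma>" by (subst (1 2) sum_type_fun_eq) (rule assms)
qed

text \<open>The coefficient of the monomial \<beta> when \<open>F\<close> is read as a series in the
  second variables over the ring of the first.\<close>

definition slice :: "('n::finite + 'm::finite) pseries \<Rightarrow> ('m \<Rightarrow> nat) \<Rightarrow> 'n pseries" where
  "slice F \<beta> = (\<lambda>\<alpha>. F (case_sum \<alpha> \<beta>))"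

lemma conv_slice: assumes "F \<in> conv_series" shows "slice F \<beta> \<in> conv_series"
proof -
  obtain C R where f: "C \<ge> 0" "R \<ge> 1" "\<And>\<alpha>. norm (F \<alpha>) \<le> C * R ^ (\<Sum>i\<in>UNIV. \<alpha> i)"
    using conv_seriesE[OF assms] by blast
  have "norm (slice F \<beta> \<alpha>) \<le> (C * R ^ (\<Sum>i\<in>UNIV. \<beta> i)) * R ^ (\<Sum>i\<in>UNIV. \<alpha> i)" for \<alpha>
    using f(3)[of "case_sum \<alpha> \<beta>"] unfolding slice_def sum_UNIV_case_sum by (simp add: power_add mult_ac)
  then show ?thesis using f(2) by (rule conv_seriesI[rotated])
qed

lemma slice_mult: "slice (F \<star> G) \<beta> = (\<Sum>\<beta>'\<in>{..\<beta>}. slice F \<beta>' \<star> slice G (\<beta> - \<beta>'))"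
  by (rule ext) (simp add: slice_def pmult_apply sum_atMost_case_sum case_sum_diff sum_fun_apply)

lemma conv_inl: assumes "f \<in> conv_series" shows "(pseries_inl f :: ('n::finite + 'm::finite) pseries) \<in> conv_series"
proof -
  obtain C R where f: "C \<ge> 0" "R \<ge> 1" "\<And>\<alpha>. norm (f \<alpha>) \<le> C * R ^ (\<Sum>i\<in>UNIV. \<alpha> i)"
    using conv_seriesE[OF assms] by blast
  have "norm (pseries_inl f \<gamma>) \<le> C * R ^ (\<Sum>i\<in>UNIV. \<gamma> i)" for \<gamma> :: "'n + 'm \<Rightarrow> nat"
  proof -
    obtain \<alpha> \<beta> where g: "\<gamma> = case_sum \<alpha> \<beta>" using sum_type_fun_eq by blast
    show ?thesis using f unfolding g pseries_inl_case_sum sum_UNIV_case_sum by auto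
  qed
  then show ?thesis using f by (intro conv_seriesI[of R]) auto
qed

lemma conv_inr: assumes "g \<in> conv_series" shows "(pseries_inr g :: ('n::finite + 'm::finite) pseries) \<in> conv_series"
proof -
  obtain C R where f: "C \<ge> 0" "R \<ge> 1" "\<And>\<alpha>. norm (g \<alpha>) \<le> C * R ^ (\<Sum>i\<in>UNIV. \<alpha> i)"
    using conv_seriesE[OF assms] by blast
  have "norm (pseries_inr g \<gamma>) \<le> C * R ^ (\<Sum>i\<in>UNIV. \<gamma> i)" for \<gamma> :: "'n + 'm \<Rightarrow> nat"
  proof -
    obtain \<alpha> \<beta> where g: "\<gamma> = case_sum \<alpha> \<beta>" using sum_type_fun_eq by blast
    show ?thesis using f unfolding g pseries_inr_case_sum sum_UNIV_case_sum by auto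
  qed
  then show ?thesis using f by (intro conv_seriesI[of R]) auto
qed

lemma diff_zero_fun [simp]: "\<beta> - (\<lambda>_. 0) = (\<beta> :: 'a \<Rightarrow> nat)"
  by (rule ext) simp

lemma inl_mult: "(pseries_inl (f \<star> g) :: ('n::finite + 'm::finite) pseries) = pseries_inl f \<star> pseries_inl g"
proof (rule join_series_eqI)
  fix \<alpha> :: "'n \<Rightarrow> nat" and \<beta> :: "'m \<Rightarrow> nat"
  have "((pseries_inl f :: ('n + 'm) pseries) \<star> pseries_inl g) (case_sum \<alpha> \<beta>)
      = (\<Sum>\<beta>'\<in>{..\<beta>}. if \<beta>' = (\<lambda>_. 0) then if \<beta> = (\<lambda>_. 0) then (f \<star> g) \<alpha> else 0 else 0)"
    unfolding pmult_apply sum_atMost_case_sum case_sum_diff pseries_inl_case_sum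
    by (intro sum.cong) auto
  also have "\<dots> = (if \<beta> = (\<lambda>_. 0) then (f \<star> g) \<alpha> else 0)"
    by (subst sum.delta) (auto simp: le_fun_def)
  finally show "pseries_inl (f \<star> g) (case_sum \<alpha> \<beta>) = (pseries_inl f \<star> pseries_inl g) (case_sum \<alpha> \<beta>)"
    unfolding pseries_inl_case_sum by simp
qed

lemma inr_mult: "(pseries_inr (f \<star> g) :: ('n::finite + 'm::finite) pseries) = pseries_inr f \<star> pseries_inr g"
proof (rule join_series_eqI)
  fix \<alpha> :: "'n \<Rightarrow> nat" and \<beta> :: "'m \<Rightarrow> nat"
  have "((pseries_inr f :: ('n + 'm) pseries) \<star> pseries_inr g) (case_sum \<alpha> \<beta>)
      = (\<Sum>\<beta>'\<in>{..\<beta>}. \<Sum>\<alpha>'\<in>{..\<alpha>}. if \<alpha>' = (\<lambda>_. 0) then if \<alpha> = (\<lambda>_. 0) then f \<beta>' * g (\<beta> - \<beta>') else 0 else 0)"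
    unfolding pmult_apply sum_atMost_case_sum case_sum_diff pseries_inr_case_sum
    by (intro sum.cong) auto
  also have "\<dots> = (if \<alpha> = (\<lambda>_. 0) then (f \<star> g) \<beta> else 0)"
    by (subst sum.delta) (auto simp: le_fun_def pmult_apply)
  finally show "pseries_inr (f \<star> g) (case_sum \<alpha> \<beta>) = (pseries_inr f \<star> pseries_inr g) (case_sum \<alpha> \<beta>)"
    unfolding pseries_inr_case_sum by simp
qed

lemma inl_mult_inr: "(pseries_inl f \<star> pseries_inr g) (case_sum \<alpha> \<beta>) = f \<alpha> * g \<beta>"
proof -
  have "(pseries_inl f \<star> pseries_inr g) (case_sum \<alpha> \<beta>)
      = (\<Sum>\<beta>'\<in>{..\<beta>}. if \<beta>' = (\<lambda>_. 0) then (\<Sum>\<alpha>'\<in>{..\<alpha>}. if \<alpha>' = \<alpha> then f \<alpha> * g \<beta> else 0) else 0)"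
    unfolding pmult_apply sum_atMost_case_sum case_sum_diff pseries_inr_case_sum pseries_inl_case_sum
  proof (intro sum.cong refl, goal_cases)
    case (1 \<beta>')
    have "\<alpha> - \<alpha>' = (\<lambda>_. 0) \<longleftrightarrow> \<alpha>' = \<alpha>" if "\<alpha>' \<in> {..\<alpha>}" for \<alpha>'
      using that by (auto simp: le_fun_def fun_eq_iff intro: antisym)
    then have "(\<Sum>\<alpha>'\<in>{..\<alpha>}. f \<alpha>' * (if \<alpha> - \<alpha>' = (\<lambda>_. 0) then g \<beta> else 0))
        = (\<Sum>\<alpha>'\<in>{..\<alpha>}. if \<alpha>' = \<alpha> then f \<alpha> * g \<beta> else 0)"
      by (intro sum.cong) auto
    then show ?case by (cases "\<beta>' = (\<lambda>_. 0)") (simp_all cong: if_cong)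
  qed
  also have "\<dots> = f \<alpha> * g \<beta>" by (subst sum.delta) (auto simp: le_fun_def)
  finally show ?thesis .
qed

lemma slice_inl_mult_inr: "slice (pseries_inl f \<star> pseries_inr g) \<beta> = smul (g \<beta>) f"
  by (rule ext) (simp add: slice_def inl_mult_inr)

lemma case_sum_eq_zero_iff: "case_sum \<alpha> \<beta> = (\<lambda>_. 0) \<longleftrightarrow> \<alpha> = (\<lambda>_. 0) \<and> \<beta> = (\<lambda>_. 0 :: nat)"
proof
  assume "case_sum \<alpha> \<beta> = (\<lambda>_. 0)"
  then have "case_sum \<alpha> \<beta> (Inl i) = 0" "case_sum \<alpha> \<beta> (Inr j) = 0" for i j by simp_all
  then show "\<alpha> = (\<lambda>_. 0) \<and> \<beta> = (\<lambda>_. 0)" by (simp add: fun_eq_iff)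
qed (auto simp: fun_eq_iff split: sum.split)

lemma inl_const: "pseries_inl (pseries_const c) = pseries_const c"
  by (rule join_series_eqI) (simp add: pseries_inl_case_sum pseries_const_def case_sum_eq_zero_iff)

lemma inr_const: "pseries_inr (pseries_const c) = pseries_const c"
  by (rule join_series_eqI) (simp add: pseries_inr_case_sum pseries_const_def case_sum_eq_zero_iff)

lemma inl_add: "pseries_inl (f + g) = pseries_inl f + pseries_inl g"
  by (rule ext) (simp add: pseries_inl_def)

lemma inr_add: "pseries_inr (f + g) = pseries_inr f + pseries_inr g"
  by (rule ext) (simp add: pseries_inr_def)

lemma inl_smul: "pseries_inl (smul c f) = smul c (pseries_inl f)"
  by (rule ext) (simp add: pseries_inl_def)

lemma inr_smul: "pseries_inr (smul c f) = smul c (pseries_inr f)"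
  by (rule ext) (simp add: pseries_inr_def)

lemma linear_inl: "Vector_Spaces.linear smul smul pseries_inl"
  by unfold_locales (simp_all add: inl_add inl_smul)

lemma linear_inr: "Vector_Spaces.linear smul smul pseries_inr"
  by unfold_locales (simp_all add: inr_add inr_smul)

interpretation inl: Vector_Spaces.linear smul smul pseries_inl by (rule linear_inl)
interpretation inr: Vector_Spaces.linear smul smul pseries_inr by (rule linear_inr)

lemma monom_case_sum:
  "monom_series (case_sum \<alpha> \<beta>) = pseries_inl (monom_series \<alpha>) \<star> pseries_inr (monom_series \<beta>)"
proof (rule join_series_eqI)
  fix \<alpha>' \<beta>'
  have "case_sum \<alpha>' \<beta>' = case_sum \<alpha> \<beta> \<longleftrightarrow> \<alpha>' = \<alpha> \<and> \<beta>' = \<beta>"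
    using case_sum_o_inj by metis
  then show "monom_series (case_sum \<alpha> \<beta>) (case_sum \<alpha>' \<beta>')
      = (pseries_inl (monom_series \<alpha>) \<star> pseries_inr (monom_series \<beta>)) (case_sum \<alpha>' \<beta>')"
    unfolding inl_mult_inr by (simp add: monom_series_def)
qed

text \<open>\<open>T\<close> induces an injection of the quotients, so a flag of length n + 1 above
  \<open>I\<close> would give one above \<open>K\<close>, which is too long.\<close>

lemma finite_codim_preimage:
  fixes T :: "'k::finite pseries \<Rightarrow> 'l::finite pseries"
  assumes I: "pideal I" and K: "pideal K" and T: "Vector_Spaces.linear smul smul T"
    and conv: "\<And>f. f \<in> conv_series \<Longrightarrow> T f \<in> conv_series"
    and iff: "\<And>f. T f \<in> K \<longleftrightarrow> f \<in> I"
    and fin: "pv.flag K n conv_series"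
  shows "\<exists>n. pv.flag I n conv_series"
proof (rule ccontr)
  assume "\<nexists>n. pv.flag I n conv_series"
  from pv.long_flag_if_infinite[OF this pideal_subspace[OF I] pideal_conv[OF I] subspace_conv]
  obtain E where E: "pv.flag I (Suc n) E" "E \<subseteq> conv_series" by blast
  have "pv.flag K (Suc n) {y. \<exists>x\<in>E. y - T x \<in> K}"
    by (rule pvp.flag_image[OF E(1) T pideal_subspace[OF I] pideal_subspace[OF K]]) (rule iff)
  moreover have "{y. \<exists>x\<in>E. y - T x \<in> K} \<subseteq> conv_series"
  proof safe
    fix y x assume "x \<in> E" "y - T x \<in> K"
    then have "(y - T x) + T x \<in> conv_series"
      using E(2) conv pideal_conv[OF K] by (intro conv_add) blast+
    then show "y \<in> conv_series" by simp
  qed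
  ultimately have "Suc n \<le> n" using pv.flag_le[OF fin _ _ pideal_subspace[OF K]] by blast
  then show False by simp
qed

subsection \<open>The ideal generated by two ideals in separate variables\<close>

definition join_ideal :: "'n::finite pseries set \<Rightarrow> 'm::finite pseries set \<Rightarrow> ('n + 'm) pseries set" where
  "join_ideal I1 I2 = Idl\<^bsub>pseries_ring\<^esub> (pseries_inl ` I1 \<union> pseries_inr ` I2)"


text \<open>
  A functional that vanishes on an ideal of finite codimension depends on finitely many coefficients
  only; it is represented by its vector \<open>d\<close> of values on monomials, and \<open>contract\<close> applies it in the
  second group of variables.
\<close>

definition annihilators :: "nat \<Rightarrow> 'm::finite pseries set \<Rightarrow> (('m \<Rightarrow> nat) \<Rightarrow> complex) set" where
  "annihilators N I = {d. (\<forall>\<beta>. \<beta> \<notin> exp_box N \<longrightarrow> d \<beta> = 0) \<and> (\<forall>g\<in>I. (\<Sum>\<beta>\<in>exp_box N. d \<beta> * g \<beta>) = 0)}"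

definition contract :: "nat \<Rightarrow> (('m \<Rightarrow> nat) \<Rightarrow> complex) \<Rightarrow> ('n::finite + 'm::finite) pseries \<Rightarrow> 'n pseries" where
  "contract N d F = (\<Sum>\<beta>\<in>exp_box N. smul (d \<beta>) (slice F \<beta>))"

lemma contract_inl_mult_inr:
  "contract N d (pseries_inl f \<star> pseries_inr g) = smul (\<Sum>\<beta>\<in>exp_box N. d \<beta> * g \<beta>) f"
  unfolding contract_def slice_inl_mult_inr
  by (rule ext) (simp add: sum_fun_apply sum_distrib_right mult.assoc)

lemma contract_add: "contract N d (F + G) = contract N d F + contract N d G"
  unfolding contract_def by (rule ext) (simp add: sum_fun_apply slice_def algebra_simps sum.distrib)

lemma contract_smul: "contract N d (smul c F) = smul c (contract N d F)"
  unfolding contract_def by (rule ext) (simp add: sum_fun_apply slice_def sum_distrib_left mult_ac)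

lemma contract_zero: "contract N d 0 = 0"
  unfolding contract_def by (rule ext) (simp add: sum_fun_apply slice_def)

lemma contract_sum: "contract N d (\<Sum>a\<in>A. F a) = (\<Sum>a\<in>A. contract N d (F a))"
  by (induction A rule: infinite_finite_induct)
     (simp_all only: sum.infinite sum.empty sum.insert contract_add contract_zero not_False_eq_True)

lemma pmult_sum_right: "h \<star> (\<Sum>a\<in>A. f a) = (\<Sum>a\<in>A. h \<star> f a)"
proof -
  have "h \<star> 0 = 0" by (rule ext) (simp add: pmult_apply)
  then show ?thesis
    by (induction A rule: infinite_finite_induct) (simp_all only: sum.infinite sum.empty sum.insert pmult_add_right not_False_eq_True)
qed

lemma pmult_sum_left: "(\<Sum>a\<in>A. f a) \<star> h = (\<Sum>a\<in>A. f a \<star> h)"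
  by (subst pmult_comm) (simp add: pmult_sum_right pmult_comm)

text \<open>With \<gamma> = \<beta> + \<delta>, the slices of \<open>H\<close> move out of the
  contraction and the functional is shifted by \<beta>. Pairs in the box whose sum leaves it carry
  the factor \<open>d (\<beta> + \<delta>) = 0\<close>; they are the neutral terms of the
  reindexing.\<close>

lemma contract_mult:
  assumes "\<And>\<beta>. \<beta> \<notin> exp_box N \<Longrightarrow> d \<beta> = 0"
  shows "contract N d (H \<star> F) = (\<Sum>\<beta>\<in>exp_box N. slice H \<beta> \<star> contract N (\<lambda>\<delta>. d (\<beta> + \<delta>)) F)"
proof -
  have eq: "contract N d (H \<star> F) = (\<Sum>(\<gamma>, \<beta>)\<in>Sigma (exp_box N) (\<lambda>\<gamma>. {..\<gamma>}). smul (d \<gamma>) (slice H \<beta> \<star> slice F (\<gamma> - \<beta>)))"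
    unfolding contract_def slice_mult
    by (subst sum.Sigma[symmetric]) (auto simp: pv.scale_sum_right)
  also have "\<dots> = (\<Sum>(\<beta>, \<delta>)\<in>exp_box N \<times> exp_box N. smul (d (\<beta> + \<delta>)) (slice H \<beta> \<star> slice F \<delta>))"
  proof (rule sum.reindex_bij_witness_not_neutral[of "{}" "{p \<in> exp_box N \<times> exp_box N. fst p + snd p \<notin> exp_box N}" _
      "\<lambda>(\<beta>, \<delta>). (\<beta> + \<delta>, \<beta>)" "\<lambda>(\<gamma>, \<beta>). (\<beta>, \<gamma> - \<beta>)"], goal_cases)
    case (3 p)
    then obtain \<gamma> \<beta> where p: "p = (\<gamma>, \<beta>)" "\<gamma> \<in> exp_box N" "\<And>i. \<beta> i \<le> \<gamma> i" by (auto simp: le_fun_def)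
    then show ?case by (auto simp: fun_eq_iff)
  next
    case (4 p)
    then obtain \<gamma> \<beta> where p: "p = (\<gamma>, \<beta>)" "\<gamma> \<in> exp_box N" "\<And>i. \<beta> i \<le> \<gamma> i" by (auto simp: le_fun_def)
    have "\<beta> + (\<gamma> - \<beta>) = \<gamma>" using p(3) by (auto simp: fun_eq_iff)
    moreover have "\<beta> \<in> exp_box N" "\<gamma> - \<beta> \<in> exp_box N"
      using p(2,3) by (auto simp: exp_box_def intro: le_less_trans le_less_trans[OF diff_le_self])
    ultimately show ?case using p by auto
  next
    case (5 p)
    then show ?case by (auto simp: fun_eq_iff)
  next
    case (6 p)
    then show ?case by (auto simp: le_fun_def)
  next
    case (8 p)
    then show ?case using assms by auto
  next
    case (9 p)
    then obtain \<gamma> \<beta> where p: "p = (\<gamma>, \<beta>)" "\<And>i. \<beta> i \<le> \<gamma> i" by (auto simp: le_fun_def)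
    have "\<beta> + (\<gamma> - \<beta>) = \<gamma>" using p(2) by (auto simp: fun_eq_iff)
    then show ?case using p by simp
  qed auto
  also have "\<dots> = (\<Sum>\<beta>\<in>exp_box N. slice H \<beta> \<star> contract N (\<lambda>\<delta>. d (\<beta> + \<delta>)) F)"
    unfolding contract_def by (subst sum.cartesian_product[symmetric]) (simp add: pmult_sum_right pmult_smul_right)
  finally show ?thesis .
qed

text \<open>The shifted functional is \<open>d\<close> composed with multiplication by the monomial
  \<beta>, under which \<open>I\<close> is stable.\<close>

lemma annihilator_shift:
  assumes I: "pideal I" and d: "d \<in> annihilators N I"
  shows "(\<lambda>\<delta>. d (\<beta> + \<delta>)) \<in> annihilators N I"
proof -
  have out: "d (\<beta> + \<delta>) = 0" if "\<delta> \<notin> exp_box N" for \<delta>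
  proof -
    have "\<beta> + \<delta> \<notin> exp_box N" using that by (auto simp: exp_box_def not_less intro: trans_le_add2)
    then show ?thesis using d by (auto simp: annihilators_def)
  qed
  have "(\<Sum>\<delta>\<in>exp_box N. d (\<beta> + \<delta>) * g \<delta>) = 0" if g: "g \<in> I" for g
  proof -
    have "(\<Sum>\<gamma>\<in>exp_box N. d \<gamma> * (monom_series \<beta> \<star> g) \<gamma>) = 0"
      using d pideal_mult[OF I g conv_monom] by (auto simp: annihilators_def)
    also have "(\<Sum>\<gamma>\<in>exp_box N. d \<gamma> * (monom_series \<beta> \<star> g) \<gamma>) = (\<Sum>\<delta>\<in>exp_box N. d (\<beta> + \<delta>) * g \<delta>)"
    proof -
      have "(\<Sum>\<gamma>\<in>exp_box N. d \<gamma> * (monom_series \<beta> \<star> g) \<gamma>)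
          = (\<Sum>\<gamma>\<in>{\<gamma> \<in> exp_box N. \<beta> \<le> \<gamma>}. d \<gamma> * g (\<gamma> - \<beta>))"
        by (intro sum.mono_neutral_cong_right) (auto simp: monom_mult_apply)
      also have "\<dots> = (\<Sum>\<delta>\<in>{\<delta> \<in> exp_box N. \<beta> + \<delta> \<in> exp_box N}. d (\<beta> + \<delta>) * g \<delta>)"
      proof (rule sum.reindex_bij_witness[of _ "\<lambda>\<delta>. \<beta> + \<delta>" "\<lambda>\<gamma>. \<gamma> - \<beta>"])
        fix \<gamma> assume \<gamma>: "\<gamma> \<in> {\<gamma> \<in> exp_box N. \<beta> \<le> \<gamma>}"
        then have "\<beta> i \<le> \<gamma> i" for i by (auto simp: le_fun_def)
        then show e: "\<beta> + (\<gamma> - \<beta>) = \<gamma>" by (auto simp: fun_eq_iff)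
        have "\<gamma> - \<beta> \<in> exp_box N" using \<gamma> by (auto simp: exp_box_def intro: le_less_trans[OF diff_le_self])
        then show "\<gamma> - \<beta> \<in> {\<delta> \<in> exp_box N. \<beta> + \<delta> \<in> exp_box N}" using e \<gamma> by auto
        show "d (\<beta> + (\<gamma> - \<beta>)) * g (\<gamma> - \<beta>) = d \<gamma> * g (\<gamma> - \<beta>)" using e by simp
      next
        fix \<delta> assume "\<delta> \<in> {\<delta> \<in> exp_box N. \<beta> + \<delta> \<in> exp_box N}"
        then show "\<beta> + \<delta> \<in> {\<gamma> \<in> exp_box N. \<beta> \<le> \<gamma>}" by (auto simp: le_fun_def)
        show "\<beta> + \<delta> - \<beta> = \<delta>" by (auto simp: fun_eq_iff)
      qed
      also have "\<dots> = (\<Sum>\<delta>\<in>exp_box N. d (\<beta> + \<delta>) * g \<delta>)"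
        using d by (intro sum.mono_neutral_left) (auto simp: annihilators_def)
      finally show ?thesis .
    qed
    finally show ?thesis .
  qed
  then show ?thesis using out by (auto simp: annihilators_def)
qed

text \<open>Annihilators are closed under shifts, so by \<open>contract_mult\<close> the condition
  is stable under multiplication. Minimality of generated ideals then transfers it to
  \<open>join_ideal\<close>.\<close>

lemma pideal_contract:
  fixes I1 :: "'n::finite pseries set" and I2 :: "'m::finite pseries set"
  assumes "pideal I1" "pideal I2"
  shows "pideal {F \<in> conv_series. \<forall>d\<in>annihilators N I2. contract N d F \<in> I1}"
proof (rule pidealI)
  have s: "pv.subspace I1" using assms pideal_subspace by blast
  show "0 \<in> {F \<in> conv_series. \<forall>d\<in>annihilators N I2. contract N d F \<in> I1}"
    using pv.subspace_0[OF s] by (simp only: mem_Collect_eq contract_zero conv_zero) blast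
  fix F G :: "('n + 'm) pseries" assume F: "F \<in> {F \<in> conv_series. \<forall>d\<in>annihilators N I2. contract N d F \<in> I1}"
  {
    assume "G \<in> {F \<in> conv_series. \<forall>d\<in>annihilators N I2. contract N d F \<in> I1}"
    then show "F + G \<in> {F \<in> conv_series. \<forall>d\<in>annihilators N I2. contract N d F \<in> I1}"
      using F pv.subspace_add[OF s] by (simp add: contract_add conv_add)
  }
  assume H: "G \<in> conv_series"
  have "contract N d (G \<star> F) \<in> I1" if d: "d \<in> annihilators N I2" for d
  proof -
    have eq: "contract N d (G \<star> F) = (\<Sum>\<beta>\<in>exp_box N. slice G \<beta> \<star> contract N (\<lambda>\<delta>. d (\<beta> + \<delta>)) F)"
      using d by (intro contract_mult) (auto simp: annihilators_def)
    have "slice G \<beta> \<star> contract N (\<lambda>\<delta>. d (\<beta> + \<delta>)) F \<in> I1" for \<beta>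
      using F annihilator_shift[OF assms(2) d] H by (intro pideal_mult[OF assms(1)] conv_slice) auto
    then show ?thesis unfolding eq by (rule pv.subspace_sum[OF s])
  qed
  then show "G \<star> F \<in> {F \<in> conv_series. \<forall>d\<in>annihilators N I2. contract N d F \<in> I1}"
    using F H by (auto intro: conv_mult)
qed auto

context
  fixes I1 :: "'n::finite pseries set" and I2 :: "'m::finite pseries set"
  assumes I1: "pideal I1" and I2: "pideal I2"
begin

lemma generators_conv: "pseries_inl ` I1 \<union> pseries_inr ` I2 \<subseteq> conv_series"
  using pideal_conv[OF I1] pideal_conv[OF I2] conv_inl conv_inr by blast

lemma pideal_join: "pideal (join_ideal I1 I2)"
  unfolding join_ideal_def by (rule pr.genideal_ideal[OF generators_conv])

lemma inl_mem_join: "f \<in> I1 \<Longrightarrow> pseries_inl f \<in> join_ideal I1 I2"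
  unfolding join_ideal_def using pr.genideal_self[OF generators_conv] by blast

lemma inr_mem_join: "f \<in> I2 \<Longrightarrow> pseries_inr f \<in> join_ideal I1 I2"
  unfolding join_ideal_def using pr.genideal_self[OF generators_conv] by blast

text \<open>The tool for proving that a series is not in the join ideal. On generators, a
  contraction gives a scalar multiple of an element of \<open>I1\<close>, or the value of
  \<open>d\<close> on an element of \<open>I2\<close>, which is 0.\<close>

lemma contract_join:
  assumes "F \<in> join_ideal I1 I2" "d \<in> annihilators N I2"
  shows "contract N d F \<in> I1"
proof -
  have c1: "contract N d (pseries_inl f) \<in> I1" if "f \<in> I1" for f d
  proof -
    have "pseries_inl f = pseries_inl f \<star> pseries_inr (pseries_const 1)"
      by (simp add: inr_const pmult_comm[of _ "pseries_const 1"])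
    then have "contract N d (pseries_inl f) = smul (\<Sum>\<beta>\<in>exp_box N. d \<beta> * pseries_const 1 \<beta>) f"
      using contract_inl_mult_inr by metis
    then show ?thesis using pv.subspace_scale[OF pideal_subspace[OF I1] that] by metis
  qed
  have c2: "contract N d (pseries_inr g) \<in> I1" if "g \<in> I2" "d \<in> annihilators N I2" for g d
  proof -
    have "pseries_inr g = pseries_inl (pseries_const 1) \<star> pseries_inr g"
      by (simp add: inl_const)
    then have "contract N d (pseries_inr g) = smul (\<Sum>\<beta>\<in>exp_box N. d \<beta> * g \<beta>) (pseries_const 1)"
      using contract_inl_mult_inr by metis
    also have "\<dots> = smul 0 (pseries_const 1)" using that by (simp add: annihilators_def)
    also have "\<dots> = 0" by (rule ext) simp
    finally show ?thesis using pv.subspace_0[OF pideal_subspace[OF I1]] by metis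
  qed
  have "join_ideal I1 I2 \<subseteq> {F \<in> conv_series. \<forall>d\<in>annihilators N I2. contract N d F \<in> I1}"
    unfolding join_ideal_def
    by (rule pr.genideal_minimal[OF pideal_contract[OF I1 I2]])
       (use generators_conv c1 c2 in auto)
  then show ?thesis using assms by auto
qed

text \<open>Evaluation at the origin annihilates \<open>I2\<close>, which lies in the maximal ideal;
  contracting with it sets the second variables to 0 and recovers \<open>f\<close>.\<close>

lemma inl_mem_join_iff:
  assumes max: "I2 \<subseteq> max_ideal"
  shows "pseries_inl f \<in> join_ideal I1 I2 \<longleftrightarrow> f \<in> I1"
proof
  have box1: "exp_box 1 = {\<lambda>_. 0 :: nat}" by (auto simp: exp_box_def fun_eq_iff)
  have d: "pseries_const 1 \<in> annihilators 1 I2"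
    using max unfolding annihilators_def box1 max_ideal_def by (auto simp: pseries_const_def)
  assume "pseries_inl f \<in> join_ideal I1 I2"
  from contract_join[OF this d] have "slice (pseries_inl f :: ('n + 'm) pseries) (\<lambda>_. 0) \<in> I1"
    unfolding contract_def box1 by (simp add: pseries_const_def)
  moreover have "slice (pseries_inl f :: ('n + 'm) pseries) (\<lambda>_. 0) = f"
    by (rule ext) (simp add: slice_def pseries_inl_case_sum)
  ultimately show "f \<in> I1" by simp
qed (rule inl_mem_join)

text \<open>Contraction acts on the second variables only, so here the substitution
  \<open>?r\<close> of 0 for the first variables is shown directly to be multiplicative and to send
  the generators into \<open>I2\<close>.\<close>

lemma inr_mem_join_iff:
  assumes max: "I1 \<subseteq> max_ideal"
  shows "pseries_inr g \<in> join_ideal I1 I2 \<longleftrightarrow> g \<in> I2"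
proof
  let ?r = "\<lambda>(F :: ('n + 'm) pseries) \<beta>. F (case_sum (\<lambda>_. 0) \<beta>)"
  have r0: "{..(\<lambda>_. 0) :: 'n \<Rightarrow> nat} = {\<lambda>_. 0}" by (auto simp: le_fun_def fun_eq_iff)
  have r_mult: "?r (H \<star> F) = ?r H \<star> ?r F" for H F
    by (rule ext) (simp add: pmult_apply sum_atMost_case_sum case_sum_diff r0 zero_fun_def)
  have r_inl: "?r (pseries_inl f) = smul (f (\<lambda>_. 0)) (pseries_const 1)" for f
    by (rule ext) (simp add: pseries_inl_case_sum pseries_const_def)
  have r_inr: "?r (pseries_inr f) = f" for f
    by (rule ext) (simp add: pseries_inr_case_sum)
  have r_conv: "?r F \<in> conv_series" if "F \<in> conv_series" for F
  proof -
    obtain C R where f: "C \<ge> 0" "R \<ge> 1" "\<And>\<alpha>. norm (F \<alpha>) \<le> C * R ^ (\<Sum>i\<in>UNIV. \<alpha> i)"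
      using conv_seriesE[OF \<open>F \<in> conv_series\<close>] by blast
    have "norm (?r F \<beta>) \<le> C * R ^ (\<Sum>i\<in>UNIV. \<beta> i)" for \<beta>
      using f(3)[of "case_sum (\<lambda>_. 0) \<beta>"] unfolding sum_UNIV_case_sum by simp
    then show ?thesis using f(2) by (rule conv_seriesI[rotated])
  qed
  have "pideal {F \<in> conv_series. ?r F \<in> I2}"
  proof (rule pidealI)
    have r_zero: "?r 0 = 0" by (rule ext) simp
    show "0 \<in> {F \<in> conv_series. ?r F \<in> I2}"
      unfolding mem_Collect_eq r_zero using conv_zero pv.subspace_0[OF pideal_subspace[OF I2]] by blast
    have r_add: "?r (F + G) = ?r F + ?r G" for F G by (rule ext) simp
    show "F + G \<in> {F \<in> conv_series. ?r F \<in> I2}"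
      if "F \<in> {F \<in> conv_series. ?r F \<in> I2}" "G \<in> {F \<in> conv_series. ?r F \<in> I2}" for F G
      using that unfolding mem_Collect_eq r_add
      using conv_add pv.subspace_add[OF pideal_subspace[OF I2]] by blast
    show "H \<star> F \<in> {F \<in> conv_series. ?r F \<in> I2}"
      if "F \<in> {F \<in> conv_series. ?r F \<in> I2}" "H \<in> conv_series" for F H
      using that unfolding mem_Collect_eq r_mult
      using conv_mult pideal_mult[OF I2] r_conv by blast
  qed auto
  then have "join_ideal I1 I2 \<subseteq> {F \<in> conv_series. ?r F \<in> I2}"
    unfolding join_ideal_def
  proof (rule pr.genideal_minimal)
    have "?r (pseries_inl f) \<in> I2" if "f \<in> I1" for f
    proof -
      have "smul (f (\<lambda>_. 0)) (pseries_const 1) = (0 :: 'm pseries)"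
        using max that by (intro ext) (auto simp: max_ideal_def)
      then show ?thesis unfolding r_inl using pv.subspace_0[OF pideal_subspace[OF I2]] by (simp only:)
    qed
    then show "pseries_inl ` I1 \<union> pseries_inr ` I2 \<subseteq> {F \<in> conv_series. ?r F \<in> I2}"
      using generators_conv r_inr by auto
  qed
  moreover assume "pseries_inr g \<in> join_ideal I1 I2"
  ultimately show "g \<in> I2" using r_inr[of g] by auto
qed (rule inr_mem_join)

text \<open>The functional is the j-th coordinate with respect to the basis \<open>v\<close> modulo
  \<open>I2\<close>. It is recorded by its values on the monomials of the box, which determine it
  because every series is congruent to its truncation.\<close>

lemma separating_annihilator:
  fixes v :: "nat \<Rightarrow> 'm pseries"
  assumes N: "\<And>i. monom_series (axis_exp i N) \<in> I2"
    and v: "pv.free_mod I2 v {..<q}" "conv_series = pv.combs I2 v {..<q}" "\<And>j. j < q \<Longrightarrow> v j \<in> conv_series"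
    and j: "j < q"
  obtains d where "d \<in> annihilators N I2"
    "\<And>j'. j' < q \<Longrightarrow> (\<Sum>\<beta>\<in>exp_box N. d \<beta> * v j' \<beta>) = (if j' = j then 1 else 0)"
proof -
  have s: "pv.subspace I2" using pideal_subspace[OF I2] .
  have "\<forall>g\<in>conv_series. \<exists>c. g - (\<Sum>j<q. smul (c j) (v j)) \<in> I2"
    using v(2) unfolding pv.combs_def by blast
  then obtain c where c: "\<And>g. g \<in> conv_series \<Longrightarrow> g - (\<Sum>j<q. smul (c g j) (v j)) \<in> I2"
    by metis
  have uniq: "c g j = a j" if "g \<in> conv_series" "g - (\<Sum>j<q. smul (a j) (v j)) \<in> I2" for g a
  proof -
    have "(g - (\<Sum>j<q. smul (a j) (v j))) - (g - (\<Sum>j<q. smul (c g j) (v j))) \<in> I2"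
      using pv.subspace_diff[OF s that(2) c[OF that(1)]] .
    then have "(\<Sum>j<q. smul (c g j - a j) (v j)) \<in> I2"
      by (simp add: pv.scale_left_diff_distrib sum_subtractf algebra_simps)
    then show ?thesis using v(1) j unfolding pv.free_mod_def by fastforce
  qed
  define d where "d = (\<lambda>\<beta>. if \<beta> \<in> exp_box N then c (monom_series \<beta>) j else 0)"
  have main: "(\<Sum>\<beta>\<in>exp_box N. d \<beta> * g \<beta>) = c g j" if g: "g \<in> conv_series" for g
  proof -
    let ?a = "\<lambda>j. \<Sum>\<beta>\<in>exp_box N. c (monom_series \<beta>) j * g \<beta>"
    have "(\<Sum>\<beta>\<in>exp_box N. smul (g \<beta>) (monom_series \<beta> - (\<Sum>j<q. smul (c (monom_series \<beta>) j) (v j)))) \<in> I2"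
      using c conv_monom by (intro pv.subspace_sum[OF s] pv.subspace_scale[OF s]) auto
    \<comment> \<open>The error of truncating \<open>g\<close> plus the errors of expanding each
      monomial in the basis: both lie in \<open>I2\<close>, and together they compare
      \<open>g\<close> with the combination with coefficients \<open>?a\<close>.\<close>
    then have "(g - (\<Sum>\<beta>\<in>exp_box N. smul (g \<beta>) (monom_series \<beta>))) +
        (\<Sum>\<beta>\<in>exp_box N. smul (g \<beta>) (monom_series \<beta> - (\<Sum>j<q. smul (c (monom_series \<beta>) j) (v j)))) \<in> I2"
      using pv.subspace_add[OF s truncation_mod_ideal[OF I2 N g]] by blast
    also have "(g - (\<Sum>\<beta>\<in>exp_box N. smul (g \<beta>) (monom_series \<beta>))) +
        (\<Sum>\<beta>\<in>exp_box N. smul (g \<beta>) (monom_series \<beta> - (\<Sum>j<q. smul (c (monom_series \<beta>) j) (v j))))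
        = g - (\<Sum>j<q. smul (?a j) (v j))"
      by (simp add: pv.scale_right_diff_distrib sum_subtractf pv.scale_sum_right pv.scale_sum_left mult.commute)
         (rule sum.swap)
    finally have "c g j = ?a j" by (rule uniq[OF g])
    also have "?a j = (\<Sum>\<beta>\<in>exp_box N. d \<beta> * g \<beta>)" by (intro sum.cong) (auto simp: d_def)
    finally show ?thesis ..
  qed
  have "d \<in> annihilators N I2"
  proof -
    have "c g j = 0" if "g \<in> I2" for g
      using uniq[of g "\<lambda>_. 0"] that pideal_conv[OF I2] by auto
    then show ?thesis using main pideal_conv[OF I2] by (auto simp: annihilators_def) (auto simp: d_def)
  qed
  moreover have "(\<Sum>\<beta>\<in>exp_box N. d \<beta> * v j' \<beta>) = (if j' = j then 1 else 0)" if "j' < q" for j'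
  proof -
    have "(\<Sum>i<q. smul (if j' = i then 1 else 0) (v i)) = (\<Sum>i<q. if j' = i then v i else 0)"
      by (intro sum.cong) auto
    also have "\<dots> = v j'" using that by (subst sum.delta') auto
    finally have "v j' - (\<Sum>i<q. smul (if j' = i then 1 else 0) (v i)) \<in> I2"
      using pv.subspace_0[OF s] by simp
    from uniq[OF v(3)[OF that] this] show ?thesis using main[OF v(3)[OF that]] by simp
  qed
  ultimately show thesis using that by blast
qed

text \<open>The tensor product of two bases. Independence: contracting a relation with the j-th
  coordinate functional leaves a relation between the \<open>u i\<close> modulo \<open>I1\<close>.
  Spanning: modulo the ideal only the monomials of a box remain, each a product of one monomial per
  group.\<close>

lemma codim_join:
  assumes f1: "pv.flag I1 p conv_series" and f2: "pv.flag I2 q conv_series"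
  shows "pv.flag (join_ideal I1 I2) (p * q) conv_series"
proof -
  let ?K = "join_ideal I1 I2"
  have K: "pv.subspace ?K" using pideal_subspace[OF pideal_join] .
  obtain u where u: "\<And>i. i < p \<Longrightarrow> u i \<in> conv_series" "pv.free_mod I1 u {..<p}" "conv_series = pv.combs I1 u {..<p}"
    using pv.flag_basis[OF f1 pideal_subspace[OF I1]] by blast
  obtain v where v: "\<And>i. i < q \<Longrightarrow> v i \<in> conv_series" "pv.free_mod I2 v {..<q}" "conv_series = pv.combs I2 v {..<q}"
    using pv.flag_basis[OF f2 pideal_subspace[OF I2]] by blast
  obtain N1 where N1: "\<And>i. monom_series (axis_exp i N1) \<in> I1" using ideal_contains_high_order[OF I1 f1] by blast
  obtain N2 where N2: "\<And>i. monom_series (axis_exp i N2) \<in> I2" using ideal_contains_high_order[OF I2 f2] by blast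
  define w :: "nat \<times> nat \<Rightarrow> ('n + 'm) pseries" where "w = (\<lambda>(i, j). pseries_inl (u i) \<star> pseries_inr (v j))"
  let ?A = "{..<p} \<times> {..<q}"
  have "pv.free_mod ?K w ?A" unfolding pv.free_mod_def
  proof (intro allI impI ballI)
    fix c a assume c: "(\<Sum>a\<in>?A. smul (c a) (w a)) \<in> ?K" and a: "a \<in> ?A"
    then obtain i j where ij: "a = (i, j)" "i < p" "j < q" by auto
    obtain d where d: "d \<in> annihilators N2 I2"
      "\<And>j'. j' < q \<Longrightarrow> (\<Sum>\<beta>\<in>exp_box N2. d \<beta> * v j' \<beta>) = (if j' = j then 1 else 0)"
      using separating_annihilator[OF N2 v(2,3,1) ij(3)] by blast
    have "contract N2 d (\<Sum>a\<in>?A. smul (c a) (w a)) \<in> I1" using contract_join[OF c d(1)] .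
    also have "contract N2 d (\<Sum>a\<in>?A. smul (c a) (w a))
        = (\<Sum>i'<p. \<Sum>j'<q. smul (c (i', j')) (smul (if j' = j then 1 else 0) (u i')))"
      unfolding contract_sum contract_smul sum.cartesian_product w_def
      by (intro sum.cong) (auto simp: contract_inl_mult_inr d(2))
    also have "\<dots> = (\<Sum>i'<p. smul (c (i', j)) (u i'))"
    proof (intro sum.cong refl)
      fix i'
      have "(\<Sum>j'<q. smul (c (i', j')) (smul (if j' = j then 1 else 0) (u i')))
          = (\<Sum>j'<q. if j' = j then smul (c (i', j)) (u i') else 0)"
        by (intro sum.cong) auto
      then show "(\<Sum>j'<q. smul (c (i', j')) (smul (if j' = j then 1 else 0) (u i'))) = smul (c (i', j)) (u i')"
        using ij(3) by simp
    qed
    finally show "c a = 0" using u(2) ij unfolding pv.free_mod_def by fastforce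
  qed
  then have flag: "pv.flag ?K (card ?A) (pv.combs ?K w ?A)" using K by (intro pv.flag_combs) auto
  let ?W = "pv.combs ?K w ?A"
  have W: "pv.subspace ?W" using pv.flag_subspace[OF flag K] .
  have KW: "?K \<subseteq> ?W" using pv.flag_incl[OF flag] .
  have wW: "w a \<in> ?W" if "a \<in> ?A" for a
  proof -
    have "(\<Sum>b\<in>?A. smul (if a = b then 1 else 0) (w b)) = (\<Sum>b\<in>?A. if a = b then w b else 0)"
      by (intro sum.cong) auto
    also have "\<dots> = w a" using that by (subst sum.delta') auto
    finally have "w a - (\<Sum>b\<in>?A. smul (if a = b then 1 else 0) (w b)) \<in> ?K" using pv.subspace_0[OF K] by simp
    then show ?thesis unfolding pv.combs_def mem_Collect_eq
      by (rule exI[of _ "\<lambda>b. if a = b then 1 else 0"])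
  qed
  \<comment> \<open>Replacing first \<open>f\<close> and then \<open>g\<close> by a congruent
    combination of basis elements changes the product only within the join ideal.\<close>
  have prod: "pseries_inl f \<star> pseries_inr g \<in> ?W" if f: "f \<in> conv_series" and g: "g \<in> conv_series" for f g
  proof -
    obtain a where a: "f - (\<Sum>i<p. smul (a i) (u i)) \<in> I1" using f u(3) unfolding pv.combs_def by blast
    obtain b where b: "g - (\<Sum>j<q. smul (b j) (v j)) \<in> I2" using g v(3) unfolding pv.combs_def by blast
    define f' where "f' = (\<Sum>i<p. smul (a i) (u i))"
    define g' where "g' = (\<Sum>j<q. smul (b j) (v j))"
    have f': "f' \<in> conv_series" unfolding f'_def using u by (intro pv.subspace_sum[OF subspace_conv] conv_smul) auto
    have "pseries_inr g \<star> pseries_inl (f - f') \<in> ?W"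
      using pideal_mult[OF pideal_join inl_mem_join conv_inr[OF g]] a KW by (auto simp: f'_def)
    moreover have "pseries_inl f' \<star> pseries_inr (g - g') \<in> ?W"
      using pideal_mult[OF pideal_join inr_mem_join conv_inl[OF f']] b KW by (auto simp: g'_def)
    moreover have "pseries_inl f' \<star> pseries_inr g' \<in> ?W"
    proof -
      have "pseries_inl f' \<star> pseries_inr g' = (\<Sum>i<p. \<Sum>j<q. smul (a i) (smul (b j) (w (i, j))))"
        by (simp add: f'_def g'_def inl.sum inr.sum inl_smul inr_smul pmult_sum_left pmult_sum_right
            pmult_smul_left pmult_smul_right w_def pv.scale_sum_right del: pv.scale_scale)
          (subst sum.swap, intro sum.cong refl pv.scale_left_commute)
      also have "\<dots> \<in> ?W" using wW by (intro pv.subspace_sum[OF W] pv.subspace_scale[OF W]) auto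
      finally show ?thesis .
    qed
    ultimately have "pseries_inr g \<star> pseries_inl (f - f') + (pseries_inl f' \<star> pseries_inr (g - g')
        + pseries_inl f' \<star> pseries_inr g') \<in> ?W"
      using pv.subspace_add[OF W] by blast
    also have "pseries_inr g \<star> pseries_inl (f - f') + (pseries_inl f' \<star> pseries_inr (g - g')
        + pseries_inl f' \<star> pseries_inr g') = pseries_inl f \<star> pseries_inr g"
      by (simp add: inl.diff inr.diff pmult_diff_left pmult_diff_right pmult_comm[of "pseries_inr g"])
    finally show ?thesis .
  qed
  define N where "N = max N1 N2"
  have "conv_series \<subseteq> ?W"
  proof
    fix F :: "('n + 'm) pseries" assume F: "F \<in> conv_series"
    have N: "monom_series (axis_exp i N) \<in> ?K" for i :: "'n + 'm"
    proof (cases i)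
      case (Inl k)
      have "axis_exp i N = case_sum (axis_exp k (N - N1) + axis_exp k N1) (\<lambda>_. 0)"
        unfolding Inl by (rule ext) (auto simp: N_def split: sum.split)
      then have "monom_series (axis_exp i N) = pseries_inr (monom_series (\<lambda>_. 0))
          \<star> (pseries_inl (monom_series (axis_exp k (N - N1))) \<star> pseries_inl (monom_series (axis_exp k N1)))"
        by (simp only: monom_case_sum monom_mult_monom[symmetric] inl_mult) (rule pmult_comm)
      then show ?thesis
        using pideal_mult[OF pideal_join] inl_mem_join[OF N1] conv_inl conv_inr conv_monom by metis
    next
      case (Inr k)
      have "axis_exp i N = case_sum (\<lambda>_. 0) (axis_exp k (N - N2) + axis_exp k N2)"
        unfolding Inr by (rule ext) (auto simp: N_def split: sum.split)
      then have "monom_series (axis_exp i N) = pseries_inl (monom_series (\<lambda>_. 0))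
          \<star> (pseries_inr (monom_series (axis_exp k (N - N2))) \<star> pseries_inr (monom_series (axis_exp k N2)))"
        by (simp only: monom_case_sum monom_mult_monom[symmetric] inr_mult)
      then show ?thesis
        using pideal_mult[OF pideal_join] inr_mem_join[OF N2] conv_inl conv_inr conv_monom by metis
    qed
    have "(F - (\<Sum>\<gamma>\<in>exp_box N. smul (F \<gamma>) (monom_series \<gamma>))) \<in> ?W"
      using truncation_mod_ideal[OF pideal_join N F] KW by blast
    moreover have "(\<Sum>\<gamma>\<in>exp_box N. smul (F \<gamma>) (monom_series \<gamma>)) \<in> ?W"
    proof (intro pv.subspace_sum[OF W] pv.subspace_scale[OF W])
      fix \<gamma> :: "'n + 'm \<Rightarrow> nat"
      show "monom_series \<gamma> \<in> ?W"
        by (subst sum_type_fun_eq) (simp only: monom_case_sum prod conv_monom)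
    qed
    ultimately have "(F - (\<Sum>\<gamma>\<in>exp_box N. smul (F \<gamma>) (monom_series \<gamma>)))
      + (\<Sum>\<gamma>\<in>exp_box N. smul (F \<gamma>) (monom_series \<gamma>)) \<in> ?W" using pv.subspace_add[OF W] by blast
    then show "F \<in> ?W" by simp
  qed
  moreover have "?W \<subseteq> conv_series"
  proof
    fix F assume "F \<in> ?W"
    then obtain c where c: "F - (\<Sum>a\<in>?A. smul (c a) (w a)) \<in> ?K" unfolding pv.combs_def by blast
    have "(\<Sum>a\<in>?A. smul (c a) (w a)) \<in> conv_series"
      by (intro pv.subspace_sum[OF subspace_conv] conv_smul)
         (auto simp: w_def intro!: conv_mult conv_inl conv_inr u v)
    then have "(F - (\<Sum>a\<in>?A. smul (c a) (w a))) + (\<Sum>a\<in>?A. smul (c a) (w a)) \<in> conv_series"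
      using c pideal_conv[OF pideal_join] by (intro conv_add) blast+
    then show "F \<in> conv_series" by simp
  qed
  ultimately have "?W = conv_series" by blast
  then show ?thesis using flag by (simp add: card_cartesian_product)
qed

text \<open>Over a field a tensor of nonzero classes is nonzero: contracting with a coordinate
  functional that does not vanish on \<open>g\<close> leaves a nonzero multiple of
  \<open>f\<close>.\<close>

lemma inl_mult_inr_notin_join:
  assumes f2: "pv.flag I2 q conv_series" and f: "f \<notin> I1" and g: "g \<in> conv_series" "g \<notin> I2"
  shows "pseries_inl f \<star> pseries_inr g \<notin> join_ideal I1 I2"
proof
  assume h: "pseries_inl f \<star> pseries_inr g \<in> join_ideal I1 I2"
  have s: "pv.subspace I2" using pideal_subspace[OF I2] .
  obtain v where v: "\<And>i. i < q \<Longrightarrow> v i \<in> conv_series" "pv.free_mod I2 v {..<q}" "conv_series = pv.combs I2 v {..<q}"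
    using pv.flag_basis[OF f2 s] by blast
  obtain N where N: "\<And>i. monom_series (axis_exp i N) \<in> I2" using ideal_contains_high_order[OF I2 f2] by blast
  obtain b where b: "g - (\<Sum>j<q. smul (b j) (v j)) \<in> I2" using g v(3) unfolding pv.combs_def by blast
  have "\<exists>j<q. b j \<noteq> 0"
  proof (rule ccontr)
    assume "\<not> (\<exists>j<q. b j \<noteq> 0)"
    then have "(\<Sum>j<q. smul (b j) (v j)) = 0" by (intro sum.neutral) auto
    then show False using b g by simp
  qed
  then obtain j where j: "j < q" "b j \<noteq> 0" by blast
  obtain d where d: "d \<in> annihilators N I2"
      "\<And>j'. j' < q \<Longrightarrow> (\<Sum>\<beta>\<in>exp_box N. d \<beta> * v j' \<beta>) = (if j' = j then 1 else 0)"
    using separating_annihilator[OF N v(2,3,1) j(1)] by blast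
  have "(\<Sum>\<beta>\<in>exp_box N. d \<beta> * (g - (\<Sum>j<q. smul (b j) (v j))) \<beta>) = 0"
    using d(1) b by (auto simp: annihilators_def)
  then have "(\<Sum>\<beta>\<in>exp_box N. d \<beta> * g \<beta>) = (\<Sum>\<beta>\<in>exp_box N. \<Sum>j<q. b j * (d \<beta> * v j \<beta>))"
    by (simp add: sum_fun_apply algebra_simps sum_subtractf sum_distrib_left)
  also have "\<dots> = (\<Sum>j<q. b j * (\<Sum>\<beta>\<in>exp_box N. d \<beta> * v j \<beta>))"
    by (subst sum.swap) (simp add: sum_distrib_left)
  also have "\<dots> = (\<Sum>j'<q. if j' = j then b j else 0)"
    by (intro sum.cong) (auto simp: d(2))
  also have "\<dots> = b j" using j by simp
  finally have "smul (b j) f \<in> I1" using contract_join[OF h d(1)] by (simp add: contract_inl_mult_inr)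
  then have "smul (inverse (b j)) (smul (b j) f) \<in> I1" using pv.subspace_scale[OF pideal_subspace[OF I1]] by blast
  then show False using f j(2) by simp
qed

end

subsection \<open>Adjoining an element to an ideal\<close>

abbreviation plus_ideal :: "'k::finite pseries \<Rightarrow> 'k pseries set \<Rightarrow> 'k pseries set" where
  "plus_ideal a I \<equiv> Idl\<^bsub>pseries_ring\<^esub> {a} <+>\<^bsub>pseries_ring\<^esub> I"

lemma mem_plus_ideal_iff:
  assumes "a \<in> conv_series" "pideal I"
  shows "x \<in> plus_ideal a I \<longleftrightarrow> (\<exists>h\<in>conv_series. x - h \<star> a \<in> I)"
proof -
  have "Idl\<^bsub>pseries_ring\<^esub> {a} = {h \<star> a |h. h \<in> conv_series}"
    using pr.cgenideal_eq_genideal[OF assms(1)] by (auto simp: cgenideal_def)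
  then have "x \<in> plus_ideal a I \<longleftrightarrow> (\<exists>h\<in>conv_series. \<exists>i\<in>I. x = h \<star> a + i)"
    unfolding set_add_def' by auto
  also have "\<dots> \<longleftrightarrow> (\<exists>h\<in>conv_series. x - h \<star> a \<in> I)"
  proof (intro bex_cong refl iffI)
    fix h assume "\<exists>i\<in>I. x = h \<star> a + i"
    then show "x - h \<star> a \<in> I" by auto
  next
    fix h assume "x - h \<star> a \<in> I"
    then show "\<exists>i\<in>I. x = h \<star> a + i" by (intro bexI[of _ "x - h \<star> a"]) auto
  qed
  finally show ?thesis .
qed

lemma pideal_plus: "a \<in> conv_series \<Longrightarrow> pideal I \<Longrightarrow> pideal (plus_ideal a I)"
  by (intro pr.add_ideals pr.genideal_ideal) auto

lemma zero_mult [simp]: "0 \<star> f = 0"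
  by (rule ext) (simp add: pmult_apply)

lemma subset_plus_ideal: assumes "a \<in> conv_series" "pideal I" shows "I \<subseteq> plus_ideal a I"
proof
  fix x assume "x \<in> I"
  then have "x - 0 \<star> a \<in> I" unfolding zero_mult by simp
  then show "x \<in> plus_ideal a I" unfolding mem_plus_ideal_iff[OF assms] using conv_zero by blast
qed

lemma mem_plus_ideal: assumes "a \<in> conv_series" "pideal I" shows "a \<in> plus_ideal a I"
proof -
  have "a - pseries_const 1 \<star> a \<in> I" using pv.subspace_0[OF pideal_subspace[OF assms(2)]] by simp
  then show ?thesis unfolding mem_plus_ideal_iff[OF assms] using conv_const by blast
qed

lemma plus_ideal_minimal:
  assumes "a \<in> conv_series" "pideal I" "pideal L" "I \<subseteq> L" "a \<in> L"
  shows "plus_ideal a I \<subseteq> L"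
proof
  fix x assume "x \<in> plus_ideal a I"
  then obtain h where h: "h \<in> conv_series" "x - h \<star> a \<in> L"
    using mem_plus_ideal_iff[OF assms(1,2)] assms(4) by blast
  then have "(x - h \<star> a) + h \<star> a \<in> L"
    using pv.subspace_add[OF pideal_subspace[OF assms(3)] h(2) pideal_mult[OF assms(3,5) h(1)]] by simp
  then show "x \<in> L" by simp
qed

lemma plus_ideal_absorb:
  assumes "a \<in> I" "pideal I" shows "plus_ideal a I = I"
  using assms pideal_conv[OF assms(2)] by (intro subset_antisym plus_ideal_minimal subset_plus_ideal) auto

lemma plus_ideal_cong:
  assumes "a \<in> conv_series" "b \<in> conv_series" "pideal I" "a - b \<in> I"
  shows "plus_ideal a I = plus_ideal b I"
proof (intro subset_antisym plus_ideal_minimal assms(1-3) subset_plus_ideal pideal_plus)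
  have s: "pv.subspace (plus_ideal a I)" "pv.subspace (plus_ideal b I)"
    using pideal_subspace pideal_plus assms by blast+
  have "(a - b) + b \<in> plus_ideal b I"
    using assms subset_plus_ideal[OF assms(2,3)] mem_plus_ideal[OF assms(2,3)] by (intro pv.subspace_add[OF s(2)]) auto
  then show "a \<in> plus_ideal b I" by simp
  have "a - (a - b) \<in> plus_ideal a I"
    by (rule pv.subspace_diff[OF s(1) mem_plus_ideal[OF assms(1,3)]
        subsetD[OF subset_plus_ideal[OF assms(1,3)] assms(4)]])
  moreover have "a - (a - b) = b" by (rule ext) simp
  ultimately show "b \<in> plus_ideal a I" by (simp only:)
qed

lemma join_ideal_mono:
  assumes "pideal I1" "pideal I2" "pideal L1" "pideal L2" "I1 \<subseteq> L1" "I2 \<subseteq> L2"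
  shows "join_ideal I1 I2 \<subseteq> join_ideal L1 L2"
  unfolding join_ideal_def[of I1]
  by (rule pr.genideal_minimal[OF pideal_join]) (use assms inl_mem_join inr_mem_join in blast)+

text \<open>With \<open>join_plus_right\<close>, this brings the ideals enlarged by one or both
  germs into the form to which \<open>codim_join\<close> applies.\<close>

lemma join_plus_left:
  assumes f: "f \<in> conv_series" and I: "pideal I1" "pideal I2"
  shows "join_ideal (plus_ideal f I1) I2 = plus_ideal (pseries_inl f) (join_ideal I1 I2)"
proof (rule subset_antisym)
  have K: "pideal (join_ideal I1 I2)" "pideal (plus_ideal f I1)" using I f pideal_join pideal_plus by blast+
  have P: "pideal (plus_ideal (pseries_inl f) (join_ideal I1 I2))" using K pideal_plus conv_inl[OF f] by blast
  show "join_ideal (plus_ideal f I1) I2 \<subseteq> plus_ideal (pseries_inl f) (join_ideal I1 I2)"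
    unfolding join_ideal_def[of "plus_ideal f I1"]
  proof (rule pr.genideal_minimal[OF P], safe)
    fix x assume "x \<in> plus_ideal f I1"
    then obtain h where h: "h \<in> conv_series" "x - h \<star> f \<in> I1" using mem_plus_ideal_iff[OF f I(1)] by blast
    then have "pseries_inl x - pseries_inl h \<star> pseries_inl f \<in> join_ideal I1 I2"
      using inl_mem_join[OF I h(2)] by (simp add: inl.diff inl_mult)
    then show "pseries_inl x \<in> plus_ideal (pseries_inl f) (join_ideal I1 I2)"
      unfolding mem_plus_ideal_iff[OF conv_inl[OF f] K(1)] using conv_inl[OF h(1)] by blast
  next
    fix x assume "x \<in> I2"
    then show "pseries_inr x \<in> plus_ideal (pseries_inl f) (join_ideal I1 I2)"
      using inr_mem_join[OF I] subset_plus_ideal[OF conv_inl[OF f] K(1)] by blast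
  qed
  show "plus_ideal (pseries_inl f) (join_ideal I1 I2) \<subseteq> join_ideal (plus_ideal f I1) I2"
    using f I K by (intro plus_ideal_minimal join_ideal_mono inl_mem_join mem_plus_ideal
        subset_plus_ideal conv_inl pideal_join) auto
qed

lemma join_plus_right:
  assumes f: "f \<in> conv_series" and I: "pideal I1" "pideal I2"
  shows "join_ideal I1 (plus_ideal f I2) = plus_ideal (pseries_inr f) (join_ideal I1 I2)"
proof (rule subset_antisym)
  have K: "pideal (join_ideal I1 I2)" "pideal (plus_ideal f I2)" using I f pideal_join pideal_plus by blast+
  have P: "pideal (plus_ideal (pseries_inr f) (join_ideal I1 I2))" using K pideal_plus conv_inr[OF f] by blast
  show "join_ideal I1 (plus_ideal f I2) \<subseteq> plus_ideal (pseries_inr f) (join_ideal I1 I2)"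
    unfolding join_ideal_def[of _ "plus_ideal f I2"]
  proof (rule pr.genideal_minimal[OF P], safe)
    fix x assume "x \<in> plus_ideal f I2"
    then obtain h where h: "h \<in> conv_series" "x - h \<star> f \<in> I2" using mem_plus_ideal_iff[OF f I(2)] by blast
    then have "pseries_inr x - pseries_inr h \<star> pseries_inr f \<in> join_ideal I1 I2"
      using inr_mem_join[OF I h(2)] by (simp add: inr.diff inr_mult)
    then show "pseries_inr x \<in> plus_ideal (pseries_inr f) (join_ideal I1 I2)"
      unfolding mem_plus_ideal_iff[OF conv_inr[OF f] K(1)] using conv_inr[OF h(1)] by blast
  next
    fix x assume "x \<in> I1"
    then show "pseries_inl x \<in> plus_ideal (pseries_inr f) (join_ideal I1 I2)"
      using inl_mem_join[OF I] subset_plus_ideal[OF conv_inr[OF f] K(1)] by blast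
  qed
  show "plus_ideal (pseries_inr f) (join_ideal I1 I2) \<subseteq> join_ideal I1 (plus_ideal f I2)"
    using f I K by (intro plus_ideal_minimal join_ideal_mono inr_mem_join mem_plus_ideal
        subset_plus_ideal conv_inr pideal_join) auto
qed

subsection \<open>The difference of Milnor and Tjurina numbers of a join\<close>

text \<open>\<open>flag_image\<close> for the identity map identifies the dimensions of P/(P
  \<inter> Q) and S/Q. The three conditions on \<open>S\<close> say that it is the sum of
  \<open>P\<close> and \<open>Q\<close>.\<close>

lemma codim_modular_law:
  assumes P: "pideal P" and Q: "pideal Q" and S: "pideal S" "P \<subseteq> S" "Q \<subseteq> S"
    and S_le: "\<And>x. x \<in> S \<Longrightarrow> \<exists>y\<in>P. x - y \<in> Q"
    and m: "pv.flag (P \<inter> Q) m conv_series" and p: "pv.flag P p conv_series"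
    and q: "pv.flag Q q conv_series" and s: "pv.flag S s conv_series"
  shows "m + s = p + q"
proof -
  have PQ: "pv.subspace (P \<inter> Q)" by (rule pv.subspace_inter[OF pideal_subspace[OF P] pideal_subspace[OF Q]])
  obtain a b where ab: "m = a + b" "pv.flag (P \<inter> Q) a P" "pv.flag P b conv_series"
    using pv.flag_split[OF m PQ pideal_subspace[OF P] _ pideal_conv[OF P]] by blast
  have "b = p" using pv.flag_unique[OF ab(3) p pideal_subspace[OF P]] .
  have id: "Vector_Spaces.linear smul smul (\<lambda>x :: 'a pseries. x)" by unfold_locales simp_all
  have "pv.flag Q a {y. \<exists>x\<in>P. y - x \<in> Q}"
    by (rule pvp.flag_image[OF ab(2) id PQ pideal_subspace[OF Q]]) auto
  also have "{y. \<exists>x\<in>P. y - x \<in> Q} = S"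
  proof safe
    fix y x assume "x \<in> P" "y - x \<in> Q"
    then have "(y - x) + x \<in> S"
      by (intro pv.subspace_add[OF pideal_subspace[OF S(1)]] subsetD[OF S(2)] subsetD[OF S(3)])
    then show "y \<in> S" by simp
  qed (use S_le in blast)
  finally have "pv.flag Q (a + s) conv_series" using s by (rule pv.flag_trans)
  then have "a + s = q" using pv.flag_unique[OF _ q pideal_subspace[OF Q]] by blast
  then show ?thesis using ab \<open>b = p\<close> by simp
qed

text \<open>
  Of the codimension drop \<open>n - c\<close> from \<open>K\<close> to \<open>K + (a + b)\<close>, the part \<open>n' - n''\<close> is visible
  modulo \<open>b\<close>; the element \<open>z\<close> witnesses a further drop that is invisible modulo \<open>b\<close>.
\<close>

lemma codim_drop_bound:
  assumes K: "pideal K" and a: "a \<in> conv_series" and b: "b \<in> conv_series"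
    and z: "z \<notin> K" "z \<in> plus_ideal (a + b) K" "z \<in> plus_ideal b K"
    and n: "pv.flag K n conv_series" and n': "pv.flag (plus_ideal b K) n' conv_series"
    and n'': "pv.flag (plus_ideal a (plus_ideal b K)) n'' conv_series"
    and c: "pv.flag (plus_ideal (a + b) K) c conv_series"
  shows "c + 1 + n' \<le> n + n''"
proof -
  let ?I = "plus_ideal (a + b) K" and ?K' = "plus_ideal b K" and ?S = "plus_ideal a (plus_ideal b K)"
  have ab: "a + b \<in> conv_series" using a b by (rule conv_add)
  have I: "pideal ?I" and K': "pideal ?K'" using K ab b pideal_plus by blast+
  have S: "pideal ?S" using K' a pideal_plus by blast
  have sub: "K \<subseteq> ?I \<inter> ?K'" using subset_plus_ideal ab b K by blast
  have IK': "pv.subspace (?I \<inter> ?K')" by (rule pv.subspace_inter[OF pideal_subspace[OF I] pideal_subspace[OF K']])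
  obtain m where m: "pv.flag (?I \<inter> ?K') m conv_series" "m \<le> n" "m = n \<Longrightarrow> ?I \<inter> ?K' = K"
    using pv.flag_codim_mono[OF n pideal_subspace[OF K] IK' sub] pideal_conv[OF I] by blast
  \<comment> \<open>The element \<open>z\<close> separates the intersection from \<open>K\<close>;
    this strict drop is the 1 in the bound.\<close>
  have "m \<noteq> n" using m(3) z by blast
  have aS: "a \<in> ?S" and K'S: "?K' \<subseteq> ?S" using mem_plus_ideal[OF a K'] subset_plus_ideal[OF a K'] .
  have bK': "b \<in> ?K'" using mem_plus_ideal[OF b K] .
  have "?I \<subseteq> ?S"
    using sub K'S aS bK' pv.subspace_add[OF pideal_subspace[OF S]] by (intro plus_ideal_minimal ab K S) auto
  \<comment> \<open>If \<open>x\<close> is congruent to \<open>h \<star> a\<close> modulo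
    \<open>?K'\<close>, it is also congruent to \<open>h \<star> (a + b)\<close>, since
    \<open>b\<close> lies in \<open>?K'\<close>. Hence \<open>?S\<close> is the sum of
    \<open>?I\<close> and \<open>?K'\<close>.\<close>
  moreover have "\<exists>y\<in>?I. x - y \<in> ?K'" if x: "x \<in> ?S" for x
  proof -
    obtain h where h: "h \<in> conv_series" "x - h \<star> a \<in> ?K'" using x mem_plus_ideal_iff[OF a K'] by blast
    have "(x - h \<star> a) - h \<star> b \<in> ?K'"
      using pv.subspace_diff[OF pideal_subspace[OF K'] h(2) pideal_mult[OF K' bK' h(1)]] .
    then have "x - h \<star> (a + b) \<in> ?K'" by (simp add: pmult_add_right diff_diff_eq)
    then show ?thesis by (rule bexI[where x = "h \<star> (a + b)"]) (rule pideal_mult[OF I mem_plus_ideal[OF ab K] h(1)])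
  qed
  ultimately have "m + n'' = c + n'"
    using codim_modular_law[OF I K' S _ K'S _ m(1) c n' n''] by blast
  then show ?thesis using m(2) \<open>m \<noteq> n\<close> by linarith
qed

text \<open>The least exponent that brings \<open>f\<close> into \<open>I\<close> is neither 0, as
  \<open>I\<close> is proper, nor 1, as \<open>f\<close> is outside \<open>I\<close>.\<close>

lemma last_nonzero_power:
  assumes I: "pideal I" "I \<subseteq> max_ideal" and fin: "pv.flag I n conv_series"
    and f: "f \<in> max_ideal" "f \<notin> I"
  obtains k :: nat where "f [^]\<^bsub>pseries_ring\<^esub> Suc k \<notin> I" "f [^]\<^bsub>pseries_ring\<^esub> Suc (Suc k) \<in> I"
proof -
  have f0: "f \<in> conv_series" "f (\<lambda>_. 0) = 0" using f(1) by (auto simp: max_ideal_def)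
  have ex: "\<exists>k::nat. f [^]\<^bsub>pseries_ring\<^esub> k \<in> I" using nilpotent_mod_ideal[OF I(1) fin f0] .
  define l where "l = (LEAST k::nat. f [^]\<^bsub>pseries_ring\<^esub> k \<in> I)"
  have l: "f [^]\<^bsub>pseries_ring\<^esub> l \<in> I" unfolding l_def using LeastI_ex[OF ex] .
  have "pseries_const 1 \<notin> I" using I(2) by (auto simp: pseries_const_def max_ideal_def)
  then have "l \<noteq> 0" using l by (intro notI) simp
  moreover have "l \<noteq> 1" using l f(2) f0(1) by (intro notI) simp
  ultimately obtain k where k: "l = Suc (Suc k)" by (metis One_nat_def not0_implies_Suc)
  then have "f [^]\<^bsub>pseries_ring\<^esub> Suc k \<notin> I" 
    using not_less_Least[of "Suc k" "\<lambda>k. f [^]\<^bsub>pseries_ring\<^esub> k \<in> I"] unfolding l_def by simp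
  then show thesis using that l k by blast
qed

text \<open>The codimensions 2 and 1 make \<open>f\<close> span its ideal modulo \<open>I\<close>,
  so f^2 is congruent to c f and f^(k+1) to c^k f. Nilpotency of \<open>f\<close> modulo
  \<open>I\<close> forces c = 0.\<close>

lemma square_in_ideal:
  assumes I: "pideal I" and two: "pv.flag I 2 conv_series" and max: "f \<in> max_ideal" and notin: "f \<notin> I"
    and one: "pv.flag (plus_ideal f I) 1 conv_series"
  shows "f \<star> f \<in> I"
proof -
  have f: "f \<in> conv_series" "f (\<lambda>_. 0) = 0" "f \<notin> I" using max notin by (auto simp: max_ideal_def)
  have s: "pv.subspace I" using pideal_subspace[OF I] .
  have T: "pideal (plus_ideal f I)" using pideal_plus f(1) I by blast
  have fT: "f \<in> plus_ideal f I" using mem_plus_ideal[OF f(1) I] .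
  obtain m k where mk: "2 = m + k" "pv.flag I m (plus_ideal f I)" "pv.flag (plus_ideal f I) k conv_series"
    using pv.flag_split[OF two s pideal_subspace[OF T] subset_plus_ideal[OF f(1) I] pideal_conv[OF T]] by blast
  have "k = 1" using pv.flag_unique[OF mk(3) one pideal_subspace[OF T]] .
  then have "pv.flag I (Suc 0) (plus_ideal f I)" using mk by simp
  then obtain v where v: "plus_ideal f I = pv.adjoin v I"
    using pv.flag_SucD pv.flag_zeroD by blast
  then have "plus_ideal f I = pv.adjoin f I"
    using pv.adjoin_exchange[OF s _ f(3), of v] fT by simp
  moreover have "f \<star> f \<in> plus_ideal f I" using pideal_mult[OF T fT f(1)] .
  ultimately obtain c where c: "f \<star> f - smul c f \<in> I" unfolding pv.adjoin_def by blast
  have pow: "f [^]\<^bsub>pseries_ring\<^esub> Suc k - smul (c ^ k) f \<in> I" for k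
  proof (induction k)
    case 0
    have "f [^]\<^bsub>pseries_ring\<^esub> Suc 0 - smul (c ^ 0) f = 0" using f(1) by (intro ext) simp
    then show ?case using pv.subspace_0[OF s] by (simp only:)
  next
    case (Suc k)
    define g where "g = f [^]\<^bsub>pseries_ring\<^esub> Suc k"
    have "f \<star> (g - smul (c ^ k) f) + smul (c ^ k) (f \<star> f - smul c f) \<in> I"
      unfolding g_def
      using pv.subspace_add[OF s pideal_mult[OF I Suc f(1)] pv.subspace_scale[OF s c]] .
    also have "f \<star> (g - smul (c ^ k) f) + smul (c ^ k) (f \<star> f - smul c f)
        = g \<star> f - smul (c ^ Suc k) f"
      unfolding pmult_diff_right pmult_smul_right pv.scale_right_diff_distrib pv.scale_scale
      by (simp add: pmult_comm[of f g] mult.commute)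
    finally show ?case unfolding pr.nat_pow_Suc[of f "Suc k"] g_def .
  qed
  obtain N :: nat where N: "f [^]\<^bsub>pseries_ring\<^esub> N \<in> I" using nilpotent_mod_ideal[OF I two f(1,2)] by blast
  have "f [^]\<^bsub>pseries_ring\<^esub> Suc N \<in> I"
    using pideal_mult[OF I N f(1)] by (simp add: pmult_comm)
  then have "f [^]\<^bsub>pseries_ring\<^esub> Suc N - (f [^]\<^bsub>pseries_ring\<^esub> Suc N - smul (c ^ N) f) \<in> I"
    using pv.subspace_diff[OF s _ pow] by blast
  then have "smul (c ^ N) f \<in> I" by simp
  then have "smul (inverse (c ^ N)) (smul (c ^ N) f) \<in> I" using pv.subspace_scale[OF s] by blast
  then have "c ^ N = 0" using f(3) by (cases "c ^ N = 0") auto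
  then have z: "smul c f = 0" by (intro ext) simp
  show ?thesis using c unfolding z diff_0_right .
qed

text \<open>Let b be congruent to h (a + b) modulo \<open>K\<close>. Multiplying by b shows that h a
  b lies in \<open>K\<close>; multiplying by a + b shows that a b is congruent to 2 h a b.\<close>

lemma product_in_ideal_if_sum_divides:
  assumes K: "pideal K" and a: "a \<in> conv_series" "a \<star> a \<in> K" and b: "b \<in> conv_series" "b \<star> b \<in> K"
    and mem: "b \<in> plus_ideal (a + b) K"
  shows "a \<star> b \<in> K"
proof -
  have s: "pv.subspace K" using pideal_subspace[OF K] .
  obtain h where h: "h \<in> conv_series" "b - h \<star> (a + b) \<in> K"
    using mem mem_plus_ideal_iff[OF conv_add[OF a(1) b(1)] K] by blast
  have "(a + b) \<star> (b - h \<star> (a + b)) + (h \<star> (a \<star> a) + h \<star> (b \<star> b) - b \<star> b) + smul 2 (h \<star> (a \<star> b)) \<in> K"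
    if "h \<star> (a \<star> b) \<in> K"
    using that pideal_mult[OF K h(2) conv_add[OF a(1) b(1)]] pideal_mult[OF K a(2) h(1)] pideal_mult[OF K b(2) h(1)] b(2)
    by (intro pv.subspace_add[OF s] pv.subspace_diff[OF s] pv.subspace_scale[OF s])
  moreover have "(a + b) \<star> (b - h \<star> (a + b)) + (h \<star> (a \<star> a) + h \<star> (b \<star> b) - b \<star> b) + smul 2 (h \<star> (a \<star> b)) = a \<star> b"
  proof -
    have "a \<star> (h \<star> a) = h \<star> (a \<star> a)" "b \<star> (h \<star> b) = h \<star> (b \<star> b)"
      "a \<star> (h \<star> b) = h \<star> (a \<star> b)" "b \<star> (h \<star> a) = h \<star> (a \<star> b)"
      by (metis pmult_assoc pmult_comm)+
    then show ?thesis
      by (simp only: pmult_add_left pmult_add_right pmult_diff_right) (rule ext, simp)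
  qed
  moreover have "h \<star> (a \<star> b) \<in> K"
  proof -
    have "(b \<star> b - h \<star> (b \<star> b)) - b \<star> (b - h \<star> (a + b)) \<in> K"
      using pideal_mult[OF K h(2) b(1)] pideal_mult[OF K b(2) h(1)] b(2)
      by (intro pv.subspace_diff[OF s])
    moreover have "(b \<star> b - h \<star> (b \<star> b)) - b \<star> (b - h \<star> (a + b)) = h \<star> (a \<star> b)"
    proof -
      have "b \<star> (h \<star> b) = h \<star> (b \<star> b)" "b \<star> (h \<star> a) = h \<star> (a \<star> b)"
        by (metis pmult_assoc pmult_comm)+
      then show ?thesis
        by (simp only: pmult_add_right pmult_diff_right) (rule ext, simp)
    qed
    ultimately show ?thesis by metis
  qed
  ultimately show ?thesis by metis
qed

subsection \<open>Jacobian ideals\<close>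

lemma jacobian_generators_conv: "f \<in> conv_series \<Longrightarrow> range (\<lambda>i. pseries_deriv i f) \<subseteq> conv_series"
  using conv_deriv by blast

lemma pideal_jacobian: "f \<in> conv_series \<Longrightarrow> pideal (jacobian_ideal f)"
  unfolding jacobian_ideal_def by (rule pr.genideal_ideal[OF jacobian_generators_conv])

lemma deriv_mem_jacobian: "f \<in> conv_series \<Longrightarrow> pseries_deriv i f \<in> jacobian_ideal f"
  unfolding jacobian_ideal_def using pr.genideal_self[OF jacobian_generators_conv] by blast

lemma deriv_join_Inl:
  "pseries_deriv (Inl i) (pseries_inl f + pseries_inr g :: ('n::finite + 'm::finite) pseries)
    = pseries_inl (pseries_deriv i f)"
proof (rule join_series_eqI)
  fix \<alpha> :: "'n \<Rightarrow> nat" and \<beta> :: "'m \<Rightarrow> nat"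
  have "(case_sum \<alpha> \<beta>)(Inl i := Suc (\<alpha> i)) = case_sum (\<alpha>(i := Suc (\<alpha> i))) \<beta>"
    by (rule ext) (simp split: sum.split)
  \<comment> \<open>A positive exponent in the first variables excludes any contribution of
    \<open>pseries_inr g\<close>.\<close>
  moreover have "\<alpha>(i := Suc (\<alpha> i)) \<noteq> (\<lambda>_. 0)" by (metis fun_upd_same nat.distinct(1))
  ultimately show "pseries_deriv (Inl i) (pseries_inl f + pseries_inr g :: ('n + 'm) pseries) (case_sum \<alpha> \<beta>)
      = pseries_inl (pseries_deriv i f) (case_sum \<alpha> \<beta>)"
    by (simp add: pseries_deriv_def pseries_inl_case_sum pseries_inr_case_sum)
qed

lemma deriv_join_Inr:
  "pseries_deriv (Inr i) (pseries_inl f + pseries_inr g :: ('n::finite + 'm::finite) pseries)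
    = pseries_inr (pseries_deriv i g)"
proof (rule join_series_eqI)
  fix \<alpha> :: "'n \<Rightarrow> nat" and \<beta> :: "'m \<Rightarrow> nat"
  have "(case_sum \<alpha> \<beta>)(Inr i := Suc (\<beta> i)) = case_sum \<alpha> (\<beta>(i := Suc (\<beta> i)))"
    by (rule ext) (simp split: sum.split)
  moreover have "\<beta>(i := Suc (\<beta> i)) \<noteq> (\<lambda>_. 0)" by (metis fun_upd_same nat.distinct(1))
  ultimately show "pseries_deriv (Inr i) (pseries_inl f + pseries_inr g :: ('n + 'm) pseries) (case_sum \<alpha> \<beta>)
      = pseries_inr (pseries_deriv i g) (case_sum \<alpha> \<beta>)"
    by (simp add: pseries_deriv_def pseries_inl_case_sum pseries_inr_case_sum)
qed

text \<open>Reduces inclusions of Jacobian ideals in \<open>jacobian_join\<close> to their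
  generators, by minimality of the generated ideal.\<close>

lemma pideal_preimage:
  assumes K: "pideal K" and T: "Vector_Spaces.linear smul smul T" "\<And>f g. T (f \<star> g) = T f \<star> T g"
    "\<And>f. f \<in> conv_series \<Longrightarrow> T f \<in> conv_series"
  shows "pideal {f \<in> conv_series. T f \<in> K}"
proof -
  interpret T: Vector_Spaces.linear smul smul T by (rule T(1))
  have s: "pv.subspace K" using pideal_subspace[OF K] .
  show ?thesis
  proof (rule pidealI)
    show "0 \<in> {f \<in> conv_series. T f \<in> K}"
      unfolding mem_Collect_eq T.zero using conv_zero pv.subspace_0[OF s] by blast
    show "f + g \<in> {f \<in> conv_series. T f \<in> K}"
      if "f \<in> {f \<in> conv_series. T f \<in> K}" "g \<in> {f \<in> conv_series. T f \<in> K}" for f g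
      using that unfolding mem_Collect_eq T.add using conv_add pv.subspace_add[OF s] by blast
    show "h \<star> f \<in> {f \<in> conv_series. T f \<in> K}"
      if "f \<in> {f \<in> conv_series. T f \<in> K}" "h \<in> conv_series" for f h
      using that unfolding mem_Collect_eq T(2) using conv_mult pideal_mult[OF K] T(3) by blast
  qed auto
qed

lemma jacobian_join:
  assumes "f \<in> conv_series" "g \<in> conv_series"
  shows "jacobian_ideal (germ_join f g) = join_ideal (jacobian_ideal f) (jacobian_ideal g)"
proof -
  let ?F = "germ_join f g" and ?J1 = "jacobian_ideal f" and ?J2 = "jacobian_ideal g"
  have F: "?F = pseries_inl f + pseries_inr g" by (simp add: germ_join_def)
  have conv: "?F \<in> conv_series" unfolding F using assms by (intro conv_add conv_inl conv_inr)
  have J: "pideal ?J1" "pideal ?J2" "pideal (jacobian_ideal ?F)" using assms conv pideal_jacobian by blast+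
  show ?thesis
  proof (rule subset_antisym)
    show "jacobian_ideal ?F \<subseteq> join_ideal ?J1 ?J2"
      unfolding jacobian_ideal_def[of ?F]
    proof (rule pr.genideal_minimal[OF pideal_join[OF J(1,2)]], safe)
      fix i :: "'a + 'b"
      show "pseries_deriv i ?F \<in> join_ideal ?J1 ?J2"
      proof (cases i)
        case (Inl k)
        show ?thesis unfolding F Inl deriv_join_Inl
          by (intro inl_mem_join[OF J(1,2)] deriv_mem_jacobian assms)
      next
        case (Inr k)
        show ?thesis unfolding F Inr deriv_join_Inr
          by (intro inr_mem_join[OF J(1,2)] deriv_mem_jacobian assms)
      qed
    qed
    have "?J1 \<subseteq> {f \<in> conv_series. pseries_inl f \<in> jacobian_ideal ?F}"
      unfolding jacobian_ideal_def[of f]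
    proof (rule pr.genideal_minimal[OF pideal_preimage[OF J(3) linear_inl inl_mult conv_inl]], simp, safe)
      fix i
      show "pseries_deriv i f \<in> conv_series" using assms conv_deriv by blast
      show "pseries_inl (pseries_deriv i f) \<in> jacobian_ideal ?F"
        using deriv_mem_jacobian[OF conv, of "Inl i"] unfolding F deriv_join_Inl .
    qed
    moreover have "?J2 \<subseteq> {f \<in> conv_series. pseries_inr f \<in> jacobian_ideal ?F}"
      unfolding jacobian_ideal_def[of g]
    proof (rule pr.genideal_minimal[OF pideal_preimage[OF J(3) linear_inr inr_mult conv_inr]], simp, safe)
      fix i
      show "pseries_deriv i g \<in> conv_series" using assms conv_deriv by blast
      show "pseries_inr (pseries_deriv i g) \<in> jacobian_ideal ?F"
        using deriv_mem_jacobian[OF conv, of "Inr i"] unfolding F deriv_join_Inr .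
    qed
    ultimately show "join_ideal ?J1 ?J2 \<subseteq> jacobian_ideal ?F"
      unfolding join_ideal_def by (intro pr.genideal_minimal[OF J(3)]) auto
  qed
qed

lemma singularityD:
  assumes "isolated_hypersurface_singularity f"
  shows "f \<in> max_ideal" "jacobian_ideal f \<subseteq> max_ideal"
proof -
  show f: "f \<in> max_ideal"
    using assms by (auto simp: isolated_hypersurface_singularity_def pseries_eval_0 max_ideal_def)
  show "jacobian_ideal f \<subseteq> max_ideal"
    unfolding jacobian_ideal_def
    by (rule pr.genideal_minimal[OF pideal_max])
       (use assms f conv_deriv in \<open>auto simp: isolated_hypersurface_singularity_def pseries_eval_0 max_ideal_def\<close>)
qed

lemma codim_pos:
  fixes I :: "'k::finite pseries set"
  assumes "pv.flag I n conv_series" "I \<subseteq> max_ideal"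
  shows "n \<ge> 1"
proof (rule ccontr)
  assume "\<not> n \<ge> 1"
  then have "n = 0" by simp
  from pv.flag_zeroD[OF assms(1)[unfolded this]] have "(conv_series :: 'k pseries set) \<subseteq> max_ideal" using assms(2) by simp
  from subsetD[OF this conv_const[of 1]] show False by (simp add: pseries_const_def max_ideal_def)
qed

lemma nat_mult_eq_2_iff: "a * b = 2 \<longleftrightarrow> a = 1 \<and> b = 2 \<or> a = 2 \<and> b = 1" for a b :: nat
proof
  assume h: "a * b = 2"
  then have "a dvd 2" "b dvd 2" by (metis dvd_triv_left, metis dvd_triv_right)
  then have "a \<le> 2" "b \<le> 2" by (auto dest: dvd_imp_le)
  then show "a = 1 \<and> b = 2 \<or> a = 2 \<and> b = 1"
    using h by (auto simp: numeral_2_eq_2 le_Suc_eq)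
qed auto

section \<open>Codimensions for the join of two singularities\<close>

context
  fixes f1 :: "'n::finite pseries" and f2 :: "'m::finite pseries"
  assumes sing1: "isolated_hypersurface_singularity f1"
    and sing2: "isolated_hypersurface_singularity f2"
begin

private abbreviation "J1 \<equiv> jacobian_ideal f1"
private abbreviation "J2 \<equiv> jacobian_ideal f2"
private abbreviation "T1 \<equiv> plus_ideal f1 J1"
private abbreviation "T2 \<equiv> plus_ideal f2 J2"
private abbreviation "K \<equiv> join_ideal J1 J2"
private abbreviation a :: "('n + 'm) pseries" where "a \<equiv> pseries_inl f1"
private abbreviation b :: "('n + 'm) pseries" where "b \<equiv> pseries_inr f2"

private lemma f1: "f1 \<in> conv_series" "f1 \<in> max_ideal" "J1 \<subseteq> max_ideal"
  using singularityD[OF sing1] by (auto simp: max_ideal_def)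

private lemma f2: "f2 \<in> conv_series" "f2 \<in> max_ideal" "J2 \<subseteq> max_ideal"
  using singularityD[OF sing2] by (auto simp: max_ideal_def)

private lemma ideals: "pideal J1" "pideal J2" "pideal T1" "pideal T2" "pideal K"
  by (intro pideal_plus pideal_join pideal_jacobian f1(1) f2(1))+

private lemma conv_ab: "a \<in> conv_series" "b \<in> conv_series" "a + b \<in> conv_series"
  using f1 f2 by (auto intro!: conv_add conv_inl conv_inr)

private lemma join_eq: "germ_join f1 f2 = a + b"
  by (simp add: germ_join_def)

private lemma milnor_join: "milnor_number (germ_join f1 f2) = quotient_dim K"
  unfolding milnor_number_def jacobian_join[OF f1(1) f2(1)] ..

private lemma tjurina_join: "tjurina_number (germ_join f1 f2) = quotient_dim (plus_ideal (a + b) K)"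
  unfolding tjurina_number_def jacobian_join[OF f1(1) f2(1)] by (simp only: join_eq)

text \<open>\<open>J1\<close> and \<open>J2\<close> are the preimages of \<open>K\<close> under the
  two inclusions, so finite codimension of \<open>K\<close> would pass to both.\<close>

lemma milnor_join_infinite:
  assumes "(\<nexists>n. pv.flag J1 n conv_series) \<or> (\<nexists>n. pv.flag J2 n conv_series)"
  shows "milnor_number (germ_join f1 f2) = 0"
proof -
  have "\<nexists>n. pv.flag K n conv_series"
    using assms
      finite_codim_preimage[OF ideals(1,5) linear_inl conv_inl inl_mem_join_iff[OF ideals(1,2) f2(3)]]
      finite_codim_preimage[OF ideals(2,5) linear_inr conv_inr inr_mem_join_iff[OF ideals(1,2) f1(3)]]
    by blast
  then show ?thesis unfolding milnor_join by (rule quotient_dim_infinite[OF ideals(5)])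
qed

context
  fixes p q t1 t2 c
  assumes p: "pv.flag J1 p conv_series" and q: "pv.flag J2 q conv_series"
    and t1: "pv.flag T1 t1 conv_series" and t2: "pv.flag T2 t2 conv_series"
    and c: "pv.flag (plus_ideal (a + b) K) c conv_series"
begin

text \<open>Each ideal is the join of \<open>J1\<close> or \<open>T1\<close> with \<open>J2\<close>
  or \<open>T2\<close>. The last two are both the join of \<open>T1\<close> and \<open>T2\<close>;
  each bound below adjoins the two germs in its own order.\<close>

private lemma codims:
  "pv.flag K (p * q) conv_series"
  "pv.flag (plus_ideal b K) (p * t2) conv_series"
  "pv.flag (plus_ideal a K) (t1 * q) conv_series"
  "pv.flag (plus_ideal a (plus_ideal b K)) (t1 * t2) conv_series"
  "pv.flag (plus_ideal b (plus_ideal a K)) (t1 * t2) conv_series"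
  unfolding join_plus_left[OF f1(1) ideals(1,2), symmetric] join_plus_right[OF f2(1) ideals(1,2), symmetric]
    join_plus_left[OF f1(1) ideals(1,4), symmetric] join_plus_right[OF f2(1) ideals(3,2), symmetric]
  using codim_join ideals p q t1 t2 by blast+

lemma codim_join_if_left_in_jacobian: "f1 \<in> J1 \<Longrightarrow> c = p * t2"
proof -
  assume "f1 \<in> J1"
  then have "a \<in> K" by (rule inl_mem_join[OF ideals(1,2)])
  then have "plus_ideal (a + b) K = plus_ideal b K"
    using conv_ab ideals by (intro plus_ideal_cong) auto
  then show "c = p * t2"
    using pv.flag_unique[OF _ codims(2) pideal_subspace[OF pideal_plus[OF conv_ab(2) ideals(5)]]] c by simp
qed

lemma codim_join_if_right_in_jacobian: "f2 \<in> J2 \<Longrightarrow> c = t1 * q"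
proof -
  assume "f2 \<in> J2"
  then have "b \<in> K" by (rule inr_mem_join[OF ideals(1,2)])
  then have "plus_ideal (a + b) K = plus_ideal a K"
    using conv_ab ideals by (intro plus_ideal_cong) auto
  then show "c = t1 * q"
    using pv.flag_unique[OF _ codims(3) pideal_subspace[OF pideal_plus[OF conv_ab(1) ideals(5)]]] c by simp
qed

lemma codim_join_bound_left:
  assumes "f1 \<notin> J1" "f2 \<notin> J2" shows "c + 1 + p * t2 \<le> p * q + t1 * t2"
proof -
  obtain k where k: "f2 [^]\<^bsub>pseries_ring\<^esub> Suc k \<notin> J2" "f2 [^]\<^bsub>pseries_ring\<^esub> Suc (Suc k) \<in> J2"
    using last_nonzero_power[OF ideals(2) f2(3) q f2(2) assms(2)] by blast
  define g where "g = f2 [^]\<^bsub>pseries_ring\<^esub> Suc k"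
  define z where "z = a \<star> pseries_inr g"
  have g: "g \<in> conv_series" unfolding g_def using f2(1) by (rule pr.nat_pow_closed)
  have gb: "pseries_inr g \<star> b \<in> K"
    using inr_mem_join[OF ideals(1,2) k(2)] by (simp add: g_def inr_mult)
  show ?thesis
  proof (rule codim_drop_bound[OF ideals(5) conv_ab(1,2) _ _ _ codims(1,2,4) c])
    show "z \<notin> K" unfolding z_def
      using inl_mult_inr_notin_join[OF ideals(1,2) q assms(1) g] k(1) by (simp add: g_def)
    \<comment> \<open>\<open>pseries_inr g \<star> b\<close> is the image of f2^(k+2), which lies in
      \<open>J2\<close>.\<close>
    have "z - pseries_inr g \<star> (a + b) = - (pseries_inr g \<star> b)"
      unfolding z_def by (simp add: pmult_add_right pmult_comm)
    then have "z - pseries_inr g \<star> (a + b) \<in> K"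
      using pv.subspace_neg[OF pideal_subspace[OF ideals(5)] gb] by (simp only:)
    then show "z \<in> plus_ideal (a + b) K"
      unfolding mem_plus_ideal_iff[OF conv_ab(3) ideals(5)] using conv_inr[OF g] by blast
    \<comment> \<open>The exponent of \<open>g\<close> is positive, so a factor \<open>b\<close>
      splits off from \<open>z\<close>.\<close>
    have h: "f2 [^]\<^bsub>pseries_ring\<^esub> k \<in> conv_series" using f2(1) by (rule pr.nat_pow_closed)
    have bK: "b \<in> plus_ideal b K" using mem_plus_ideal[OF conv_ab(2) ideals(5)] .
    have "(a \<star> pseries_inr (f2 [^]\<^bsub>pseries_ring\<^esub> k)) \<star> b \<in> plus_ideal b K"
      by (rule pideal_mult[OF pideal_plus[OF conv_ab(2) ideals(5)] bK conv_mult[OF conv_ab(1) conv_inr[OF h]]])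
    then show "z \<in> plus_ideal b K"
      unfolding z_def g_def pr.nat_pow_Suc inr_mult pmult_assoc .
  qed
qed

text \<open>The bound with the two germs exchanged, proved anew because exchanging them would change
  the index type of the join.\<close>

lemma codim_join_bound_right:
  assumes "f1 \<notin> J1" "f2 \<notin> J2" shows "c + 1 + t1 * q \<le> p * q + t1 * t2"
proof -
  obtain k where k: "f1 [^]\<^bsub>pseries_ring\<^esub> Suc k \<notin> J1" "f1 [^]\<^bsub>pseries_ring\<^esub> Suc (Suc k) \<in> J1"
    using last_nonzero_power[OF ideals(1) f1(3) p f1(2) assms(1)] by blast
  define g where "g = f1 [^]\<^bsub>pseries_ring\<^esub> Suc k"
  define z where "z = pseries_inl g \<star> b"
  have g: "g \<in> conv_series" unfolding g_def using f1(1) by (rule pr.nat_pow_closed)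
  have ga: "pseries_inl g \<star> a \<in> K"
    using inl_mem_join[OF ideals(1,2) k(2)] by (simp add: g_def inl_mult)
  have c': "pv.flag (plus_ideal (b + a) K) c conv_series" using c by (simp only: add.commute)
  have ba: "b + a \<in> conv_series" using conv_ab(3) by (simp only: add.commute)
  show ?thesis
  proof (rule codim_drop_bound[OF ideals(5) conv_ab(2,1) _ _ _ codims(1,3,5) c'])
    show "z \<notin> K" unfolding z_def
      using inl_mult_inr_notin_join[OF ideals(1,2) q _ f2(1) assms(2), of g] k(1) by (simp add: g_def)
    have "z - pseries_inl g \<star> (b + a) = - (pseries_inl g \<star> a)"
      unfolding z_def by (simp add: pmult_add_right)
    then have "z - pseries_inl g \<star> (b + a) \<in> K"
      using pv.subspace_neg[OF pideal_subspace[OF ideals(5)] ga] by (simp only:)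
    then show "z \<in> plus_ideal (b + a) K"
      unfolding mem_plus_ideal_iff[OF ba ideals(5)] using conv_inl[OF g] by blast
    have h: "f1 [^]\<^bsub>pseries_ring\<^esub> k \<in> conv_series" using f1(1) by (rule pr.nat_pow_closed)
    have aK: "a \<in> plus_ideal a K" using mem_plus_ideal[OF conv_ab(1) ideals(5)] .
    have "(b \<star> pseries_inl (f1 [^]\<^bsub>pseries_ring\<^esub> k)) \<star> a \<in> plus_ideal a K"
      by (rule pideal_mult[OF pideal_plus[OF conv_ab(1) ideals(5)] aK conv_mult[OF conv_ab(2) conv_inl[OF h]]])
    then show "z \<in> plus_ideal a K"
      unfolding z_def g_def pr.nat_pow_Suc inl_mult pmult_assoc pmult_comm[of _ b] .
  qed
qed

text \<open>The upper bound is c + 1 + 2 \<le> 4 + 1. For the lower one, \<open>?S\<close> has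
  codimension \<open>t1 * t2 = 1\<close> and contains \<open>?I\<close> properly.\<close>

lemma codim_join_two:
  assumes "p = 2" "q = 2" "t1 = 1" "t2 = 1" shows "c = 2"
proof -
  \<comment> \<open>If \<open>f1\<close> were in \<open>J1\<close>, then \<open>T1\<close> would
    equal \<open>J1\<close>, but their codimensions are 1 and 2; likewise for
    \<open>f2\<close>.\<close>
  have ne: "f1 \<notin> J1" "f2 \<notin> J2"
    using pv.flag_unique[OF p _ pideal_subspace[OF ideals(1)]] t1 plus_ideal_absorb[OF _ ideals(1)]
      pv.flag_unique[OF q _ pideal_subspace[OF ideals(2)]] t2 plus_ideal_absorb[OF _ ideals(2)] assms
    by fastforce+
  have "c \<le> 2" using codim_join_bound_left[OF ne] assms by simp
  have sq: "f1 \<star> f1 \<in> J1" "f2 \<star> f2 \<in> J2"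
    using square_in_ideal[OF ideals(1) _ f1(2) ne(1)] square_in_ideal[OF ideals(2) _ f2(2) ne(2)]
      p q t1 t2 unfolding assms by blast+
  have aa: "a \<star> a \<in> K" using inl_mem_join[OF ideals(1,2) sq(1)] by (simp only: inl_mult)
  have bb: "b \<star> b \<in> K" using inr_mem_join[OF ideals(1,2) sq(2)] by (simp only: inr_mult)
  let ?I = "plus_ideal (a + b) K" and ?S = "plus_ideal a (plus_ideal b K)"
  have I: "pideal ?I" and S: "pideal ?S" using ideals conv_ab pideal_plus by blast+
  have bK: "pideal (plus_ideal b K)" using ideals conv_ab pideal_plus by blast
  have KS: "K \<subseteq> ?S"
    using subset_plus_ideal[OF conv_ab(2) ideals(5)] subset_plus_ideal[OF conv_ab(1) bK] by blast
  have aS: "a \<in> ?S" using mem_plus_ideal[OF conv_ab(1) bK] .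
  have bS: "b \<in> ?S"
    using mem_plus_ideal[OF conv_ab(2) ideals(5)] subset_plus_ideal[OF conv_ab(1) bK] by blast
  have IS: "?I \<subseteq> ?S"
    by (intro plus_ideal_minimal conv_ab ideals S KS pv.subspace_add[OF pideal_subspace[OF S]] aS bS)
  obtain m where m: "pv.flag ?S m conv_series" "m \<le> c" "m = c \<Longrightarrow> ?S = ?I"
    using pv.flag_codim_mono[OF c pideal_subspace[OF I] pideal_subspace[OF S] IS pideal_conv[OF S]] by blast
  have "m = 1" using pv.flag_unique[OF m(1) codims(4) pideal_subspace[OF S]] assms by simp
  have "?S \<noteq> ?I"
  proof
    assume "?S = ?I"
    then have "a \<star> b \<in> K"
      using product_in_ideal_if_sum_divides[OF ideals(5) conv_ab(1) aa conv_ab(2) bb] bS by simp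
    then show False using inl_mult_inr_notin_join[OF ideals(1,2) q ne(1) f2(1) ne(2)] by simp
  qed
  then show "c = 2" using m \<open>m = 1\<close> \<open>c \<le> 2\<close> by fastforce
qed

end

text \<open>Supplies the flags assumed above and the inequalities for the final count: the Tjurina
  ideals contain the Jacobian ideals and lie in the maximal ideal.\<close>

lemma tjurina_le_milnor_finite:
  assumes "pv.flag J1 p conv_series" "pv.flag J2 q conv_series"
  obtains t1 t2 c where "pv.flag T1 t1 conv_series" "pv.flag T2 t2 conv_series"
    "pv.flag (plus_ideal (a + b) K) c conv_series" "1 \<le> t1" "1 \<le> t2"
    "t1 \<le> p" "t2 \<le> q" "t1 = p \<longleftrightarrow> f1 \<in> J1" "t2 = q \<longleftrightarrow> f2 \<in> J2"
proof -
  have s: "pv.subspace J1" "pv.subspace J2" "pv.subspace K" using ideals pideal_subspace by blast+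
  obtain t1 where t1: "pv.flag T1 t1 conv_series" "t1 \<le> p" "t1 = p \<Longrightarrow> T1 = J1"
    using pv.flag_codim_mono[OF assms(1) s(1) pideal_subspace[OF ideals(3)]
        subset_plus_ideal[OF f1(1) ideals(1)] pideal_conv[OF ideals(3)]] by blast
  obtain t2 where t2: "pv.flag T2 t2 conv_series" "t2 \<le> q" "t2 = q \<Longrightarrow> T2 = J2"
    using pv.flag_codim_mono[OF assms(2) s(2) pideal_subspace[OF ideals(4)]
        subset_plus_ideal[OF f2(1) ideals(2)] pideal_conv[OF ideals(4)]] by blast
  have I: "pideal (plus_ideal (a + b) K)" using conv_ab ideals pideal_plus by blast
  obtain c where c: "pv.flag (plus_ideal (a + b) K) c conv_series"
    using pv.flag_codim_mono[OF codim_join[OF ideals(1,2) assms] s(3) pideal_subspace[OF I]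
        subset_plus_ideal[OF conv_ab(3) ideals(5)] pideal_conv[OF I]] by blast
  have e1: "t1 = p \<longleftrightarrow> f1 \<in> J1"
  proof
    show "f1 \<in> J1" if "t1 = p" using t1(3)[OF that] mem_plus_ideal[OF f1(1) ideals(1)] by simp
    show "t1 = p" if "f1 \<in> J1"
      using pv.flag_unique[OF _ assms(1) s(1)] t1(1) plus_ideal_absorb[OF that ideals(1)] by simp
  qed
  have e2: "t2 = q \<longleftrightarrow> f2 \<in> J2"
  proof
    show "f2 \<in> J2" if "t2 = q" using t2(3)[OF that] mem_plus_ideal[OF f2(1) ideals(2)] by simp
    show "t2 = q" if "f2 \<in> J2"
      using pv.flag_unique[OF _ assms(2) s(2)] t2(1) plus_ideal_absorb[OF that ideals(2)] by simp
  qed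
  have "1 \<le> t1" "1 \<le> t2"
    using codim_pos[OF t1(1)] plus_ideal_minimal[OF f1(1) ideals(1) pideal_max f1(3,2)]
      codim_pos[OF t2(1)] plus_ideal_minimal[OF f2(1) ideals(2) pideal_max f2(3,2)] by blast+
  then show thesis using that t1 t2 c e1 e2 by blast
qed

lemma join_numbers:
  assumes p: "pv.flag J1 p conv_series" and q: "pv.flag J2 q conv_series"
    and t1: "pv.flag T1 t1 conv_series" and t2: "pv.flag T2 t2 conv_series"
    and c: "pv.flag (plus_ideal (a + b) K) c conv_series"
  shows "milnor_number f1 = p" "milnor_number f2 = q" "tjurina_number f1 = t1" "tjurina_number f2 = t2"
    "milnor_number (germ_join f1 f2) = p * q" "tjurina_number (germ_join f1 f2) = c"
  unfolding milnor_join tjurina_join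
  unfolding milnor_number_def tjurina_number_def
  by (rule quotient_dim_eq ideals pideal_plus conv_ab codim_join assms)+

end

theorem corollary3:
  fixes f1 :: "'n::finite pseries" and f2 :: "'m::finite pseries"
  assumes "isolated_hypersurface_singularity f1"
    and "isolated_hypersurface_singularity f2"
  shows "(int (tjurina_number (germ_join f1 f2)) = int (milnor_number (germ_join f1 f2)) - 1 \<longleftrightarrow>
        (milnor_number f1 = 1 \<and> tjurina_number f1 = 1 \<and>
           int (milnor_number f2) - 1 = int (tjurina_number f2))
      \<or> (milnor_number f2 = 1 \<and> tjurina_number f2 = 1 \<and>
           int (milnor_number f1) - 1 = int (tjurina_number f1)))
    \<and> (int (tjurina_number (germ_join f1 f2)) = int (milnor_number (germ_join f1 f2)) - 2 \<longleftrightarrow>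
        (milnor_number f1 = 1 \<and> tjurina_number f1 = 1 \<and>
           int (milnor_number f2) - 2 = int (tjurina_number f2))
      \<or> (milnor_number f2 = 1 \<and> tjurina_number f2 = 1 \<and>
           int (milnor_number f1) - 2 = int (tjurina_number f1))
      \<or> (milnor_number f1 = 2 \<and> milnor_number f2 = 2 \<and>
           tjurina_number f1 = 1 \<and> tjurina_number f2 = 1)
      \<or> (milnor_number f1 = 2 \<and> tjurina_number f1 = 2 \<and>
           int (milnor_number f2) - 1 = int (tjurina_number f2))
      \<or> (milnor_number f2 = 2 \<and> tjurina_number f2 = 2 \<and>
           int (milnor_number f1) - 1 = int (tjurina_number f1)))"
proof (cases "(\<exists>n. pv.flag (jacobian_ideal f1) n conv_series) \<and> (\<exists>n. pv.flag (jacobian_ideal f2) n conv_series)")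
  case False
  then have inf: "(\<nexists>n. pv.flag (jacobian_ideal f1) n conv_series) \<or> (\<nexists>n. pv.flag (jacobian_ideal f2) n conv_series)"
    by blast
  have J: "pideal (jacobian_ideal f1)" "pideal (jacobian_ideal f2)"
    using assms by (auto intro!: pideal_jacobian simp: isolated_hypersurface_singularity_def)
  have "milnor_number f1 = 0 \<or> milnor_number f2 = 0"
    unfolding milnor_number_def
    using inf quotient_dim_infinite[OF J(1)] quotient_dim_infinite[OF J(2)] by (elim disjE) simp_all
  moreover have "milnor_number (germ_join f1 f2) = 0"
    using milnor_join_infinite[OF assms inf] .
  \<comment> \<open>With these Milnor numbers 0, each left side needs a negative Tjurina number, and
    each case on the right needs one too or prescribes a Milnor number 1 or 2 that is 0.\<close>
  ultimately show ?thesis by auto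
next
  case True
  then obtain p q where p: "pv.flag (jacobian_ideal f1) p conv_series"
    and q: "pv.flag (jacobian_ideal f2) q conv_series" by blast
  from tjurina_le_milnor_finite[OF assms p q] obtain t1 t2 c where
    t1: "pv.flag (plus_ideal f1 (jacobian_ideal f1)) t1 conv_series" and
    t2: "pv.flag (plus_ideal f2 (jacobian_ideal f2)) t2 conv_series" and
    c: "pv.flag (plus_ideal (pseries_inl f1 + pseries_inr f2)
          (join_ideal (jacobian_ideal f1) (jacobian_ideal f2))) c conv_series" and
    le: "1 \<le> t1" "1 \<le> t2" "t1 \<le> p" "t2 \<le> q" and
    iff: "t1 = p \<longleftrightarrow> f1 \<in> jacobian_ideal f1" "t2 = q \<longleftrightarrow> f2 \<in> jacobian_ideal f2"
    by blast
  note numbers = join_numbers[OF assms p q t1 t2 c]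
  \<comment> \<open>\<open>r\<close> and \<open>s\<close> are the differences of Milnor and Tjurina
    numbers; \<open>r = 0\<close> means that \<open>f1\<close> lies in its Jacobian ideal.\<close>
  obtain r s where rs: "p = t1 + r" "q = t2 + s" using le by (metis le_Suc_ex)
  consider "r = 0" | "s = 0" | "r > 0" "s > 0" by blast
  then show ?thesis
  proof cases
    case 1
    then have "c = p * t2" using codim_join_if_left_in_jacobian[OF assms p q t1 t2 c] iff rs by simp
    \<comment> \<open>The drop is p q - p t2 = p s; keeping \<open>k\<close> general serves both
      parts.\<close>
    then have "int c = int (p * q) - k \<longleftrightarrow> int (p * s) = k" for k
      by (auto simp: rs(2) algebra_simps)
    then have "int c = int (p * q) - 1 \<longleftrightarrow> p * s = 1" "int c = int (p * q) - 2 \<longleftrightarrow> p * s = 2"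
      by (metis of_nat_1 of_nat_eq_iff, metis of_nat_numeral of_nat_eq_iff)
    then show ?thesis unfolding numbers nat_mult_eq_2_iff nat_mult_eq_1_iff using 1 rs le by auto
  next
    case 2
    then have "c = t1 * q" using codim_join_if_right_in_jacobian[OF assms p q t1 t2 c] iff rs by simp
    then have "int c = int (p * q) - k \<longleftrightarrow> int (r * q) = k" for k
      by (auto simp: rs(1) algebra_simps)
    then have "int c = int (p * q) - 1 \<longleftrightarrow> r * q = 1" "int c = int (p * q) - 2 \<longleftrightarrow> r * q = 2"
      by (metis of_nat_1 of_nat_eq_iff, metis of_nat_numeral of_nat_eq_iff)
    then show ?thesis unfolding numbers nat_mult_eq_2_iff nat_mult_eq_1_iff using 2 rs le by auto
  next
    case 3
    then have ne: "f1 \<notin> jacobian_ideal f1" "f2 \<notin> jacobian_ideal f2" using iff rs by auto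
    \<comment> \<open>The term t1 t2 cancels, since p t2 = t1 t2 + r t2 and t1 q = t1 t2 + t1
      s.\<close>
    have "c + 1 + r * t2 \<le> p * q" "c + 1 + t1 * s \<le> p * q"
      using codim_join_bound_left[OF assms p q t1 t2 c ne] codim_join_bound_right[OF assms p q t1 t2 c ne]
      unfolding rs by (auto simp: algebra_simps)
    moreover have "r * t2 \<ge> 1" "t1 * s \<ge> 1" using 3 le by (auto simp: Suc_le_eq)
    ultimately have one: "int c \<noteq> int (p * q) - 1"
      and two: "int c = int (p * q) - 2 \<Longrightarrow> r * t2 = 1 \<and> t1 * s = 1"
      by linarith+
    have "p = 2 \<and> q = 2 \<and> t1 = 1 \<and> t2 = 1" if "int c = int (p * q) - 2"
      using two[OF that] unfolding rs nat_mult_eq_1_iff by simp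
    moreover have "int c = int (p * q) - 2" if "p = 2 \<and> q = 2 \<and> t1 = 1 \<and> t2 = 1"
      using codim_join_two[OF assms p q t1 t2 c] that by simp
    \<comment> \<open>Every case of the theorem except (c) requires equal Milnor and Tjurina numbers
      for one of the germs.\<close>
    moreover have "p \<noteq> t1" "q \<noteq> t2" using 3 rs by simp_all
    ultimately show ?thesis unfolding numbers using one by metis
  qed
qed

end
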